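(* Let $k$ be an algebraically closed field of characteristic $0$ and fix $(q,p)\in k^2$ satisfying $p^2=q^2+q^3$. Let $A$ be the unital associative $k$-algebra with generators $x,y,a,a^{-1},b$ and defining relations $$aa^{-1}=a^{-1}a=1,\qquad y^2=x^2+x^3,\qquad b^2=a^3,$$ $$ba=ab,\qquad ya=ay,\qquad bx=xb,\qquad yx=xy,\qquad by=-yb+2pb^2,$$ $$a^2x=-xa^2-axa-a^2+(1+3q)a^3,$$ $$ax^2=-ax-xa-x^2a-xax+(2+3q)q\,a^3.$$ Then $A$ admits a Hopf algebra structure whose coproduct $\Delta$, counit $\varepsilon$ and antipode $S$ satisfy $$\Delta(x)=1\otimes(x-qa)+x\otimes a,\qquad \Delta(y)=1\otimes(y-pb)+y\otimes b,$$ $$\Delta(a)=a\otimes a,\qquad \Delta(b)=b\otimes b,\qquad \varepsilon(x)=q,\qquad \varepsilon(y)=p,\qquad \varepsilon(a)=\varepsilon(b)=1,$$ $$S(x)=q-(x-q)a^{-1},\qquad S(y)=p-(y-p)b^{-1},\qquad S(a)=a^{-1},\qquad S(b)=b^{-1}.$$ Furthermore, let $B\subset A$ be the subalgebra generated by $x,y$, which is a right coideal subalgebra of $A$. Then $B$ is the coordinate ring of the nodal cubic (that is, the canonical map $k[X,Y]/(Y^2-X^2-X^3)\to B$, $X\mapsto x$, $Y\mapsto y$, is an isomorphism of algebras), and $A$ is free, and in particular faithfully flat, as a left $B$-module.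
   Context: A right coideal subalgebra of a Hopf algebra $A$ is a subalgebra $B\subset A$ with $\Delta(B)\subset B\otimes A$. The paper calls a right coideal subalgebra $B$ of a Hopf algebra $A$ a quantum homogeneous space if $A$ is faithfully flat as a left $B$-module. The nodal cubic is the affine plane curve with equation $y^2=x^2+x^3$. The element $b$ is invertible in $A$ since $b^2=a^3$ and $a$ is invertible and commutes with $b$; $b^{-1}=a^{-3}b$. *)

theory Defs
  imports
    "HOL-Algebra.Algebra"
    "HOL-Algebra.Algebraic_Closure_Type"
    "HOL-Library.Poly_Mapping"
    "HOL-Computational_Algebra.Polynomial"
begin

section \<open>Modules and algebras over a commutative ring\<close>

text \<open>The locale \<^locale>\<open>algebra\<close> of the library is about commutative algebras.\<close>

locale associative_algebra = module + ring M +
  assumes smult_mult_left: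
      "\<lbrakk>r \<in> carrier R; x \<in> carrier M; y \<in> carrier M\<rbrakk> \<Longrightarrow>
        (r \<odot>\<^bsub>M\<^esub> x) \<otimes>\<^bsub>M\<^esub> y = r \<odot>\<^bsub>M\<^esub> (x \<otimes>\<^bsub>M\<^esub> y)"
    and smult_mult_right:
      "\<lbrakk>r \<in> carrier R; x \<in> carrier M; y \<in> carrier M\<rbrakk> \<Longrightarrow>
        x \<otimes>\<^bsub>M\<^esub> (r \<odot>\<^bsub>M\<^esub> y) = r \<odot>\<^bsub>M\<^esub> (x \<otimes>\<^bsub>M\<^esub> y)"

definition module_homs ::
    "('r, 'c) ring_scheme \<Rightarrow> ('r, 'm, 'd) module_scheme \<Rightarrow> ('r, 'n, 'e) module_scheme \<Rightarrow> ('m \<Rightarrow> 'n) set" where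
  "module_homs R M N =
    {f \<in> carrier M \<rightarrow> carrier N.
      (\<forall>x\<in>carrier M. \<forall>y\<in>carrier M. f (x \<oplus>\<^bsub>M\<^esub> y) = f x \<oplus>\<^bsub>N\<^esub> f y) \<and>
      (\<forall>r\<in>carrier R. \<forall>x\<in>carrier M. f (r \<odot>\<^bsub>M\<^esub> x) = r \<odot>\<^bsub>N\<^esub> f x)}"

definition algebra_homs ::
    "('r, 'c) ring_scheme \<Rightarrow> ('r, 'a, 'd) module_scheme \<Rightarrow> ('r, 'b, 'e) module_scheme \<Rightarrow> ('a \<Rightarrow> 'b) set" where
  "algebra_homs R A B = ring_hom A B \<inter> module_homs R A B"

definition algebra_isos ::
    "('r, 'c) ring_scheme \<Rightarrow> ('r, 'a, 'd) module_scheme \<Rightarrow> ('r, 'b, 'e) module_scheme \<Rightarrow> ('a \<Rightarrow> 'b) set" where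
  "algebra_isos R A B = {f \<in> algebra_homs R A B. bij_betw f (carrier A) (carrier B)}"

definition is_subalgebra ::
    "('r, 'c) ring_scheme \<Rightarrow> 'a set \<Rightarrow> ('r, 'a, 'd) module_scheme \<Rightarrow> bool" where
  "is_subalgebra R B A \<longleftrightarrow> subring B A \<and> submodule B R A"

definition generated_subalgebra ::
    "('r, 'c) ring_scheme \<Rightarrow> ('r, 'a, 'd) module_scheme \<Rightarrow> 'a set \<Rightarrow> 'a set" where
  "generated_subalgebra R A S = \<Inter>{B. is_subalgebra R B A \<and> S \<subseteq> B}"

definition quotient_algebra ::
    "('r, 'a, 'd) module_scheme \<Rightarrow> 'a set \<Rightarrow> ('r, 'a set) module" where
  "quotient_algebra A I =
    \<lparr>carrier = carrier (A Quot I),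
     monoid.mult = monoid.mult (A Quot I),
     one = \<one>\<^bsub>A Quot I\<^esub>,
     ring.zero = \<zero>\<^bsub>A Quot I\<^esub>,
     add = add (A Quot I),
     module.smult = (\<lambda>r C. \<Union>x\<in>C. I +>\<^bsub>A\<^esub> (r \<odot>\<^bsub>A\<^esub> x))\<rparr>"

text \<open>A ring as a left module over itself. With \<open>A\<lparr>carrier := B\<rparr>\<close> as ring of scalars, this is
  also \<open>A\<close> as a left module over a subring \<open>B\<close>.\<close>

definition regular_module :: "('a, 'c) ring_scheme \<Rightarrow> ('a, 'a) module" where
  "regular_module A =
    \<lparr>carrier = carrier A, monoid.mult = monoid.mult A, one = \<one>\<^bsub>A\<^esub>,
     ring.zero = \<zero>\<^bsub>A\<^esub>, add = add A, module.smult = monoid.mult A\<rparr>"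

definition algebra_of_type :: "('r \<Rightarrow> 'a \<Rightarrow> 'a) \<Rightarrow> ('r, 'a::ring_1) module" where
  "algebra_of_type s =
    \<lparr>carrier = UNIV, monoid.mult = (*), one = 1, ring.zero = 0, add = (+), module.smult = s\<rparr>"


section \<open>Tensor products\<close>

definition tensor_relations ::
    "('r, 'c) ring_scheme \<Rightarrow> ('r, 'm, 'd) module_scheme \<Rightarrow> ('r, 'n, 'e) module_scheme
      \<Rightarrow> ('m \<times> 'n \<Rightarrow>\<^sub>0 int) set" where
  "tensor_relations R M N =
    {frag_of (x \<oplus>\<^bsub>M\<^esub> x', y) - frag_of (x, y) - frag_of (x', y) | x x' y.
        x \<in> carrier M \<and> x' \<in> carrier M \<and> y \<in> carrier N}
    \<union> {frag_of (x, y \<oplus>\<^bsub>N\<^esub> y') - frag_of (x, y) - frag_of (x, y') | x y y'.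
        x \<in> carrier M \<and> y \<in> carrier N \<and> y' \<in> carrier N}
    \<union> {frag_of (r \<odot>\<^bsub>M\<^esub> x, y) - frag_of (x, r \<odot>\<^bsub>N\<^esub> y) | r x y.
        r \<in> carrier R \<and> x \<in> carrier M \<and> y \<in> carrier N}"

definition tensor_null ::
    "('r, 'c) ring_scheme \<Rightarrow> ('r, 'm, 'd) module_scheme \<Rightarrow> ('r, 'n, 'e) module_scheme
      \<Rightarrow> ('m \<times> 'n \<Rightarrow>\<^sub>0 int) set" where
  "tensor_null R M N =
    generate (free_Abelian_group (carrier M \<times> carrier N)) (tensor_relations R M N)"

definition tensor_group ::
    "('r, 'c) ring_scheme \<Rightarrow> ('r, 'm, 'd) module_scheme \<Rightarrow> ('r, 'n, 'e) module_scheme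
      \<Rightarrow> ('m \<times> 'n \<Rightarrow>\<^sub>0 int) set monoid" where
  "tensor_group R M N =
    free_Abelian_group (carrier M \<times> carrier N) Mod tensor_null R M N"

definition pure_tensor ::
    "('r, 'c) ring_scheme \<Rightarrow> ('r, 'm, 'd) module_scheme \<Rightarrow> ('r, 'n, 'e) module_scheme
      \<Rightarrow> 'm \<Rightarrow> 'n \<Rightarrow> ('m \<times> 'n \<Rightarrow>\<^sub>0 int) set" where
  "pure_tensor R M N x y =
    tensor_null R M N #>\<^bsub>free_Abelian_group (carrier M \<times> carrier N)\<^esub> frag_of (x, y)"

text \<open>The homomorphism from a tensor product to a commutative group \<open>G\<close> (written multiplicatively)
  that sends \<open>pure_tensor R M N x y\<close> to \<open>\<beta> x y\<close>. The value does not depend on the choice of the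
  representative \<open>c\<close> when \<open>\<beta>\<close> is balanced and biadditive; it is only used for such \<open>\<beta>\<close>.\<close>

definition tensor_lift ::
    "('g, 'e) monoid_scheme \<Rightarrow> ('m \<Rightarrow> 'n \<Rightarrow> 'g) \<Rightarrow> ('m \<times> 'n \<Rightarrow>\<^sub>0 int) set \<Rightarrow> 'g" where
  "tensor_lift G \<beta> t =
    (let c = (SOME c. c \<in> t)
     in finprod G (\<lambda>(x, y). \<beta> x y [^]\<^bsub>G\<^esub> Poly_Mapping.lookup c (x, y)) (Poly_Mapping.keys c))"

text \<open>The fields \<open>mult\<close> and \<open>one\<close> play no role in a module.\<close>

definition tensor_module ::
    "('r, 'c) ring_scheme \<Rightarrow> ('r, 'm, 'd) module_scheme \<Rightarrow> ('r, 'n, 'e) module_scheme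
      \<Rightarrow> ('r, ('m \<times> 'n \<Rightarrow>\<^sub>0 int) set) module" where
  "tensor_module R M N =
    \<lparr>carrier = carrier (tensor_group R M N),
     monoid.mult = undefined,
     one = undefined,
     ring.zero = \<one>\<^bsub>tensor_group R M N\<^esub>,
     add = monoid.mult (tensor_group R M N),
     module.smult = (\<lambda>r. tensor_lift (tensor_group R M N) (\<lambda>x y. pure_tensor R M N (r \<odot>\<^bsub>M\<^esub> x) y))\<rparr>"

definition tensor_algebra ::
    "('r, 'c) ring_scheme \<Rightarrow> ('r, 'a, 'd) module_scheme \<Rightarrow> ('r, 'b, 'e) module_scheme
      \<Rightarrow> ('r, ('a \<times> 'b \<Rightarrow>\<^sub>0 int) set) module" where
  "tensor_algebra R A B =
    (tensor_module R A B)
      \<lparr>monoid.mult := (\<lambda>s t.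
         tensor_lift (tensor_group R A B)
           (\<lambda>a b. tensor_lift (tensor_group R A B)
             (\<lambda>a' b'. pure_tensor R A B (a \<otimes>\<^bsub>A\<^esub> a') (b \<otimes>\<^bsub>B\<^esub> b')) t) s),
       one := pure_tensor R A B \<one>\<^bsub>A\<^esub> \<one>\<^bsub>B\<^esub>\<rparr>"

text \<open>\<open>tensor_map R M' N' f g\<close> is \<open>f \<otimes> g\<close>, with values in \<open>M' \<otimes> N'\<close>.\<close>

definition tensor_map ::
    "('r, 'c) ring_scheme \<Rightarrow> ('r, 'm1, 'd) module_scheme \<Rightarrow> ('r, 'n1, 'e) module_scheme
      \<Rightarrow> ('m \<Rightarrow> 'm1) \<Rightarrow> ('n \<Rightarrow> 'n1)
      \<Rightarrow> ('m \<times> 'n \<Rightarrow>\<^sub>0 int) set \<Rightarrow> ('m1 \<times> 'n1 \<Rightarrow>\<^sub>0 int) set" where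
  "tensor_map R M' N' f g =
    tensor_lift (tensor_group R M' N') (\<lambda>x y. pure_tensor R M' N' (f x) (g y))"

text \<open>The canonical isomorphism from \<open>(L \<otimes> M) \<otimes> N\<close> to \<open>L \<otimes> (M \<otimes> N)\<close>.\<close>

definition tensor_assoc ::
    "('r, 'c) ring_scheme \<Rightarrow> ('r, 'l, 'd) module_scheme \<Rightarrow> ('r, 'm, 'e) module_scheme
      \<Rightarrow> ('r, 'n, 'f) module_scheme
      \<Rightarrow> (('l \<times> 'm \<Rightarrow>\<^sub>0 int) set \<times> 'n \<Rightarrow>\<^sub>0 int) set
      \<Rightarrow> ('l \<times> ('m \<times> 'n \<Rightarrow>\<^sub>0 int) set \<Rightarrow>\<^sub>0 int) set" where
  "tensor_assoc R L M N =
    (let G = tensor_group R L (tensor_module R M N)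
     in tensor_lift G (\<lambda>t z. tensor_lift G
          (\<lambda>x y. pure_tensor R L (tensor_module R M N) x (pure_tensor R M N y z)) t))"


section \<open>Hopf algebras\<close>

locale hopf_algebra = associative_algebra R A
  for R :: "('r, 'c) ring_scheme" and A :: "('r, 'a, 'd) module_scheme" +
  fixes \<Delta> :: "'a \<Rightarrow> ('a \<times> 'a \<Rightarrow>\<^sub>0 int) set" and \<epsilon> :: "'a \<Rightarrow> 'r" and S :: "'a \<Rightarrow> 'a"
  assumes comult_hom: "\<Delta> \<in> algebra_homs R A (tensor_algebra R A A)"
    and counit_hom: "\<epsilon> \<in> algebra_homs R A (regular_module R)"
    and antipode_linear: "S \<in> module_homs R A A"
    and coassoc:
      "z \<in> carrier A \<Longrightarrow>
        tensor_assoc R A A A (tensor_map R (tensor_module R A A) A \<Delta> (\<lambda>u. u) (\<Delta> z)) =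
        tensor_map R A (tensor_module R A A) (\<lambda>u. u) \<Delta> (\<Delta> z)"
    and counit_left:
      "z \<in> carrier A \<Longrightarrow> tensor_lift (add_monoid A) (\<lambda>u v. \<epsilon> u \<odot>\<^bsub>A\<^esub> v) (\<Delta> z) = z"
    and counit_right:
      "z \<in> carrier A \<Longrightarrow> tensor_lift (add_monoid A) (\<lambda>u v. \<epsilon> v \<odot>\<^bsub>A\<^esub> u) (\<Delta> z) = z"
    and antipode_left:
      "z \<in> carrier A \<Longrightarrow>
        tensor_lift (add_monoid A) (\<lambda>u v. S u \<otimes>\<^bsub>A\<^esub> v) (\<Delta> z) = \<epsilon> z \<odot>\<^bsub>A\<^esub> \<one>\<^bsub>A\<^esub>"
    and antipode_right:
      "z \<in> carrier A \<Longrightarrow>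
        tensor_lift (add_monoid A) (\<lambda>u v. u \<otimes>\<^bsub>A\<^esub> S v) (\<Delta> z) = \<epsilon> z \<odot>\<^bsub>A\<^esub> \<one>\<^bsub>A\<^esub>"

text \<open>The condition \<open>\<Delta>(B) \<subseteq> B \<otimes> A\<close> refers to the image of \<open>B \<otimes> A\<close> in \<open>A \<otimes> A\<close>.\<close>

definition right_coideal_subalgebra ::
    "('r, 'c) ring_scheme \<Rightarrow> ('r, 'a, 'd) module_scheme \<Rightarrow> ('a \<Rightarrow> ('a \<times> 'a \<Rightarrow>\<^sub>0 int) set)
      \<Rightarrow> 'a set \<Rightarrow> bool" where
  "right_coideal_subalgebra R A \<Delta> B \<longleftrightarrow>
    is_subalgebra R B A \<and>
    \<Delta> ` B \<subseteq> tensor_map R A A (\<lambda>u. u) (\<lambda>u. u) ` carrier (tensor_module R (A\<lparr>carrier := B\<rparr>) A)"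


section \<open>Free and faithfully flat modules\<close>

definition is_basis ::
    "('r, 'c) ring_scheme \<Rightarrow> ('r, 'm, 'd) module_scheme \<Rightarrow> 'm set \<Rightarrow> bool" where
  "is_basis R M E \<longleftrightarrow> E \<subseteq> carrier M \<and>
    (\<forall>x\<in>carrier M. \<exists>!c. c \<in> UNIV \<rightarrow> carrier R \<and>
      finite {e. c e \<noteq> \<zero>\<^bsub>R\<^esub>} \<and> {e. c e \<noteq> \<zero>\<^bsub>R\<^esub>} \<subseteq> E \<and>
      x = (\<Oplus>\<^bsub>M\<^esub>e\<in>{e. c e \<noteq> \<zero>\<^bsub>R\<^esub>}. c e \<odot>\<^bsub>M\<^esub> e))"

definition free_module :: "('r, 'c) ring_scheme \<Rightarrow> ('r, 'm, 'd) module_scheme \<Rightarrow> bool" where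
  "free_module R M \<longleftrightarrow> module R M \<and> (\<exists>E. is_basis R M E)"

text \<open>A sequence of modules over the commutative ring \<open>R\<close> is exact if and only if it is exact
  after tensoring with \<open>M\<close>. There is no quantifier over types, so the type \<open>'n\<close> of the elements
  of the test modules is a parameter; a theorem that has \<open>'n\<close> as a free type variable covers
  test modules of all types.\<close>

definition faithfully_flat ::
    "'n itself \<Rightarrow> ('r, 'c) ring_scheme \<Rightarrow> ('r, 'm, 'd) module_scheme \<Rightarrow> bool" where
  "faithfully_flat _ R M \<longleftrightarrow> module R M \<and>
    (\<forall>(N1 :: ('r, 'n) module) (N2 :: ('r, 'n) module) (N3 :: ('r, 'n) module) f g.
      module R N1 \<and> module R N2 \<and> module R N3 \<and>
      f \<in> module_homs R N1 N2 \<and> g \<in> module_homs R N2 N3 \<longrightarrow>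
      (f ` carrier N1 = a_kernel N2 N3 g \<longleftrightarrow>
       tensor_map R N2 M f (\<lambda>u. u) ` carrier (tensor_module R N1 M) =
         a_kernel (tensor_module R N2 M) (tensor_module R N3 M) (tensor_map R N3 M g (\<lambda>u. u))))"


section \<open>Free algebras\<close>

datatype 'g free_monoid = Word "'g list"

instantiation free_monoid :: (type) monoid_add
begin

definition zero_free_monoid :: "'a free_monoid" where
  "zero_free_monoid = Word []"

fun plus_free_monoid :: "'a free_monoid \<Rightarrow> 'a free_monoid \<Rightarrow> 'a free_monoid" where
  "Word u + Word v = Word (u @ v)"

instance
proof
  fix a b c :: "'a free_monoid"
  show "a + b + c = a + (b + c)" by (cases a; cases b; cases c) simp
  show "0 + a = a" by (cases a) (simp add: zero_free_monoid_def)
  show "a + 0 = a" by (cases a) (simp add: zero_free_monoid_def)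
qed

end

text \<open>The multiplication of \<^typ>\<open>'g free_monoid \<Rightarrow>\<^sub>0 'k\<close> is convolution.\<close>

type_synonym ('g, 'k) free_alg = "'g free_monoid \<Rightarrow>\<^sub>0 'k"

definition fvar :: "'g \<Rightarrow> ('g, 'k::ring_1) free_alg" where
  "fvar g = Poly_Mapping.single (Word [g]) 1"

definition fconst :: "'k \<Rightarrow> ('g, 'k::ring_1) free_alg" where
  "fconst c = Poly_Mapping.single 0 c"

definition free_algebra :: "('k::ring_1, ('g, 'k) free_alg) module" where
  "free_algebra = algebra_of_type (\<lambda>c f. fconst c * f)"


section \<open>The algebra A\<close>

datatype gen = Gx | Gy | Ga | Gainv | Gb

definition nodal_relations :: "'k \<Rightarrow> 'k \<Rightarrow> (gen, 'k::field) free_alg set" where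
  "nodal_relations q p =
    (let x = fvar Gx; y = fvar Gy; a = fvar Ga; a' = fvar Gainv; b = fvar Gb in
      {a * a' - 1,
       a' * a - 1,
       y^2 - (x^2 + x^3),
       b^2 - a^3,
       b * a - a * b,
       y * a - a * y,
       b * x - x * b,
       y * x - x * y,
       b * y - (- (y * b) + fconst (2 * p) * b^2),
       a^2 * x - (- (x * a^2) - a * x * a - a^2 + fconst (1 + 3 * q) * a^3),
       a * x^2 - (- (a * x) - x * a - x^2 * a - x * a * x + fconst ((2 + 3 * q) * q) * a^3)})"

definition nodal_ideal :: "'k \<Rightarrow> 'k \<Rightarrow> (gen, 'k::field) free_alg set" where
  "nodal_ideal q p = Idl\<^bsub>free_algebra\<^esub> (nodal_relations q p)"

definition nodal_hopf :: "'k \<Rightarrow> 'k \<Rightarrow> ('k::field, (gen, 'k) free_alg set) module" where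
  "nodal_hopf q p = quotient_algebra free_algebra (nodal_ideal q p)"

definition nodal_gen :: "'k \<Rightarrow> 'k \<Rightarrow> gen \<Rightarrow> (gen, 'k::field) free_alg set" where
  "nodal_gen q p g = nodal_ideal q p +>\<^bsub>free_algebra\<^esub> fvar g"


section \<open>The coordinate ring of the nodal cubic\<close>

text \<open>\<open>k[X, Y]\<close> is \<open>k[X][Y]\<close>.\<close>

definition poly_X :: "'k::field poly poly" where
  "poly_X = [:[:0, 1:]:]"

definition poly_Y :: "'k::field poly poly" where
  "poly_Y = [:0, 1:]"

definition poly_XY :: "('k::field, 'k poly poly) module" where
  "poly_XY = algebra_of_type (\<lambda>c. Polynomial.smult [:c:])"

definition cubic_ideal :: "'k::field poly poly set" where
  "cubic_ideal = Idl\<^bsub>poly_XY\<^esub> {poly_Y^2 - poly_X^2 - poly_X^3}"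

definition nodal_cubic :: "('k::field, 'k poly poly set) module" where
  "nodal_cubic = quotient_algebra poly_XY cubic_ideal"

end

theory Submission
  imports Defs "HOL-Library.Product_Plus"
begin

text \<open>
  Substitute \<open>u = 3 x + 1 - (1 + 3 q) a\<close> and \<open>z = y - p b\<close>. In the new generators the parameters \<open>q\<close> and
  \<open>p\<close> disappear: the cubic equation becomes \<open>27 z\<^sup>2 = u\<^sup>3 - 3 u + 2 - 2 a\<^sup>3\<close>, the two long relations become
  \<open>a\<^sup>2 u + a u a + u a\<^sup>2 = 0\<close> and \<open>a u\<^sup>2 + u a u + u\<^sup>2 a = 3 (a - a\<^sup>3)\<close>, and the coproduct becomes skew primitive,
  \<open>\<Delta>(u) = 1 \<otimes> u + u \<otimes> a\<close>, \<open>\<Delta>(z) = 1 \<otimes> z + z \<otimes> b\<close>, with \<open>\<epsilon>(u) = \<epsilon>(z) = 0\<close>. That the structure maps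
  respect the relations is then a calculation in the shifted generators
  (\<open>shifted_set_tensor\<close>, \<open>antipode_relations\<close>), and the Hopf axioms need to be checked on generators only,
  or, for the antipode, on generators and products.

  For the freeness, let \<open>\<omega>\<close> be a primitive cube root of unity. Conjugation by \<open>a\<close> satisfies
  \<open>1 + c + c\<^sup>2 = 0\<close> on the span of the conjugates of \<open>u\<close>, so \<open>v = a u a\<inverse> - \<omega> u\<close> is an eigenvector,
  \<open>a v = \<omega>\<^sup>2 v a\<close>, and the two long relations are equivalent to the straightening rules for
  \<open>a u\<close>, \<open>a v\<close> and \<open>v u\<close> in \<open>eigenvector\<close>. They show that the elements \<open>v\<^sup>i a\<^sup>l b\<^sup>f\<close> with
  \<open>f \<in> {0, 1}\<close> span \<open>A\<close> over \<open>B\<close>. Independence comes from a representation of \<open>A\<close> by operators on functions on the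
  index set \<open>(i, l, f)\<close> with values in \<open>k[T]\<close>, the coordinate ring of the normalization of the nodal cubic: \<open>x\<close>
  and \<open>y\<close> act at the index \<open>(0, 0, 0)\<close> as \<open>T\<^sup>2 - 1\<close> and \<open>T\<^sup>3 - T\<close>, and the basis elements shift this index. The
  same representation shows that \<open>x\<close> and \<open>y\<close> satisfy no relation other than the cubic equation, because the
  parametrization of the nodal cubic is injective on its coordinate ring (\<open>evc_eq_0\<close>).
  Faithful flatness follows from a general fact on free modules (\<open>free_imp_faithfully_flat\<close>).
\<close>

section \<open>Tensor products\<close>

definition frag_eval :: "('g, 'e) monoid_scheme \<Rightarrow> ('i \<Rightarrow> 'g) \<Rightarrow> ('i \<Rightarrow>\<^sub>0 int) \<Rightarrow> 'g" where
  "frag_eval G f c = finprod G (\<lambda>i. f i [^]\<^bsub>G\<^esub> Poly_Mapping.lookup c i) (Poly_Mapping.keys c)"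

context comm_group
begin

lemma frag_eval_superset:
  assumes "f \<in> S \<rightarrow> carrier G" "Poly_Mapping.keys c \<subseteq> U" "finite U" "U \<subseteq> S"
  shows "frag_eval G f c = finprod G (\<lambda>i. f i [^] Poly_Mapping.lookup c i) U"
  unfolding frag_eval_def
  using assms by (intro finprod_mono_neutral_cong_left) (auto simp: in_keys_iff Pi_iff subset_iff)

lemma frag_eval_hom:
  assumes f: "f \<in> S \<rightarrow> carrier G"
  shows "frag_eval G f \<in> hom (free_Abelian_group S) G"
proof (rule homI)
  fix c assume "c \<in> carrier (free_Abelian_group S)"
  then show "frag_eval G f c \<in> carrier G"
    using f unfolding frag_eval_def by (intro finprod_closed) auto
next
  fix c d assume cd: "c \<in> carrier (free_Abelian_group S)" "d \<in> carrier (free_Abelian_group S)"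
  define U where "U = Poly_Mapping.keys c \<union> Poly_Mapping.keys d"
  have U: "finite U" "U \<subseteq> S" "Poly_Mapping.keys c \<subseteq> U" "Poly_Mapping.keys d \<subseteq> U"
      "Poly_Mapping.keys (c + d) \<subseteq> U"
    using cd keys_add[of c d] by (auto simp: U_def)
  have fU: "f i \<in> carrier G" if "i \<in> U" for i
    using that U f by auto
  have "finprod G (\<lambda>i. f i [^] Poly_Mapping.lookup (c + d) i) U =
      finprod G (\<lambda>i. f i [^] Poly_Mapping.lookup c i \<otimes> f i [^] Poly_Mapping.lookup d i) U"
    using fU by (intro finprod_cong') (auto simp: lookup_add int_pow_mult)
  also have "\<dots> = finprod G (\<lambda>i. f i [^] Poly_Mapping.lookup c i) U \<otimes>
      finprod G (\<lambda>i. f i [^] Poly_Mapping.lookup d i) U"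
    using fU by (intro finprod_multf) auto
  finally show "frag_eval G f (c \<otimes>\<^bsub>free_Abelian_group S\<^esub> d) = frag_eval G f c \<otimes> frag_eval G f d"
    using frag_eval_superset[OF f] U by simp
qed

lemma frag_eval_of:
  assumes "f i \<in> carrier G"
  shows "frag_eval G f (frag_of i) = f i"
  using assms by (simp add: frag_eval_def)

end

definition balanced_map ::
    "('r, 'c) ring_scheme \<Rightarrow> ('r, 'm, 'd) module_scheme \<Rightarrow> ('r, 'n, 'e) module_scheme
      \<Rightarrow> ('p, 'f) ring_scheme \<Rightarrow> ('m \<Rightarrow> 'n \<Rightarrow> 'p) \<Rightarrow> bool" where
  "balanced_map R M N P \<beta> \<longleftrightarrow>
    (\<forall>x\<in>carrier M. \<forall>y\<in>carrier N. \<beta> x y \<in> carrier P) \<and>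
    (\<forall>x\<in>carrier M. \<forall>x'\<in>carrier M. \<forall>y\<in>carrier N. \<beta> (x \<oplus>\<^bsub>M\<^esub> x') y = \<beta> x y \<oplus>\<^bsub>P\<^esub> \<beta> x' y) \<and>
    (\<forall>x\<in>carrier M. \<forall>y\<in>carrier N. \<forall>y'\<in>carrier N. \<beta> x (y \<oplus>\<^bsub>N\<^esub> y') = \<beta> x y \<oplus>\<^bsub>P\<^esub> \<beta> x y') \<and>
    (\<forall>r\<in>carrier R. \<forall>x\<in>carrier M. \<forall>y\<in>carrier N. \<beta> (r \<odot>\<^bsub>M\<^esub> x) y = \<beta> x (r \<odot>\<^bsub>N\<^esub> y))"

text \<open>The group structure of \<open>P\<close> may be presented by a different record \<open>G\<close>, because
  \<^const>\<open>tensor_lift\<close> expects a multiplicative group.\<close>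

definition is_add_group :: "('p, 'e) monoid_scheme \<Rightarrow> ('p, 'f) ring_scheme \<Rightarrow> bool" where
  "is_add_group G P \<longleftrightarrow> comm_group G \<and> abelian_group P \<and>
    carrier G = carrier P \<and> monoid.mult G = add P \<and> one G = ring.zero P"

lemma is_add_group_add_monoid: "abelian_group P \<Longrightarrow> is_add_group (add_monoid P) P"
  by (simp add: is_add_group_def abelian_group.a_comm_group)

locale tensor_product = M: module R M + N: module R N
  for R :: "('r, 'c) ring_scheme" (structure) and M :: "('r, 'm, 'd) module_scheme"
    and N :: "('r, 'n, 'e) module_scheme"
begin

abbreviation "FG \<equiv> free_Abelian_group (carrier M \<times> carrier N)"
abbreviation "K \<equiv> tensor_null R M N"
abbreviation "T \<equiv> tensor_module R M N"
abbreviation "pt \<equiv> pure_tensor R M N"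

lemma relations_subset: "tensor_relations R M N \<subseteq> carrier FG"
proof -
  have "Poly_Mapping.keys (c - d) \<subseteq> S" if "Poly_Mapping.keys c \<subseteq> S" "Poly_Mapping.keys d \<subseteq> S"
    for S and c d :: "'m \<times> 'n \<Rightarrow>\<^sub>0 int"
    using keys_diff[of c d] that by blast
  then show ?thesis
    unfolding tensor_relations_def by (auto intro!: subsetI simp del: diff_diff_eq)
qed

sublocale FG: comm_group FG
  by (rule abelian_free_Abelian_group)

lemma null_subgroup: "subgroup K FG"
  unfolding tensor_null_def by (rule FG.generate_is_subgroup[OF relations_subset])

lemma null_normal: "K \<lhd> FG"
  using FG.normal_iff_subgroup null_subgroup by blast

lemma T_comm_group: "comm_group (tensor_group R M N)"
  unfolding tensor_group_def by (rule FG.abelian_FactGroup[OF null_subgroup])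

sublocale T: abelian_group T
proof -
  interpret G: comm_group "tensor_group R M N" by (rule T_comm_group)
  show "abelian_group T"
  proof (rule abelian_groupI)
    fix x assume "x \<in> carrier T"
    then show "\<exists>y\<in>carrier T. y \<oplus>\<^bsub>T\<^esub> x = \<zero>\<^bsub>T\<^esub>"
      using G.l_inv_ex by (auto simp: tensor_module_def)
  qed (auto simp: tensor_module_def G.m_ac)
qed

lemma is_add_group_tensor: "is_add_group (tensor_group R M N) T"
  using T_comm_group T.abelian_group_axioms
  by (simp add: is_add_group_def tensor_module_def)

lemma carrier_T: "carrier T = (\<lambda>c. K #>\<^bsub>FG\<^esub> c) ` carrier FG"
  by (simp add: tensor_module_def tensor_group_def carrier_FactGroup)

lemma coset_add:
  assumes "c \<in> carrier FG" "d \<in> carrier FG"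
  shows "K #>\<^bsub>FG\<^esub> (c + d) = (K #>\<^bsub>FG\<^esub> c) \<oplus>\<^bsub>T\<^esub> (K #>\<^bsub>FG\<^esub> d)"
  using normal.rcos_sum[OF null_normal assms] by (simp add: tensor_module_def tensor_group_def)

lemma coset_zero: "K #>\<^bsub>FG\<^esub> 0 = \<zero>\<^bsub>T\<^esub>"
  using FG.coset_mult_one[of K] null_subgroup subgroup.subset
  by (fastforce simp: tensor_module_def tensor_group_def)

lemma coset_eqI:
  assumes "c \<in> carrier FG" "d \<in> carrier FG" "c - d \<in> K"
  shows "K #>\<^bsub>FG\<^esub> c = K #>\<^bsub>FG\<^esub> d"
proof -
  have "c = (c - d) \<otimes>\<^bsub>FG\<^esub> d" by simp
  then have "c \<in> K #>\<^bsub>FG\<^esub> d" using assms(3) unfolding r_coset_def by blast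
  then show ?thesis
    using FG.repr_independence[of c K d] assms(2) null_subgroup by auto
qed

lemma null_memI: "c \<in> tensor_relations R M N \<Longrightarrow> c \<in> K"
  unfolding tensor_null_def by (rule generate.incl)

lemma pure_closed [simp, intro]:
  "\<lbrakk>x \<in> carrier M; y \<in> carrier N\<rbrakk> \<Longrightarrow> pt x y \<in> carrier T"
  unfolding carrier_T pure_tensor_def by (rule imageI) simp

lemma pure_balanced: "balanced_map R M N T pt"
  unfolding balanced_map_def
proof (intro conjI ballI)
  fix x x' y assume h: "x \<in> carrier M" "x' \<in> carrier M" "y \<in> carrier N"
  have "frag_of (x \<oplus>\<^bsub>M\<^esub> x', y) - (frag_of (x, y) + frag_of (x', y)) \<in> K"
    using h by (intro null_memI) (auto simp: tensor_relations_def algebra_simps)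
  then have "pt (x \<oplus>\<^bsub>M\<^esub> x') y = K #>\<^bsub>FG\<^esub> (frag_of (x, y) + frag_of (x', y))"
    unfolding pure_tensor_def using h FG.m_closed[of "frag_of (x, y)" "frag_of (x', y)"]
    by (intro coset_eqI) auto
  then show "pt (x \<oplus>\<^bsub>M\<^esub> x') y = pt x y \<oplus>\<^bsub>T\<^esub> pt x' y"
    using h by (subst (asm) coset_add) (auto simp: pure_tensor_def)
next
  fix x y y' assume h: "x \<in> carrier M" "y \<in> carrier N" "y' \<in> carrier N"
  have "frag_of (x, y \<oplus>\<^bsub>N\<^esub> y') - (frag_of (x, y) + frag_of (x, y')) \<in> K"
    using h by (intro null_memI) (auto simp: tensor_relations_def algebra_simps)
  then have "pt x (y \<oplus>\<^bsub>N\<^esub> y') = K #>\<^bsub>FG\<^esub> (frag_of (x, y) + frag_of (x, y'))"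
    unfolding pure_tensor_def using h FG.m_closed[of "frag_of (x, y)" "frag_of (x, y')"]
    by (intro coset_eqI) auto
  then show "pt x (y \<oplus>\<^bsub>N\<^esub> y') = pt x y \<oplus>\<^bsub>T\<^esub> pt x y'"
    using h by (subst (asm) coset_add) (auto simp: pure_tensor_def)
next
  fix r x y assume h: "r \<in> carrier R" "x \<in> carrier M" "y \<in> carrier N"
  then show "pt (r \<odot>\<^bsub>M\<^esub> x) y = pt x (r \<odot>\<^bsub>N\<^esub> y)"
    unfolding pure_tensor_def
    by (intro coset_eqI null_memI) (auto simp: tensor_relations_def)
qed auto

lemmas pure_add_left = pure_balanced[unfolded balanced_map_def, THEN conjunct2, THEN conjunct1, rule_format]
lemmas pure_add_right = pure_balanced[unfolded balanced_map_def, THEN conjunct2, THEN conjunct2, THEN conjunct1, rule_format]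
lemmas pure_smult = pure_balanced[unfolded balanced_map_def, THEN conjunct2, THEN conjunct2, THEN conjunct2, rule_format]

lemma pure_zero_left:
  assumes y: "y \<in> carrier N" shows "pt \<zero>\<^bsub>M\<^esub> y = \<zero>\<^bsub>T\<^esub>"
  using pure_add_left[of "\<zero>\<^bsub>M\<^esub>" "\<zero>\<^bsub>M\<^esub>" y] y
  by (metis M.zero_closed M.M.l_zero T.add.l_cancel_one' pure_closed)

lemma pure_minus_left:
  assumes "x \<in> carrier M" "y \<in> carrier N"
  shows "pt (\<ominus>\<^bsub>M\<^esub> x) y = \<ominus>\<^bsub>T\<^esub> pt x y"
  using assms pure_add_left[of "\<ominus>\<^bsub>M\<^esub> x" x y] pure_zero_left[of y]
  by (simp add: M.M.l_neg T.minus_equality)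

text \<open>No case for inverses is needed since \<open>- (x \<otimes> y) = (- x) \<otimes> y\<close>.\<close>

lemma tensor_induct [consumes 1, case_names pure add]:
  assumes t: "t \<in> carrier T"
    and pure: "\<And>x y. \<lbrakk>x \<in> carrier M; y \<in> carrier N\<rbrakk> \<Longrightarrow> P (pt x y)"
    and add: "\<And>s t. \<lbrakk>s \<in> carrier T; t \<in> carrier T; P s; P t\<rbrakk> \<Longrightarrow> P (s \<oplus>\<^bsub>T\<^esub> t)"
  shows "P t"
proof -
  obtain c where c: "c \<in> carrier FG" "t = K #>\<^bsub>FG\<^esub> c"
    using t carrier_T by auto
  have Z: "P \<zero>\<^bsub>T\<^esub>"
    using pure[of "\<zero>\<^bsub>M\<^esub>" "\<zero>\<^bsub>N\<^esub>"] pure_zero_left[of "\<zero>\<^bsub>N\<^esub>"] by simp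
  have minus: "K #>\<^bsub>FG\<^esub> (- d) = \<ominus>\<^bsub>T\<^esub> (K #>\<^bsub>FG\<^esub> d)" if "d \<in> carrier FG" for d
  proof -
    have d: "- d \<in> carrier FG" "K #>\<^bsub>FG\<^esub> d \<in> carrier T" "K #>\<^bsub>FG\<^esub> (- d) \<in> carrier T"
      using that unfolding carrier_T by auto
    then show ?thesis
      using coset_add[OF d(1) that] coset_zero by (simp add: T.minus_equality)
  qed
  have "Poly_Mapping.keys c \<subseteq> carrier M \<times> carrier N" using c by simp
  then have "c \<in> carrier FG \<and> P (K #>\<^bsub>FG\<^esub> c) \<and> P (\<ominus>\<^bsub>T\<^esub> (K #>\<^bsub>FG\<^esub> c))"
  proof (induction c rule: frag_induction)
    case zero
    have "P (\<ominus>\<^bsub>T\<^esub> \<zero>\<^bsub>T\<^esub>)" using Z T.minus_equality[of "\<zero>\<^bsub>T\<^esub>" "\<zero>\<^bsub>T\<^esub>"] by (metis T.l_zero T.zero_closed)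
    then show ?case unfolding coset_zero using Z by simp
  next
    case (one z)
    then obtain x y where z: "z = (x, y)" "x \<in> carrier M" "y \<in> carrier N" by auto
    show ?case
      using z pure[of x y] pure[of "\<ominus>\<^bsub>M\<^esub> x" y] pure_minus_left[of x y]
      by (auto simp: pure_tensor_def)
  next
    case (diff a b)
    have cl: "a - b \<in> carrier FG" "- b \<in> carrier FG"
      "K #>\<^bsub>FG\<^esub> a \<in> carrier T" "K #>\<^bsub>FG\<^esub> b \<in> carrier T"
      using diff keys_diff[of a b] unfolding carrier_T by auto
    have e: "K #>\<^bsub>FG\<^esub> (a - b) = (K #>\<^bsub>FG\<^esub> a) \<oplus>\<^bsub>T\<^esub> (\<ominus>\<^bsub>T\<^esub> (K #>\<^bsub>FG\<^esub> b))"
      using coset_add[of a "- b"] minus[of b] diff cl by simp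
    show ?case
      unfolding e using cl diff by (auto intro!: add simp: T.minus_add)
  qed
  then show ?thesis using c by simp
qed

context
  fixes G :: "('p, 'g) monoid_scheme" and P :: "('p, 'f) ring_scheme" and \<beta>
  assumes GP: "is_add_group G P" and \<beta>: "balanced_map R M N P \<beta>"
begin

interpretation P: abelian_group P using GP by (simp add: is_add_group_def)

private lemma GP_simps: "carrier G = carrier P" "monoid.mult G = add P" "one G = ring.zero P"
  using GP by (auto simp: is_add_group_def)

private lemma inv_G: "x \<in> carrier P \<Longrightarrow> inv\<^bsub>G\<^esub> x = \<ominus>\<^bsub>P\<^esub> x"
  by (simp add: a_inv_def m_inv_def GP_simps)

interpretation GP: comm_group G using GP by (simp add: is_add_group_def)

private abbreviation (input) "ev \<equiv> frag_eval G (\<lambda>(x, y). \<beta> x y)"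

private lemma \<beta>_closed: "(\<lambda>(x, y). \<beta> x y) \<in> carrier M \<times> carrier N \<rightarrow> carrier G"
  using \<beta> by (auto simp: balanced_map_def GP_simps)

private lemma ev_hom: "group_hom FG G ev"
  using GP.frag_eval_hom[OF \<beta>_closed]
  by (simp add: group_hom_def group_hom_axioms_def FG.is_group GP.is_group)

private lemma ev_of: "\<lbrakk>x \<in> carrier M; y \<in> carrier N\<rbrakk> \<Longrightarrow> ev (frag_of (x, y)) = \<beta> x y"
  using GP.frag_eval_of[of "\<lambda>(x, y). \<beta> x y" "(x, y)"] \<beta>
  by (simp add: balanced_map_def GP_simps)

private lemma ev_diff:
  assumes "c \<in> carrier FG" "d \<in> carrier FG"
  shows "ev (c - d) = ev c \<ominus>\<^bsub>P\<^esub> ev d"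
proof -
  interpret ev: group_hom FG G ev by (rule ev_hom)
  show ?thesis
    using ev.hom_mult[of c "- d"] ev.hom_inv[of d] ev.hom_closed[of d] assms
    by (simp add: a_minus_def GP_simps inv_G)
qed

private lemma ev_null:
  assumes "c \<in> K" shows "ev c = \<zero>\<^bsub>P\<^esub>"
proof -
  interpret ev: group_hom FG G ev by (rule ev_hom)
  have rel: "ev c = \<zero>\<^bsub>P\<^esub>" if "c \<in> tensor_relations R M N" for c
  proof -
    have *: "frag_of z - frag_of w \<in> carrier FG" if "z \<in> carrier M \<times> carrier N" "w \<in> carrier M \<times> carrier N" for z w
      using that keys_diff[of "frag_of z" "frag_of w"] by auto
    have closed: "\<beta> x y \<in> carrier P" if "x \<in> carrier M" "y \<in> carrier N" for x y
      using that \<beta> by (auto simp: balanced_map_def)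
    show ?thesis
      using that unfolding tensor_relations_def
    proof (elim UnE CollectE exE conjE)
      fix x x' y assume h: "x \<in> carrier M" "x' \<in> carrier M" "y \<in> carrier N"
        and c: "c = frag_of (x \<oplus>\<^bsub>M\<^esub> x', y) - frag_of (x, y) - frag_of (x', y)"
      have "ev c = (\<beta> (x \<oplus>\<^bsub>M\<^esub> x') y \<ominus>\<^bsub>P\<^esub> \<beta> x y) \<ominus>\<^bsub>P\<^esub> \<beta> x' y"
        unfolding c using h by (simp add: ev_diff ev_of * del: carrier_free_Abelian_group_iff)
      also have "\<dots> = (\<beta> x y \<oplus>\<^bsub>P\<^esub> \<beta> x' y \<ominus>\<^bsub>P\<^esub> \<beta> x y) \<ominus>\<^bsub>P\<^esub> \<beta> x' y"
        using h \<beta> by (simp add: balanced_map_def)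
      finally show ?thesis
        using closed[OF h(1,3)] closed[OF h(2,3)]
        by (simp add: P.minus_eq P.a_ac P.r_neg P.r_neg1 P.r_neg2)
    next
      fix x y y' assume h: "x \<in> carrier M" "y \<in> carrier N" "y' \<in> carrier N"
        and c: "c = frag_of (x, y \<oplus>\<^bsub>N\<^esub> y') - frag_of (x, y) - frag_of (x, y')"
      have "ev c = (\<beta> x (y \<oplus>\<^bsub>N\<^esub> y') \<ominus>\<^bsub>P\<^esub> \<beta> x y) \<ominus>\<^bsub>P\<^esub> \<beta> x y'"
        unfolding c using h by (simp add: ev_diff ev_of * del: carrier_free_Abelian_group_iff)
      also have "\<dots> = (\<beta> x y \<oplus>\<^bsub>P\<^esub> \<beta> x y' \<ominus>\<^bsub>P\<^esub> \<beta> x y) \<ominus>\<^bsub>P\<^esub> \<beta> x y'"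
        using h \<beta> by (simp add: balanced_map_def)
      finally show ?thesis
        using closed[OF h(1,2)] closed[OF h(1,3)]
        by (simp add: P.minus_eq P.a_ac P.r_neg P.r_neg1 P.r_neg2)
    next
      fix r x y assume h: "r \<in> carrier R" "x \<in> carrier M" "y \<in> carrier N"
        and c: "c = frag_of (r \<odot>\<^bsub>M\<^esub> x, y) - frag_of (x, r \<odot>\<^bsub>N\<^esub> y)"
      have "ev c = \<beta> (r \<odot>\<^bsub>M\<^esub> x) y \<ominus>\<^bsub>P\<^esub> \<beta> x (r \<odot>\<^bsub>N\<^esub> y)"
        unfolding c using h by (simp add: ev_diff ev_of)
      also have "\<dots> = \<zero>\<^bsub>P\<^esub>"
        using h \<beta> closed by (simp add: balanced_map_def P.minus_eq P.r_neg)
      finally show ?thesis .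
    qed
  qed
  have "tensor_relations R M N \<subseteq> kernel FG G ev"
    using rel relations_subset unfolding kernel_def GP_simps by blast
  then have "K \<subseteq> kernel FG G ev"
    unfolding tensor_null_def by (rule FG.generate_subgroup_incl[OF _ ev.subgroup_kernel])
  then show ?thesis using assms by (auto simp: kernel_def GP_simps)
qed

private lemma lift_coset:
  assumes "c \<in> carrier FG"
  shows "tensor_lift G \<beta> (K #>\<^bsub>FG\<^esub> c) = ev c"
proof -
  interpret ev: group_hom FG G ev by (rule ev_hom)
  define d where "d = (SOME d. d \<in> K #>\<^bsub>FG\<^esub> c)"
  have "d \<in> K #>\<^bsub>FG\<^esub> c"
    unfolding d_def by (rule someI, rule FG.rcos_self[OF assms null_subgroup])
  then obtain h where h: "h \<in> K" "d = h + c" by (auto simp: r_coset_def)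
  have hc: "h \<in> carrier FG" using h null_subgroup subgroup.subset by blast
  have "tensor_lift G \<beta> (K #>\<^bsub>FG\<^esub> c) = ev d"
    by (simp add: tensor_lift_def frag_eval_def Let_def d_def case_prod_unfold)
  also have "\<dots> = ev c"
    using ev.hom_mult[OF hc assms] ev_null[OF h(1)] h(2) ev.hom_closed[OF assms] by (simp add: GP_simps)
  finally show ?thesis .
qed

lemma lift_pure:
  "\<lbrakk>x \<in> carrier M; y \<in> carrier N\<rbrakk> \<Longrightarrow> tensor_lift G \<beta> (pt x y) = \<beta> x y"
  unfolding pure_tensor_def by (simp add: lift_coset ev_of)

lemma lift_closed: "t \<in> carrier T \<Longrightarrow> tensor_lift G \<beta> t \<in> carrier P"
  using group_hom.hom_closed[OF ev_hom] by (auto simp: carrier_T lift_coset GP_simps simp del: carrier_free_Abelian_group_iff)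

lemma lift_add:
  assumes s: "s \<in> carrier T" and t: "t \<in> carrier T"
  shows "tensor_lift G \<beta> (s \<oplus>\<^bsub>T\<^esub> t) =
      tensor_lift G \<beta> s \<oplus>\<^bsub>P\<^esub> tensor_lift G \<beta> t"
proof -
  obtain c d where "c \<in> carrier FG" "s = K #>\<^bsub>FG\<^esub> c" "d \<in> carrier FG" "t = K #>\<^bsub>FG\<^esub> d"
    using s t carrier_T by auto
  then show ?thesis
    using group_hom.hom_mult[OF ev_hom, of c d] FG.m_closed[of c d]
    by (simp add: coset_add[symmetric] lift_coset GP_simps del: carrier_free_Abelian_group_iff)
qed

end

end

lemma module_homsI:
  assumes "\<And>x. x \<in> carrier M \<Longrightarrow> f x \<in> carrier N"
    and "\<And>x y. \<lbrakk>x \<in> carrier M; y \<in> carrier M\<rbrakk> \<Longrightarrow> f (x \<oplus>\<^bsub>M\<^esub> y) = f x \<oplus>\<^bsub>N\<^esub> f y"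
    and "\<And>r x. \<lbrakk>r \<in> carrier R; x \<in> carrier M\<rbrakk> \<Longrightarrow> f (r \<odot>\<^bsub>M\<^esub> x) = r \<odot>\<^bsub>N\<^esub> f x"
  shows "f \<in> module_homs R M N"
  using assms by (auto simp: module_homs_def)

lemma module_homsD:
  assumes "f \<in> module_homs R M N"
  shows "\<And>x. x \<in> carrier M \<Longrightarrow> f x \<in> carrier N"
    and "\<And>x y. \<lbrakk>x \<in> carrier M; y \<in> carrier M\<rbrakk> \<Longrightarrow> f (x \<oplus>\<^bsub>M\<^esub> y) = f x \<oplus>\<^bsub>N\<^esub> f y"
    and "\<And>r x. \<lbrakk>r \<in> carrier R; x \<in> carrier M\<rbrakk> \<Longrightarrow> f (r \<odot>\<^bsub>M\<^esub> x) = r \<odot>\<^bsub>N\<^esub> f x"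
  using assms by (auto simp: module_homs_def)

lemma module_homs_zero:
  assumes "module R M" "module R N" "f \<in> module_homs R M N"
  shows "f \<zero>\<^bsub>M\<^esub> = \<zero>\<^bsub>N\<^esub>"
proof -
  interpret M: module R M by fact
  interpret N: module R N by fact
  show ?thesis
    using module_homsD(2)[OF assms(3), of "\<zero>\<^bsub>M\<^esub>" "\<zero>\<^bsub>M\<^esub>"] module_homsD(1)[OF assms(3), of "\<zero>\<^bsub>M\<^esub>"]
    by (metis M.zero_closed M.M.l_zero N.add.l_cancel_one')
qed

lemma module_homs_comp:
  "\<lbrakk>f \<in> module_homs R L M; g \<in> module_homs R M N\<rbrakk> \<Longrightarrow> (\<lambda>x. g (f x)) \<in> module_homs R L N"
  by (simp add: module_homs_def Pi_iff)

context tensor_product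
begin

lemma balanced_smult:
  assumes "r \<in> carrier R"
  shows "balanced_map R M N T (\<lambda>x y. pt (r \<odot>\<^bsub>M\<^esub> x) y)"
  unfolding balanced_map_def
proof (intro conjI ballI)
  fix s x y assume "s \<in> carrier R" "x \<in> carrier M" "y \<in> carrier N"
  then show "pt (r \<odot>\<^bsub>M\<^esub> (s \<odot>\<^bsub>M\<^esub> x)) y = pt (r \<odot>\<^bsub>M\<^esub> x) (s \<odot>\<^bsub>N\<^esub> y)"
    using assms by (metis M.smult_assoc1 M.R.m_comm M.smult_closed pure_smult)
qed (use assms in \<open>auto simp: M.smult_r_distr pure_add_left pure_add_right\<close>)

lemma smult_T: "r \<odot>\<^bsub>T\<^esub> t = tensor_lift (tensor_group R M N) (\<lambda>x y. pt (r \<odot>\<^bsub>M\<^esub> x) y) t"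
  by (simp add: tensor_module_def)

lemma smult_pure:
  "\<lbrakk>r \<in> carrier R; x \<in> carrier M; y \<in> carrier N\<rbrakk> \<Longrightarrow> r \<odot>\<^bsub>T\<^esub> pt x y = pt (r \<odot>\<^bsub>M\<^esub> x) y"
  by (simp add: smult_T lift_pure[OF is_add_group_tensor balanced_smult])

lemma T_module: "module R T"
proof (rule moduleI)
  have closed: "r \<odot>\<^bsub>T\<^esub> t \<in> carrier T" if "r \<in> carrier R" "t \<in> carrier T" for r t
    using that by (simp add: smult_T lift_closed[OF is_add_group_tensor balanced_smult])
  have distr: "r \<odot>\<^bsub>T\<^esub> (s \<oplus>\<^bsub>T\<^esub> t) = r \<odot>\<^bsub>T\<^esub> s \<oplus>\<^bsub>T\<^esub> r \<odot>\<^bsub>T\<^esub> t"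
    if "r \<in> carrier R" "s \<in> carrier T" "t \<in> carrier T" for r s t
    using that by (simp add: smult_T lift_add[OF is_add_group_tensor balanced_smult])
  show "cring R" by (rule M.R.cring_axioms)
  show "abelian_group T" by (rule T.abelian_group_axioms)
  show "r \<odot>\<^bsub>T\<^esub> t \<in> carrier T" if "r \<in> carrier R" "t \<in> carrier T" for r t
    using that by (rule closed)
  show "r \<odot>\<^bsub>T\<^esub> (s \<oplus>\<^bsub>T\<^esub> t) = r \<odot>\<^bsub>T\<^esub> s \<oplus>\<^bsub>T\<^esub> r \<odot>\<^bsub>T\<^esub> t"
    if "r \<in> carrier R" "s \<in> carrier T" "t \<in> carrier T" for r s t
    using that by (rule distr)
  show "(r \<oplus> s) \<odot>\<^bsub>T\<^esub> t = r \<odot>\<^bsub>T\<^esub> t \<oplus>\<^bsub>T\<^esub> s \<odot>\<^bsub>T\<^esub> t"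
    if "r \<in> carrier R" "s \<in> carrier R" "t \<in> carrier T" for r s t
    using that(3)
  proof (induction t rule: tensor_induct)
    case (pure x y)
    then show ?case using that by (simp add: smult_pure M.smult_l_distr pure_add_left)
  next
    case (add t u)
    then show ?case
      using that closed by (simp add: distr T.a_ac)
  qed
  show "(r \<otimes> s) \<odot>\<^bsub>T\<^esub> t = r \<odot>\<^bsub>T\<^esub> (s \<odot>\<^bsub>T\<^esub> t)"
    if "r \<in> carrier R" "s \<in> carrier R" "t \<in> carrier T" for r s t
    using that(3)
  proof (induction t rule: tensor_induct)
    case (pure x y)
    then show ?case using that by (simp add: smult_pure M.smult_assoc1)
  next
    case (add t u)
    then show ?case
      using that closed by (simp add: distr)
  qed
  show "\<one> \<odot>\<^bsub>T\<^esub> t = t" if "t \<in> carrier T" for t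
    using that
  proof (induction t rule: tensor_induct)
    case (add t u)
    then show ?case
      by (simp add: distr)
  qed (simp add: smult_pure)
qed

sublocale T: module R T by (rule T_module)

lemma balanced_mapI:
  assumes "module R P"
    and "\<And>x y. \<lbrakk>x \<in> carrier M; y \<in> carrier N\<rbrakk> \<Longrightarrow> \<beta> x y \<in> carrier P"
    and "\<And>x x' y. \<lbrakk>x \<in> carrier M; x' \<in> carrier M; y \<in> carrier N\<rbrakk> \<Longrightarrow> \<beta> (x \<oplus>\<^bsub>M\<^esub> x') y = \<beta> x y \<oplus>\<^bsub>P\<^esub> \<beta> x' y"
    and "\<And>x y y'. \<lbrakk>x \<in> carrier M; y \<in> carrier N; y' \<in> carrier N\<rbrakk> \<Longrightarrow> \<beta> x (y \<oplus>\<^bsub>N\<^esub> y') = \<beta> x y \<oplus>\<^bsub>P\<^esub> \<beta> x y'"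
    and "\<And>r x y. \<lbrakk>r \<in> carrier R; x \<in> carrier M; y \<in> carrier N\<rbrakk> \<Longrightarrow> \<beta> (r \<odot>\<^bsub>M\<^esub> x) y = r \<odot>\<^bsub>P\<^esub> \<beta> x y"
    and "\<And>r x y. \<lbrakk>r \<in> carrier R; x \<in> carrier M; y \<in> carrier N\<rbrakk> \<Longrightarrow> \<beta> x (r \<odot>\<^bsub>N\<^esub> y) = r \<odot>\<^bsub>P\<^esub> \<beta> x y"
  shows "balanced_map R M N P \<beta>"
  using assms by (simp add: balanced_map_def)

lemma lift_module_hom:
  assumes P: "module R P" and G: "is_add_group G P" and \<beta>: "balanced_map R M N P \<beta>"
    and lin: "\<And>r x y. \<lbrakk>r \<in> carrier R; x \<in> carrier M; y \<in> carrier N\<rbrakk> \<Longrightarrow> \<beta> (r \<odot>\<^bsub>M\<^esub> x) y = r \<odot>\<^bsub>P\<^esub> \<beta> x y"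
  shows "tensor_lift G \<beta> \<in> module_homs R T P"
proof (rule module_homsI)
  interpret P: module R P by fact
  fix r t assume r: "r \<in> carrier R" and "t \<in> carrier T"
  from this(2) show "tensor_lift G \<beta> (r \<odot>\<^bsub>T\<^esub> t) = r \<odot>\<^bsub>P\<^esub> tensor_lift G \<beta> t"
  proof (induction t rule: tensor_induct)
    case (pure x y)
    then show ?case using r by (simp add: smult_pure lift_pure[OF G \<beta>] lin)
  next
    case (add s t)
    then show ?case
      using r by (simp add: T.smult_r_distr lift_add[OF G \<beta>] P.smult_r_distr lift_closed[OF G \<beta>])
  qed
qed (simp_all add: lift_closed[OF G \<beta>] lift_add[OF G \<beta>])

lemma module_homs_eqI:
  assumes "f \<in> module_homs R T P" "g \<in> module_homs R T P" "t \<in> carrier T"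
    and "\<And>x y. \<lbrakk>x \<in> carrier M; y \<in> carrier N\<rbrakk> \<Longrightarrow> f (pt x y) = g (pt x y)"
  shows "f t = g t"
  using assms(3)
  by (induction t rule: tensor_induct)
    (simp_all add: assms(4) module_homsD(2)[OF assms(1)] module_homsD(2)[OF assms(2)])

end

lemma balanced_tensor_map:
  assumes "tensor_product R M N" "tensor_product R M' N'"
    and f: "f \<in> module_homs R M M'" and g: "g \<in> module_homs R N N'"
  shows "balanced_map R M N (tensor_module R M' N') (\<lambda>x y. pure_tensor R M' N' (f x) (g y))"
proof -
  interpret S: tensor_product R M N by fact
  interpret S': tensor_product R M' N' by fact
  show ?thesis
    using module_homsD[OF f] module_homsD[OF g]
    by (intro S.balanced_mapI[OF S'.T_module])
      (simp_all add: S'.pure_add_left S'.pure_add_right S'.smult_pure S'.pure_smult[symmetric])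
qed

lemma tensor_map_pure:
  assumes "tensor_product R M N" "tensor_product R M' N'"
    and "f \<in> module_homs R M M'" "g \<in> module_homs R N N'" "x \<in> carrier M" "y \<in> carrier N"
  shows "tensor_map R M' N' f g (pure_tensor R M N x y) = pure_tensor R M' N' (f x) (g y)"
  unfolding tensor_map_def
  by (rule tensor_product.lift_pure[OF assms(1) tensor_product.is_add_group_tensor[OF assms(2)]
        balanced_tensor_map[OF assms(1-4)] assms(5,6)])

lemma tensor_map_hom:
  assumes S: "tensor_product R M N" and S': "tensor_product R M' N'"
    and f: "f \<in> module_homs R M M'" and g: "g \<in> module_homs R N N'"
  shows "tensor_map R M' N' f g \<in> module_homs R (tensor_module R M N) (tensor_module R M' N')"
  unfolding tensor_map_def
proof (rule tensor_product.lift_module_hom[OF S tensor_product.T_module[OF S']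
      tensor_product.is_add_group_tensor[OF S'] balanced_tensor_map[OF assms]])
  fix r x y assume "r \<in> carrier R" "x \<in> carrier M" "y \<in> carrier N"
  then show "pure_tensor R M' N' (f (r \<odot>\<^bsub>M\<^esub> x)) (g y) =
      r \<odot>\<^bsub>tensor_module R M' N'\<^esub> pure_tensor R M' N' (f x) (g y)"
    using module_homsD[OF f] module_homsD[OF g] by (simp add: tensor_product.smult_pure[OF S'])
qed

section \<open>Tensor products of algebras\<close>

lemma tensor_algebra_simps [simp]:
  "carrier (tensor_algebra R A B) = carrier (tensor_module R A B)"
  "add (tensor_algebra R A B) = add (tensor_module R A B)"
  "ring.zero (tensor_algebra R A B) = ring.zero (tensor_module R A B)"
  "module.smult (tensor_algebra R A B) = module.smult (tensor_module R A B)"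
  "one (tensor_algebra R A B) = pure_tensor R A B (one A) (one B)"
  by (simp_all add: tensor_algebra_def)

lemma associative_algebraI:
  assumes "module R M" "ring M"
    and "\<And>r x y. \<lbrakk>r \<in> carrier R; x \<in> carrier M; y \<in> carrier M\<rbrakk> \<Longrightarrow>
        (r \<odot>\<^bsub>M\<^esub> x) \<otimes>\<^bsub>M\<^esub> y = r \<odot>\<^bsub>M\<^esub> (x \<otimes>\<^bsub>M\<^esub> y)"
    and "\<And>r x y. \<lbrakk>r \<in> carrier R; x \<in> carrier M; y \<in> carrier M\<rbrakk> \<Longrightarrow>
        x \<otimes>\<^bsub>M\<^esub> (r \<odot>\<^bsub>M\<^esub> y) = r \<odot>\<^bsub>M\<^esub> (x \<otimes>\<^bsub>M\<^esub> y)"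
  shows "associative_algebra R M"
  using assms by (simp add: associative_algebra_def associative_algebra_axioms_def)

lemma algebra_homsI:
  assumes "f \<in> module_homs R A B"
    and "\<And>x y. \<lbrakk>x \<in> carrier A; y \<in> carrier A\<rbrakk> \<Longrightarrow> f (x \<otimes>\<^bsub>A\<^esub> y) = f x \<otimes>\<^bsub>B\<^esub> f y"
    and "f \<one>\<^bsub>A\<^esub> = \<one>\<^bsub>B\<^esub>"
  shows "f \<in> algebra_homs R A B"
  using assms by (auto simp: algebra_homs_def ring_hom_def module_homs_def)

lemma algebra_homsD:
  assumes "f \<in> algebra_homs R A B"
  shows "f \<in> module_homs R A B"
    and "\<And>x. x \<in> carrier A \<Longrightarrow> f x \<in> carrier B"
    and "\<And>x y. \<lbrakk>x \<in> carrier A; y \<in> carrier A\<rbrakk> \<Longrightarrow> f (x \<oplus>\<^bsub>A\<^esub> y) = f x \<oplus>\<^bsub>B\<^esub> f y"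
    and "\<And>x y. \<lbrakk>x \<in> carrier A; y \<in> carrier A\<rbrakk> \<Longrightarrow> f (x \<otimes>\<^bsub>A\<^esub> y) = f x \<otimes>\<^bsub>B\<^esub> f y"
    and "\<And>r x. \<lbrakk>r \<in> carrier R; x \<in> carrier A\<rbrakk> \<Longrightarrow> f (r \<odot>\<^bsub>A\<^esub> x) = r \<odot>\<^bsub>B\<^esub> f x"
    and "f \<one>\<^bsub>A\<^esub> = \<one>\<^bsub>B\<^esub>"
  using assms by (auto simp: algebra_homs_def ring_hom_def module_homs_def)

lemma algebra_homs_comp:
  "\<lbrakk>f \<in> algebra_homs R A B; g \<in> algebra_homs R B C\<rbrakk> \<Longrightarrow> (\<lambda>x. g (f x)) \<in> algebra_homs R A C"
  by (simp add: algebra_homs_def module_homs_def ring_hom_def Pi_iff)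

locale two_algebras = A: associative_algebra R A + B: associative_algebra R B
  for R :: "('r, 'c) ring_scheme" (structure) and A :: "('r, 'a, 'd) module_scheme"
    and B :: "('r, 'b, 'e) module_scheme"
begin

sublocale tensor_product R A B
  by (simp add: tensor_product_def A.module_axioms B.module_axioms)

abbreviation "TA \<equiv> tensor_algebra R A B"

abbreviation (input) "mul_inner a b \<equiv>
  tensor_lift (tensor_group R A B) (\<lambda>a' b'. pt (a \<otimes>\<^bsub>A\<^esub> a') (b \<otimes>\<^bsub>B\<^esub> b'))"

lemma balanced_inner:
  assumes "a \<in> carrier A" "b \<in> carrier B"
  shows "balanced_map R A B T (\<lambda>a' b'. pt (a \<otimes>\<^bsub>A\<^esub> a') (b \<otimes>\<^bsub>B\<^esub> b'))"
  using assms
  by (intro balanced_mapI[OF T_module])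
    (simp_all add: A.r_distr B.r_distr pure_add_left pure_add_right A.smult_mult_right
      B.smult_mult_right smult_pure pure_smult[symmetric])

lemma inner_pure:
  "\<lbrakk>a \<in> carrier A; b \<in> carrier B; a' \<in> carrier A; b' \<in> carrier B\<rbrakk> \<Longrightarrow>
    mul_inner a b (pt a' b') = pt (a \<otimes>\<^bsub>A\<^esub> a') (b \<otimes>\<^bsub>B\<^esub> b')"
  by (rule lift_pure[OF is_add_group_tensor balanced_inner])

lemma inner_hom:
  assumes "a \<in> carrier A" "b \<in> carrier B"
  shows "mul_inner a b \<in> module_homs R T T"
  using assms
  by (intro lift_module_hom[OF T_module is_add_group_tensor balanced_inner])
    (simp_all add: A.smult_mult_right smult_pure)

lemma balanced_outer:
  assumes t: "t \<in> carrier T"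
  shows "balanced_map R A B T (\<lambda>a b. mul_inner a b t)"
proof (rule balanced_mapI[OF T_module])
  fix x y assume h: "x \<in> carrier A" "y \<in> carrier B"
  show "mul_inner x y t \<in> carrier T" using module_homsD(1)[OF inner_hom[OF h] t] .
next
  fix x x' y assume h: "x \<in> carrier A" "x' \<in> carrier A" "y \<in> carrier B"
  show "mul_inner (x \<oplus>\<^bsub>A\<^esub> x') y t = mul_inner x y t \<oplus>\<^bsub>T\<^esub> mul_inner x' y t"
    using t
    by (induction t rule: tensor_induct)
      (use h in \<open>simp_all add: inner_pure A.l_distr pure_add_left T.a_ac
        module_homsD[OF inner_hom]\<close>)
next
  fix x y y' assume h: "x \<in> carrier A" "y \<in> carrier B" "y' \<in> carrier B"
  show "mul_inner x (y \<oplus>\<^bsub>B\<^esub> y') t = mul_inner x y t \<oplus>\<^bsub>T\<^esub> mul_inner x y' t"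
    using t
    by (induction t rule: tensor_induct)
      (use h in \<open>simp_all add: inner_pure B.l_distr pure_add_right T.a_ac
        module_homsD[OF inner_hom]\<close>)
next
  fix r x y assume h: "r \<in> carrier R" "x \<in> carrier A" "y \<in> carrier B"
  show "mul_inner (r \<odot>\<^bsub>A\<^esub> x) y t = r \<odot>\<^bsub>T\<^esub> mul_inner x y t"
    using t
    by (induction t rule: tensor_induct)
      (use h in \<open>simp_all add: inner_pure A.smult_mult_left smult_pure T.smult_r_distr
        module_homsD[OF inner_hom]\<close>)
  show "mul_inner x (r \<odot>\<^bsub>B\<^esub> y) t = r \<odot>\<^bsub>T\<^esub> mul_inner x y t"
    using t
    by (induction t rule: tensor_induct)
      (use h in \<open>simp_all add: inner_pure B.smult_mult_left smult_pure T.smult_r_distr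
        pure_smult[symmetric] module_homsD[OF inner_hom]\<close>)
qed

lemma mult_TA: "s \<otimes>\<^bsub>TA\<^esub> t = tensor_lift (tensor_group R A B) (\<lambda>a b. mul_inner a b t) s"
  by (simp add: tensor_algebra_def)

lemma mult_pure_left:
  "\<lbrakk>a \<in> carrier A; b \<in> carrier B; t \<in> carrier T\<rbrakk> \<Longrightarrow> pt a b \<otimes>\<^bsub>TA\<^esub> t = mul_inner a b t"
  by (simp add: mult_TA lift_pure[OF is_add_group_tensor balanced_outer])

lemma mult_pure:
  "\<lbrakk>a \<in> carrier A; b \<in> carrier B; a' \<in> carrier A; b' \<in> carrier B\<rbrakk> \<Longrightarrow>
    pt a b \<otimes>\<^bsub>TA\<^esub> pt a' b' = pt (a \<otimes>\<^bsub>A\<^esub> a') (b \<otimes>\<^bsub>B\<^esub> b')"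
  by (simp add: mult_pure_left inner_pure)

lemma mult_closed_TA: "\<lbrakk>s \<in> carrier T; t \<in> carrier T\<rbrakk> \<Longrightarrow> s \<otimes>\<^bsub>TA\<^esub> t \<in> carrier T"
  by (simp add: mult_TA lift_closed[OF is_add_group_tensor balanced_outer])

lemma l_distr_TA:
  "\<lbrakk>s \<in> carrier T; s' \<in> carrier T; t \<in> carrier T\<rbrakk> \<Longrightarrow>
    (s \<oplus>\<^bsub>T\<^esub> s') \<otimes>\<^bsub>TA\<^esub> t = s \<otimes>\<^bsub>TA\<^esub> t \<oplus>\<^bsub>T\<^esub> s' \<otimes>\<^bsub>TA\<^esub> t"
  by (simp add: mult_TA lift_add[OF is_add_group_tensor balanced_outer])

lemma r_distr_TA:
  assumes s: "s \<in> carrier T" and t: "t \<in> carrier T" "t' \<in> carrier T"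
  shows "s \<otimes>\<^bsub>TA\<^esub> (t \<oplus>\<^bsub>T\<^esub> t') = s \<otimes>\<^bsub>TA\<^esub> t \<oplus>\<^bsub>T\<^esub> s \<otimes>\<^bsub>TA\<^esub> t'"
  using s
  by (induction s rule: tensor_induct)
    (use t in \<open>simp_all add: mult_pure_left module_homsD[OF inner_hom] l_distr_TA mult_closed_TA T.a_ac\<close>)

lemma smult_mult_left_TA:
  assumes r: "r \<in> carrier R" and s: "s \<in> carrier T" and t: "t \<in> carrier T"
  shows "(r \<odot>\<^bsub>T\<^esub> s) \<otimes>\<^bsub>TA\<^esub> t = r \<odot>\<^bsub>T\<^esub> (s \<otimes>\<^bsub>TA\<^esub> t)"
  using s
proof (induction s rule: tensor_induct)
  case (pure x y)
  show ?case
    using t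
    by (induction t rule: tensor_induct)
      (use r pure in \<open>simp_all add: smult_pure mult_pure A.smult_mult_left r_distr_TA mult_closed_TA T.smult_r_distr\<close>)
qed (use r t in \<open>simp_all add: l_distr_TA mult_closed_TA T.smult_r_distr\<close>)

lemma smult_mult_right_TA:
  assumes r: "r \<in> carrier R" and s: "s \<in> carrier T" and t: "t \<in> carrier T"
  shows "s \<otimes>\<^bsub>TA\<^esub> (r \<odot>\<^bsub>T\<^esub> t) = r \<odot>\<^bsub>T\<^esub> (s \<otimes>\<^bsub>TA\<^esub> t)"
  using s
  by (induction s rule: tensor_induct)
    (use r t in \<open>simp_all add: mult_pure_left module_homsD[OF inner_hom] l_distr_TA mult_closed_TA T.smult_r_distr\<close>)

lemma assoc_TA:
  assumes s: "s \<in> carrier T" and t: "t \<in> carrier T" and u: "u \<in> carrier T"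
  shows "(s \<otimes>\<^bsub>TA\<^esub> t) \<otimes>\<^bsub>TA\<^esub> u = s \<otimes>\<^bsub>TA\<^esub> (t \<otimes>\<^bsub>TA\<^esub> u)"
  using s
proof (induction s rule: tensor_induct)
  case s: (pure a b)
  show ?case
    using t
  proof (induction t rule: tensor_induct)
    case t: (pure a' b')
    show ?case
      using u
      by (induction u rule: tensor_induct)
        (use s t in \<open>simp_all add: mult_pure A.m_assoc B.m_assoc r_distr_TA mult_closed_TA\<close>)
  qed (use s u in \<open>simp_all add: r_distr_TA l_distr_TA mult_closed_TA\<close>)
qed (use t u in \<open>simp_all add: l_distr_TA mult_closed_TA\<close>)

lemma TA_ring: "ring TA"
proof (rule ringI)
  show "abelian_group TA"
    by (rule abelian_groupI) (use T.add.l_inv_ex in \<open>auto simp: T.a_ac\<close>)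
  have one_l: "pt \<one>\<^bsub>A\<^esub> \<one>\<^bsub>B\<^esub> \<otimes>\<^bsub>TA\<^esub> t = t" if "t \<in> carrier T" for t
    using that by (induction t rule: tensor_induct) (simp_all add: mult_pure r_distr_TA)
  have one_r: "t \<otimes>\<^bsub>TA\<^esub> pt \<one>\<^bsub>A\<^esub> \<one>\<^bsub>B\<^esub> = t" if "t \<in> carrier T" for t
    using that by (induction t rule: tensor_induct) (simp_all add: mult_pure l_distr_TA)
  show "monoid TA"
    by (rule monoidI) (simp_all add: mult_closed_TA assoc_TA one_l one_r)
qed (simp_all add: l_distr_TA r_distr_TA)

lemma TA_module: "module R TA"
proof (rule moduleI)
  show "abelian_group TA" using TA_ring ring.is_abelian_group by blast
qed (simp_all add: A.R.cring_axioms T.smult_l_distr T.smult_r_distr T.smult_assoc1)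

sublocale TA: associative_algebra R TA
  by (rule associative_algebraI) (simp_all add: TA_module TA_ring smult_mult_left_TA smult_mult_right_TA)

lemma is_add_group_TA: "is_add_group (tensor_group R A B) TA"
  using is_add_group_tensor TA.M.abelian_group_axioms by (simp add: is_add_group_def)

lemma algebra_homsI_TA:
  assumes f: "f \<in> module_homs R T C" and C: "associative_algebra R C"
    and mult: "\<And>a b a' b'. \<lbrakk>a \<in> carrier A; b \<in> carrier B; a' \<in> carrier A; b' \<in> carrier B\<rbrakk> \<Longrightarrow>
      f (pt (a \<otimes>\<^bsub>A\<^esub> a') (b \<otimes>\<^bsub>B\<^esub> b')) = f (pt a b) \<otimes>\<^bsub>C\<^esub> f (pt a' b')"
    and one: "f (pt \<one>\<^bsub>A\<^esub> \<one>\<^bsub>B\<^esub>) = \<one>\<^bsub>C\<^esub>"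
  shows "f \<in> algebra_homs R TA C"
proof (rule algebra_homsI)
  interpret C: associative_algebra R C by fact
  show "f \<in> module_homs R TA C" using f by (simp add: module_homs_def)
  fix s t assume s: "s \<in> carrier TA" and t: "t \<in> carrier TA"
  from s have "s \<in> carrier T" by simp
  then show "f (s \<otimes>\<^bsub>TA\<^esub> t) = f s \<otimes>\<^bsub>C\<^esub> f t"
  proof (induction s rule: tensor_induct)
    case s: (pure a b)
    from t have "t \<in> carrier T" by simp
    then show ?case
      by (induction t rule: tensor_induct)
        (use s in \<open>simp_all add: mult_pure mult r_distr_TA mult_closed_TA module_homsD[OF f] C.r_distr\<close>)
  qed (use t in \<open>simp_all add: l_distr_TA mult_closed_TA module_homsD[OF f] C.l_distr\<close>)
qed (simp add: one)

end

lemma tensor_map_algebra_hom: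
  assumes "two_algebras R A B" "two_algebras R A' B'"
    and f: "f \<in> algebra_homs R A A'" and g: "g \<in> algebra_homs R B B'"
  shows "tensor_map R A' B' f g \<in> algebra_homs R (tensor_algebra R A B) (tensor_algebra R A' B')"
proof -
  interpret S: two_algebras R A B by fact
  interpret S': two_algebras R A' B' by fact
  note P = tensor_map_pure[OF S.tensor_product_axioms S'.tensor_product_axioms
      algebra_homsD(1)[OF f] algebra_homsD(1)[OF g]]
  show ?thesis
  proof (rule S.algebra_homsI_TA)
    show "tensor_map R A' B' f g \<in> module_homs R S.T S'.TA"
      using tensor_map_hom[OF S.tensor_product_axioms S'.tensor_product_axioms
          algebra_homsD(1)[OF f] algebra_homsD(1)[OF g]]
      by (simp add: module_homs_def)
  qed (simp_all add: P S'.TA.associative_algebra_axioms S'.mult_pure algebra_homsD[OF f] algebra_homsD[OF g])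
qed

section \<open>Free modules are faithfully flat\<close>

text \<open>The coordinates with respect to the basis identify \<open>N \<otimes> M\<close> with the finitely supported
  families in \<open>N\<close>, so tensoring a sequence with \<open>M\<close> gives a direct sum of copies of it.\<close>

locale module_with_basis = module R M for R :: "('r, 'c) ring_scheme" (structure) and M :: "('r, 'm, 'd) module_scheme" +
  fixes E assumes basis: "is_basis R M E"
begin

definition is_coord :: "('m \<Rightarrow> 'r) \<Rightarrow> 'm \<Rightarrow> bool" where
  "is_coord c x \<longleftrightarrow> c \<in> UNIV \<rightarrow> carrier R \<and> finite {e. c e \<noteq> \<zero>} \<and> {e. c e \<noteq> \<zero>} \<subseteq> E \<and>
    x = (\<Oplus>\<^bsub>M\<^esub>e\<in>{e. c e \<noteq> \<zero>}. c e \<odot>\<^bsub>M\<^esub> e)"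

definition coord :: "'m \<Rightarrow> 'm \<Rightarrow> 'r" where
  "coord x = (THE c. is_coord c x)"

lemma E_carrier: "e \<in> E \<Longrightarrow> e \<in> carrier M"
  using basis by (auto simp: is_basis_def)

lemma coord_ex1: "x \<in> carrier M \<Longrightarrow> \<exists>!c. is_coord c x"
  using basis unfolding is_basis_def is_coord_def by blast

lemma coord: "x \<in> carrier M \<Longrightarrow> is_coord (coord x) x"
  unfolding coord_def by (rule theI'[OF coord_ex1])

lemma coord_eqI: "\<lbrakk>x \<in> carrier M; is_coord c x\<rbrakk> \<Longrightarrow> coord x = c"
  using coord_ex1 coord by blast

lemma coord_closed [simp]: "x \<in> carrier M \<Longrightarrow> coord x e \<in> carrier R"
  using coord[of x] by (auto simp: is_coord_def)

lemma support_finsum: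
  assumes "c \<in> UNIV \<rightarrow> carrier R" "{e. c e \<noteq> \<zero>} \<subseteq> U" "finite U" "U \<subseteq> E"
  shows "(\<Oplus>\<^bsub>M\<^esub>e\<in>{e. c e \<noteq> \<zero>}. c e \<odot>\<^bsub>M\<^esub> e) = (\<Oplus>\<^bsub>M\<^esub>e\<in>U. c e \<odot>\<^bsub>M\<^esub> e)"
  using assms E_carrier by (intro M.add.finprod_mono_neutral_cong_left) (auto simp: Pi_iff)

lemma is_coordI:
  assumes "c \<in> UNIV \<rightarrow> carrier R" "{e. c e \<noteq> \<zero>} \<subseteq> U" "finite U" "U \<subseteq> E"
    and "x = (\<Oplus>\<^bsub>M\<^esub>e\<in>U. c e \<odot>\<^bsub>M\<^esub> e)"
  shows "is_coord c x"
  using assms support_finsum[OF assms(1-4)] finite_subset[OF assms(2,3)] by (auto simp: is_coord_def)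

lemma coord_sum:
  assumes x: "x \<in> carrier M"
  obtains U where "finite U" "U \<subseteq> E"
    "\<And>V. \<lbrakk>finite V; U \<subseteq> V; V \<subseteq> E\<rbrakk> \<Longrightarrow> x = (\<Oplus>\<^bsub>M\<^esub>e\<in>V. coord x e \<odot>\<^bsub>M\<^esub> e)"
    "\<And>e. e \<notin> U \<Longrightarrow> coord x e = \<zero>"
proof -
  note c = coord[OF x, unfolded is_coord_def]
  show thesis
  proof (rule that[of "{e. coord x e \<noteq> \<zero>}"])
    fix V assume "finite V" "{e. coord x e \<noteq> \<zero>} \<subseteq> V" "V \<subseteq> E"
    then show "x = (\<Oplus>\<^bsub>M\<^esub>e\<in>V. coord x e \<odot>\<^bsub>M\<^esub> e)"
      using support_finsum[of "coord x" V] c by simp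
  qed (use c in auto)
qed

lemma coord_add:
  assumes x: "x \<in> carrier M" and y: "y \<in> carrier M"
  shows "coord (x \<oplus>\<^bsub>M\<^esub> y) e = coord x e \<oplus> coord y e"
proof -
  obtain U where U: "finite U" "U \<subseteq> E"
    "\<And>V. \<lbrakk>finite V; U \<subseteq> V; V \<subseteq> E\<rbrakk> \<Longrightarrow> x = (\<Oplus>\<^bsub>M\<^esub>e\<in>V. coord x e \<odot>\<^bsub>M\<^esub> e)"
    "\<And>e. e \<notin> U \<Longrightarrow> coord x e = \<zero>"
    by (rule coord_sum[OF x that])
  obtain W where W: "finite W" "W \<subseteq> E"
    "\<And>V. \<lbrakk>finite V; W \<subseteq> V; V \<subseteq> E\<rbrakk> \<Longrightarrow> y = (\<Oplus>\<^bsub>M\<^esub>e\<in>V. coord y e \<odot>\<^bsub>M\<^esub> e)"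
    "\<And>e. e \<notin> W \<Longrightarrow> coord y e = \<zero>"
    by (rule coord_sum[OF y that])
  have "x = (\<Oplus>\<^bsub>M\<^esub>e\<in>U \<union> W. coord x e \<odot>\<^bsub>M\<^esub> e)" "y = (\<Oplus>\<^bsub>M\<^esub>e\<in>U \<union> W. coord y e \<odot>\<^bsub>M\<^esub> e)"
    by (rule U(3) W(3); use U(1,2) W(1,2) in blast)+
  then have "x \<oplus>\<^bsub>M\<^esub> y = (\<Oplus>\<^bsub>M\<^esub>e\<in>U \<union> W. coord x e \<odot>\<^bsub>M\<^esub> e) \<oplus>\<^bsub>M\<^esub> (\<Oplus>\<^bsub>M\<^esub>e\<in>U \<union> W. coord y e \<odot>\<^bsub>M\<^esub> e)"
    by (rule arg_cong2)
  also have "\<dots> = (\<Oplus>\<^bsub>M\<^esub>e\<in>U \<union> W. coord x e \<odot>\<^bsub>M\<^esub> e \<oplus>\<^bsub>M\<^esub> coord y e \<odot>\<^bsub>M\<^esub> e)"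
    using x y U(2) W(2) E_carrier by (intro M.finsum_addf[symmetric]) auto
  also have "\<dots> = (\<Oplus>\<^bsub>M\<^esub>e\<in>U \<union> W. (coord x e \<oplus> coord y e) \<odot>\<^bsub>M\<^esub> e)"
    using x y U(2) W(2) E_carrier by (intro M.finsum_cong') (auto simp: smult_l_distr)
  finally have sum: "x \<oplus>\<^bsub>M\<^esub> y = (\<Oplus>\<^bsub>M\<^esub>e\<in>U \<union> W. (coord x e \<oplus> coord y e) \<odot>\<^bsub>M\<^esub> e)" .
  have "coord x e \<oplus> coord y e = \<zero>" if "e \<notin> U \<union> W" for e
    using U(4) W(4) that by simp
  then have "is_coord (\<lambda>e. coord x e \<oplus> coord y e) (x \<oplus>\<^bsub>M\<^esub> y)"
    using x y U(1,2) W(1,2) by (intro is_coordI[OF _ _ _ _ sum]) auto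
  then show ?thesis using coord_eqI[of "x \<oplus>\<^bsub>M\<^esub> y"] x y by simp
qed

lemma coord_smult:
  assumes r: "r \<in> carrier R" and x: "x \<in> carrier M"
  shows "coord (r \<odot>\<^bsub>M\<^esub> x) e = r \<otimes> coord x e"
proof -
  obtain U where U: "finite U" "U \<subseteq> E"
    "\<And>V. \<lbrakk>finite V; U \<subseteq> V; V \<subseteq> E\<rbrakk> \<Longrightarrow> x = (\<Oplus>\<^bsub>M\<^esub>e\<in>V. coord x e \<odot>\<^bsub>M\<^esub> e)"
    "\<And>e. e \<notin> U \<Longrightarrow> coord x e = \<zero>"
    by (rule coord_sum[OF x that])
  have "r \<odot>\<^bsub>M\<^esub> (\<Oplus>\<^bsub>M\<^esub>e\<in>V. coord x e \<odot>\<^bsub>M\<^esub> e) = (\<Oplus>\<^bsub>M\<^esub>e\<in>V. (r \<otimes> coord x e) \<odot>\<^bsub>M\<^esub> e)"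
    if "finite V" "V \<subseteq> E" for V
    using that
  proof (induction V rule: finite_induct)
    case (insert e V)
    then have c: "(\<lambda>e. coord x e \<odot>\<^bsub>M\<^esub> e) \<in> V \<rightarrow> carrier M" "coord x e \<odot>\<^bsub>M\<^esub> e \<in> carrier M"
      "(\<lambda>e. (r \<otimes> coord x e) \<odot>\<^bsub>M\<^esub> e) \<in> V \<rightarrow> carrier M" "(r \<otimes> coord x e) \<odot>\<^bsub>M\<^esub> e \<in> carrier M"
      using E_carrier r x by auto
    show ?case
      using insert c E_carrier r x
      by (simp add: M.finsum_insert smult_r_distr M.finsum_closed smult_assoc1)
  qed (use r in simp)
  note step = this[OF U(1,2)]
  have sum: "(\<Oplus>\<^bsub>M\<^esub>e\<in>U. coord x e \<odot>\<^bsub>M\<^esub> e) = x"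
    by (rule U(3)[symmetric]) (use U in auto)
  have "r \<odot>\<^bsub>M\<^esub> x = (\<Oplus>\<^bsub>M\<^esub>e\<in>U. (r \<otimes> coord x e) \<odot>\<^bsub>M\<^esub> e)"
    using step unfolding sum .
  moreover have "r \<otimes> coord x e = \<zero>" if "e \<notin> U" for e
    using U(4)[OF that] r by simp
  ultimately have "is_coord (\<lambda>e. r \<otimes> coord x e) (r \<odot>\<^bsub>M\<^esub> x)"
    using r x U(1,2) by (intro is_coordI[of _ U]) auto
  then show ?thesis using coord_eqI[of "r \<odot>\<^bsub>M\<^esub> x"] r x by simp
qed

lemma coord_basis: "e \<in> E \<Longrightarrow> coord e e' = (if e' = e then \<one> else \<zero>)"
proof -
  assume e: "e \<in> E"
  then have "is_coord (\<lambda>e'. if e' = e then \<one> else \<zero>) e"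
    using E_carrier[OF e] by (intro is_coordI[of _ "{e}"]) (auto simp: M.finsum_insert)
  then show ?thesis using coord_eqI[of e] E_carrier[OF e] by simp
qed

definition comp :: "('r, 'n, 'f) module_scheme \<Rightarrow> 'm \<Rightarrow> ('n \<times> 'm \<Rightarrow>\<^sub>0 int) set \<Rightarrow> 'n" where
  "comp N e = tensor_lift (add_monoid N) (\<lambda>n m. coord m e \<odot>\<^bsub>N\<^esub> n)"

lemma comp_hom:
  assumes "module R N"
  shows "comp N e \<in> module_homs R (tensor_module R N M) N"
    and "\<And>n m. \<lbrakk>n \<in> carrier N; m \<in> carrier M\<rbrakk> \<Longrightarrow> comp N e (pure_tensor R N M n m) = coord m e \<odot>\<^bsub>N\<^esub> n"
proof -
  interpret N: module R N by fact
  interpret NM: tensor_product R N M by (simp add: tensor_product_def N.module_axioms module_axioms)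
  have s: "r \<odot>\<^bsub>N\<^esub> (s \<odot>\<^bsub>N\<^esub> x) = s \<odot>\<^bsub>N\<^esub> (r \<odot>\<^bsub>N\<^esub> x)" if "r \<in> carrier R" "s \<in> carrier R" "x \<in> carrier N" for r s x
    using that by (metis N.smult_assoc1 R.m_comm)
  have b: "balanced_map R N M N (\<lambda>n m. coord m e \<odot>\<^bsub>N\<^esub> n)"
    by (rule NM.balanced_mapI[OF N.module_axioms])
      (simp_all add: N.smult_r_distr coord_add coord_smult N.smult_l_distr N.smult_assoc1 s)
  note G = is_add_group_add_monoid[OF N.M.abelian_group_axioms]
  show "comp N e \<in> module_homs R (tensor_module R N M) N"
    unfolding comp_def by (rule NM.lift_module_hom[OF N.module_axioms G b]) (simp add: s)
  show "\<And>n m. \<lbrakk>n \<in> carrier N; m \<in> carrier M\<rbrakk> \<Longrightarrow> comp N e (pure_tensor R N M n m) = coord m e \<odot>\<^bsub>N\<^esub> n"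
    unfolding comp_def by (rule NM.lift_pure[OF G b])
qed

lemma tensor_decomp:
  assumes "module R N" "t \<in> carrier (tensor_module R N M)"
  obtains U where "finite U" "U \<subseteq> E"
    "t = (\<Oplus>\<^bsub>tensor_module R N M\<^esub>e\<in>U. pure_tensor R N M (comp N e t) e)"
proof -
  interpret N: module R N by fact
  interpret NM: tensor_product R N M by (simp add: tensor_product_def N.module_axioms module_axioms)
  note D = module_homsD[OF comp_hom(1)[OF assms(1)]]
  define supp where "supp t U \<longleftrightarrow> finite U \<and> U \<subseteq> E \<and> (\<forall>V. finite V \<longrightarrow> U \<subseteq> V \<longrightarrow> V \<subseteq> E \<longrightarrow>
      t = (\<Oplus>\<^bsub>NM.T\<^esub>e\<in>V. NM.pt (comp N e t) e))" for t U
  have suppI: "supp t U" if "finite U" "U \<subseteq> E"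
      "\<And>V. \<lbrakk>finite V; U \<subseteq> V; V \<subseteq> E\<rbrakk> \<Longrightarrow> t = (\<Oplus>\<^bsub>NM.T\<^esub>e\<in>V. NM.pt (comp N e t) e)" for t U
    unfolding supp_def by (intro conjI allI impI that)
  have suppD: "finite U" "U \<subseteq> E"
      "\<And>V. \<lbrakk>finite V; U \<subseteq> V; V \<subseteq> E\<rbrakk> \<Longrightarrow> t = (\<Oplus>\<^bsub>NM.T\<^esub>e\<in>V. NM.pt (comp N e t) e)" if "supp t U" for t U
  proof -
    note h = that[unfolded supp_def]
    show "finite U" by (rule conjunct1[OF h])
    show "U \<subseteq> E" by (rule conjunct1[OF conjunct2[OF h]])
    show "t = (\<Oplus>\<^bsub>NM.T\<^esub>e\<in>V. NM.pt (comp N e t) e)" if "finite V" "U \<subseteq> V" "V \<subseteq> E" for V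
      by (rule conjunct2[OF conjunct2[OF h], rule_format, OF that])
  qed
  have "\<exists>U. supp t U"
    using assms(2)
  proof (induction t rule: NM.tensor_induct)
    case (pure n m)
    obtain U where U: "finite U" "U \<subseteq> E"
      "\<And>V. \<lbrakk>finite V; U \<subseteq> V; V \<subseteq> E\<rbrakk> \<Longrightarrow> m = (\<Oplus>\<^bsub>M\<^esub>e\<in>V. coord m e \<odot>\<^bsub>M\<^esub> e)"
      "\<And>e. e \<notin> U \<Longrightarrow> coord m e = \<zero>"
      by (rule coord_sum[OF pure(2) that])
    have sum: "NM.pt n (\<Oplus>\<^bsub>M\<^esub>e\<in>V. coord m e \<odot>\<^bsub>M\<^esub> e) = (\<Oplus>\<^bsub>NM.T\<^esub>e\<in>V. NM.pt (coord m e \<odot>\<^bsub>N\<^esub> n) e)"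
      if "finite V" "V \<subseteq> E" for V
      using that
    proof (induction V rule: finite_induct)
      case empty
      have "NM.pt n \<zero>\<^bsub>M\<^esub> = \<zero>\<^bsub>NM.T\<^esub>"
        using NM.pure_smult[of \<zero> n "\<zero>\<^bsub>M\<^esub>"] NM.pure_zero_left[of "\<zero>\<^bsub>M\<^esub>"] pure(1) by simp
      then show ?case by simp
    next
      case (insert e V)
      then have c: "(\<lambda>e. coord m e \<odot>\<^bsub>M\<^esub> e) \<in> V \<rightarrow> carrier M" "coord m e \<odot>\<^bsub>M\<^esub> e \<in> carrier M"
        "(\<lambda>e. NM.pt (coord m e \<odot>\<^bsub>N\<^esub> n) e) \<in> V \<rightarrow> carrier NM.T" "NM.pt (coord m e \<odot>\<^bsub>N\<^esub> n) e \<in> carrier NM.T"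
        using E_carrier pure by auto
      show ?case
        using insert.hyps insert.IH insert.prems c E_carrier pure NM.pure_smult[of "coord m e" n e]
        by (simp add: M.finsum_insert NM.T.finsum_insert NM.pure_add_right M.finsum_closed)
    qed
    have "NM.pt n m = (\<Oplus>\<^bsub>NM.T\<^esub>e\<in>V. NM.pt (comp N e (NM.pt n m)) e)" if V: "finite V" "U \<subseteq> V" "V \<subseteq> E" for V
      using sum[OF V(1,3)] unfolding U(3)[OF V, symmetric] comp_hom(2)[OF assms(1) pure] .
    then have "supp (NM.pt n m) U" by (rule suppI[OF U(1,2)])
    then show ?case by (rule exI)
  next
    case (add s t)
    obtain U where "supp s U" using add(3) by (rule exE)
    note U = suppD[OF this]
    obtain W where "supp t W" using add(4) by (rule exE)
    note W = suppD[OF this]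
    have "s \<oplus>\<^bsub>NM.T\<^esub> t = (\<Oplus>\<^bsub>NM.T\<^esub>e\<in>V. NM.pt (comp N e (s \<oplus>\<^bsub>NM.T\<^esub> t)) e)"
      if V: "finite V" "U \<union> W \<subseteq> V" "V \<subseteq> E" for V
    proof -
      have "s = (\<Oplus>\<^bsub>NM.T\<^esub>e\<in>V. NM.pt (comp N e s) e)" "t = (\<Oplus>\<^bsub>NM.T\<^esub>e\<in>V. NM.pt (comp N e t) e)"
        by (rule U(3) W(3); use V in blast)+
      then have "s \<oplus>\<^bsub>NM.T\<^esub> t = (\<Oplus>\<^bsub>NM.T\<^esub>e\<in>V. NM.pt (comp N e s) e) \<oplus>\<^bsub>NM.T\<^esub> (\<Oplus>\<^bsub>NM.T\<^esub>e\<in>V. NM.pt (comp N e t) e)"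
        by (rule arg_cong2)
      also have "\<dots> = (\<Oplus>\<^bsub>NM.T\<^esub>e\<in>V. NM.pt (comp N e s) e \<oplus>\<^bsub>NM.T\<^esub> NM.pt (comp N e t) e)"
        using V(3) E_carrier add(1,2) D(1) by (intro NM.T.finsum_addf[symmetric]) auto
      also have "\<dots> = (\<Oplus>\<^bsub>NM.T\<^esub>e\<in>V. NM.pt (comp N e (s \<oplus>\<^bsub>NM.T\<^esub> t)) e)"
        using V(3) E_carrier add(1,2) D(1,2) by (intro NM.T.finsum_cong') (auto simp: NM.pure_add_left)
      finally show ?thesis .
    qed
    then have "supp (s \<oplus>\<^bsub>NM.T\<^esub> t) (U \<union> W)"
      by (rule suppI[rotated 2]) (use U(1,2) W(1,2) in auto)
    then show ?case by (rule exI)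
  qed
  then obtain U where "supp t U" by (rule exE)
  note U = suppD[OF this]
  show thesis by (rule that[OF U(1,2) U(3)[OF U(1) subset_refl U(2)]])
qed

theorem free_imp_faithfully_flat:
  assumes E: "E \<noteq> {}"
  shows "faithfully_flat TYPE('n) R M"
  unfolding faithfully_flat_def
proof (intro conjI allI impI)
  show "module R M" by (rule module_axioms)
next
  fix N1 N2 N3 :: "('r, 'n) module" and f g
  assume "module R N1 \<and> module R N2 \<and> module R N3 \<and> f \<in> module_homs R N1 N2 \<and> g \<in> module_homs R N2 N3"
  then have N: "module R N1" "module R N2" "module R N3" and f: "f \<in> module_homs R N1 N2"
    and g: "g \<in> module_homs R N2 N3" by auto
  interpret N1: module R N1 by fact
  interpret N2: module R N2 by fact
  interpret N3: module R N3 by fact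
  interpret T1: tensor_product R N1 M by (simp add: tensor_product_def N module_axioms)
  interpret T2: tensor_product R N2 M by (simp add: tensor_product_def N module_axioms)
  interpret T3: tensor_product R N3 M by (simp add: tensor_product_def N module_axioms)
  have id: "(\<lambda>u. u) \<in> module_homs R M M" by (auto simp: module_homs_def)
  define F where "F = tensor_map R N2 M f (\<lambda>u. u)"
  define G where "G = tensor_map R N3 M g (\<lambda>u. u)"
  note hF = module_homsD[OF tensor_map_hom[OF T1.tensor_product_axioms T2.tensor_product_axioms f id], folded F_def]
  note pF = tensor_map_pure[OF T1.tensor_product_axioms T2.tensor_product_axioms f id, folded F_def]
  note hG = module_homsD[OF tensor_map_hom[OF T2.tensor_product_axioms T3.tensor_product_axioms g id], folded G_def]
  note pG = tensor_map_pure[OF T2.tensor_product_axioms T3.tensor_product_axioms g id, folded G_def]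
  note c1 = module_homsD[OF comp_hom(1)[OF N(1)]] and c2 = module_homsD[OF comp_hom(1)[OF N(2)]]
    and c3 = module_homsD[OF comp_hom(1)[OF N(3)]]
  note Df = module_homsD[OF f] and Dg = module_homsD[OF g]
  have natF: "comp N2 e (F t) = f (comp N1 e t)" if "t \<in> carrier T1.T" for e t
    using that by (induction t rule: T1.tensor_induct)
      (simp_all add: pF hF comp_hom(2)[OF N(1)] comp_hom(2)[OF N(2)] Df c1 c2)
  have natG: "comp N3 e (G t) = g (comp N2 e t)" if "t \<in> carrier T2.T" for e t
    using that by (induction t rule: T2.tensor_induct)
      (simp_all add: pG hG comp_hom(2)[OF N(2)] comp_hom(2)[OF N(3)] Dg c2 c3)
  have zero: "comp N3 e \<zero>\<^bsub>T3.T\<^esub> = \<zero>\<^bsub>N3\<^esub>" for e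
    by (rule module_homs_zero[OF T3.T_module N(3) comp_hom(1)[OF N(3)]])
  have kerG: "G t = \<zero>\<^bsub>T3.T\<^esub> \<longleftrightarrow> (\<forall>e\<in>E. g (comp N2 e t) = \<zero>\<^bsub>N3\<^esub>)" if t: "t \<in> carrier T2.T" for t
  proof
    assume "G t = \<zero>\<^bsub>T3.T\<^esub>"
    then show "\<forall>e\<in>E. g (comp N2 e t) = \<zero>\<^bsub>N3\<^esub>" using natG[OF t, symmetric] zero by simp
  next
    assume 0: "\<forall>e\<in>E. g (comp N2 e t) = \<zero>\<^bsub>N3\<^esub>"
    obtain U where U: "finite U" "U \<subseteq> E" "G t = (\<Oplus>\<^bsub>T3.T\<^esub>e\<in>U. T3.pt (comp N3 e (G t)) e)"
      using tensor_decomp[OF N(3) hG(1)[OF t]] by blast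
    have "(\<Oplus>\<^bsub>T3.T\<^esub>e\<in>U. T3.pt (comp N3 e (G t)) e) = (\<Oplus>\<^bsub>T3.T\<^esub>e\<in>U. \<zero>\<^bsub>T3.T\<^esub>)"
      using U(2) 0 E_carrier by (intro T3.T.finsum_cong') (auto simp: natG[OF t] T3.pure_zero_left)
    also have "\<dots> = \<zero>\<^bsub>T3.T\<^esub>" by (rule T3.T.finsum_zero)
    finally show "G t = \<zero>\<^bsub>T3.T\<^esub>" by (rule trans[OF U(3)])
  qed
  show "(f ` carrier N1 = a_kernel N2 N3 g) \<longleftrightarrow>
    (tensor_map R N2 M f (\<lambda>u. u) ` carrier T1.T = a_kernel T2.T T3.T (tensor_map R N3 M g (\<lambda>u. u)))"
    unfolding F_def[symmetric] G_def[symmetric] a_kernel_def'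
  proof
    assume ex: "f ` carrier N1 = {x \<in> carrier N2. g x = \<zero>\<^bsub>N3\<^esub>}"
    show "F ` carrier T1.T = {t \<in> carrier T2.T. G t = \<zero>\<^bsub>T3.T\<^esub>}"
    proof (intro equalityI subsetI)
      fix t assume "t \<in> F ` carrier T1.T"
      then obtain s where s: "s \<in> carrier T1.T" "t = F s" by auto
      have "g (comp N2 e t) = \<zero>\<^bsub>N3\<^esub>" for e
      proof -
        have "f (comp N1 e s) \<in> {x \<in> carrier N2. g x = \<zero>\<^bsub>N3\<^esub>}"
          unfolding ex[symmetric] by (rule imageI) (rule c1(1)[OF s(1)])
        then show ?thesis by (simp add: s(2) natF[OF s(1)])
      qed
      then show "t \<in> {t \<in> carrier T2.T. G t = \<zero>\<^bsub>T3.T\<^esub>}"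
        using kerG[of t] hF(1)[OF s(1)] s(2) by simp
    next
      fix t assume "t \<in> {t \<in> carrier T2.T. G t = \<zero>\<^bsub>T3.T\<^esub>}"
      then have t: "t \<in> carrier T2.T" "\<forall>e\<in>E. g (comp N2 e t) = \<zero>\<^bsub>N3\<^esub>" using kerG by auto
      obtain U where U: "finite U" "U \<subseteq> E" "t = (\<Oplus>\<^bsub>T2.T\<^esub>e\<in>U. T2.pt (comp N2 e t) e)"
        using tensor_decomp[OF N(2) t(1)] by blast
      have im: "T2.pt (comp N2 e t) e \<in> F ` carrier T1.T" if "e \<in> U" for e
      proof -
        have "comp N2 e t \<in> f ` carrier N1" unfolding ex using t(2) c2(1)[OF t(1)] that U(2) by simp blast
        then obtain n where n: "comp N2 e t = f n" "n \<in> carrier N1" by (rule imageE)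
        have e: "e \<in> carrier M" using that U(2) E_carrier by blast
        show ?thesis
          unfolding n(1) pF[OF n(2) e, symmetric] using n(2) e by (intro imageI T1.pure_closed)
      qed
      have F0: "F \<zero>\<^bsub>T1.T\<^esub> = \<zero>\<^bsub>T2.T\<^esub>"
        unfolding F_def
        by (rule module_homs_zero[OF T1.T_module T2.T_module
            tensor_map_hom[OF T1.tensor_product_axioms T2.tensor_product_axioms f id]])
      have "(\<Oplus>\<^bsub>T2.T\<^esub>e\<in>V. T2.pt (comp N2 e t) e) \<in> F ` carrier T1.T" if "finite V" "V \<subseteq> U" for V
        using that
      proof (induction V rule: finite_induct)
        case empty
        have "\<zero>\<^bsub>T2.T\<^esub> \<in> F ` carrier T1.T" unfolding F0[symmetric] by (rule imageI) (rule T1.T.zero_closed)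
        then show ?case by simp
      next
        case (insert e V)
        have c: "(\<lambda>e. T2.pt (comp N2 e t) e) \<in> V \<rightarrow> carrier T2.T" "T2.pt (comp N2 e t) e \<in> carrier T2.T"
          using insert U(2) E_carrier c2(1)[OF t(1)] by auto
        have eU: "e \<in> U" "V \<subseteq> U" using insert.prems by auto
        obtain s where s: "T2.pt (comp N2 e t) e = F s" "s \<in> carrier T1.T"
          by (rule imageE[OF im[OF eU(1)]])
        obtain s' where s': "(\<Oplus>\<^bsub>T2.T\<^esub>e\<in>V. T2.pt (comp N2 e t) e) = F s'" "s' \<in> carrier T1.T"
          by (rule imageE[OF insert.IH[OF eU(2)]])
        have "(\<Oplus>\<^bsub>T2.T\<^esub>e\<in>insert e V. T2.pt (comp N2 e t) e) = F (s \<oplus>\<^bsub>T1.T\<^esub> s')"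
          using insert.hyps c by (simp add: T2.T.finsum_insert hF s s')
        then show ?case using s(2) s'(2) by (simp add: rev_image_eqI)
      qed
      from this[OF U(1) subset_refl] show "t \<in> F ` carrier T1.T" by (rule ssubst[OF U(3)])
    qed
  next
    assume ex: "F ` carrier T1.T = {t \<in> carrier T2.T. G t = \<zero>\<^bsub>T3.T\<^esub>}"
    obtain e where e: "e \<in> E" using E by auto
    have em: "e \<in> carrier M" using E_carrier[OF e] .
    show "f ` carrier N1 = {x \<in> carrier N2. g x = \<zero>\<^bsub>N3\<^esub>}"
    proof (intro equalityI subsetI)
      fix x assume "x \<in> f ` carrier N1"
      then obtain n where n: "n \<in> carrier N1" "x = f n" by auto
      have "F (T1.pt n e) \<in> {t \<in> carrier T2.T. G t = \<zero>\<^bsub>T3.T\<^esub>}"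
        unfolding ex[symmetric] using n(1) em by (intro imageI T1.pure_closed)
      then have "T2.pt x e \<in> carrier T2.T" "G (T2.pt x e) = \<zero>\<^bsub>T3.T\<^esub>"
        unfolding pF[OF n(1) em] n(2) by simp_all
      then have "g (comp N2 e (T2.pt x e)) = \<zero>\<^bsub>N3\<^esub>"
        using kerG e by blast
      then show "x \<in> {x \<in> carrier N2. g x = \<zero>\<^bsub>N3\<^esub>}"
        using n em e Df(1) by (simp add: comp_hom(2)[OF N(2)] coord_basis)
    next
      fix x assume "x \<in> {x \<in> carrier N2. g x = \<zero>\<^bsub>N3\<^esub>}"
      then have x: "x \<in> carrier N2" "g x = \<zero>\<^bsub>N3\<^esub>" by auto
      have "G (T2.pt x e) = \<zero>\<^bsub>T3.T\<^esub>"
        using pG x em by (simp add: T3.pure_zero_left)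
      then have "T2.pt x e \<in> F ` carrier T1.T" unfolding ex using x em by simp
      then obtain s where s: "s \<in> carrier T1.T" "T2.pt x e = F s" by (elim imageE)
      have "x = comp N2 e (T2.pt x e)"
        using x em e by (simp add: comp_hom(2)[OF N(2)] coord_basis)
      also have "\<dots> = f (comp N1 e s)" unfolding s(2) by (rule natF[OF s(1)])
      finally show "x \<in> f ` carrier N1" using c1(1)[OF s(1)] by blast
    qed
  qed
qed

end

lemma tensor_module_tensor_algebra [simp]:
  "tensor_group R (tensor_algebra R A B) N = tensor_group R (tensor_module R A B) N"
  "pure_tensor R (tensor_algebra R A B) N = pure_tensor R (tensor_module R A B) N"
  "tensor_module R (tensor_algebra R A B) N = tensor_module R (tensor_module R A B) N"
  "tensor_group R M (tensor_algebra R A B) = tensor_group R M (tensor_module R A B)"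
  "pure_tensor R M (tensor_algebra R A B) = pure_tensor R M (tensor_module R A B)"
  "tensor_module R M (tensor_algebra R A B) = tensor_module R M (tensor_module R A B)"
proof -
  have rel: "tensor_relations R (tensor_algebra R A B) N = tensor_relations R (tensor_module R A B) N"
    "tensor_relations R M (tensor_algebra R A B) = tensor_relations R M (tensor_module R A B)"
    unfolding tensor_relations_def by simp_all
  then have null: "tensor_null R (tensor_algebra R A B) N = tensor_null R (tensor_module R A B) N"
    "tensor_null R M (tensor_algebra R A B) = tensor_null R M (tensor_module R A B)"
    unfolding tensor_null_def by simp_all
  then show group: "tensor_group R (tensor_algebra R A B) N = tensor_group R (tensor_module R A B) N"
    "tensor_group R M (tensor_algebra R A B) = tensor_group R M (tensor_module R A B)"
    unfolding tensor_group_def by simp_all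
  show pure: "pure_tensor R (tensor_algebra R A B) N = pure_tensor R (tensor_module R A B) N"
    "pure_tensor R M (tensor_algebra R A B) = pure_tensor R M (tensor_module R A B)"
    unfolding pure_tensor_def by (simp_all add: null fun_eq_iff)
  show "tensor_module R (tensor_algebra R A B) N = tensor_module R (tensor_module R A B) N"
    "tensor_module R M (tensor_algebra R A B) = tensor_module R M (tensor_module R A B)"
    unfolding tensor_module_def[of R "tensor_algebra R A B"] tensor_module_def[of R "tensor_module R A B"]
      tensor_module_def[of R M]
    by (simp_all add: group pure)
qed

lemma tensor_map_tensor_algebra [simp]:
  "tensor_map R (tensor_algebra R A B) N f g = tensor_map R (tensor_module R A B) N f g"
  "tensor_map R M (tensor_algebra R A B) f g = tensor_map R M (tensor_module R A B) f g"
  by (simp_all add: tensor_map_def)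

locale three_algebras = A: associative_algebra R A + B: associative_algebra R B +
    C: associative_algebra R C
  for R :: "('r, 'c) ring_scheme" (structure) and A :: "('r, 'a, 'd) module_scheme"
    and B :: "('r, 'b, 'e) module_scheme" and C :: "('r, 'm, 'f) module_scheme"
begin

sublocale AB: two_algebras R A B
  by (simp add: two_algebras_def A.associative_algebra_axioms B.associative_algebra_axioms)

sublocale BC: two_algebras R B C
  by (simp add: two_algebras_def B.associative_algebra_axioms C.associative_algebra_axioms)

sublocale AB_C: two_algebras R "tensor_algebra R A B" C
  by (simp add: two_algebras_def AB.TA.associative_algebra_axioms C.associative_algebra_axioms)

sublocale A_BC: two_algebras R A "tensor_algebra R B C"
  by (simp add: two_algebras_def BC.TA.associative_algebra_axioms A.associative_algebra_axioms)

abbreviation (input) "reassoc z \<equiv> tensor_lift (tensor_group R A (tensor_module R B C))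
  (\<lambda>x y. pure_tensor R A (tensor_module R B C) x (pure_tensor R B C y z))"

lemma balanced_reassoc:
  assumes z: "z \<in> carrier C"
  shows "balanced_map R A B A_BC.T (\<lambda>x y. A_BC.pt x (BC.pt y z))"
  using z A_BC.pure_add_left A_BC.pure_add_right A_BC.pure_smult[symmetric] A_BC.smult_pure
    A_BC.pure_closed
  by (intro AB.balanced_mapI[OF A_BC.T_module])
    (simp_all add: BC.pure_add_left BC.smult_pure[symmetric])

lemma reassoc_pure:
  "\<lbrakk>x \<in> carrier A; y \<in> carrier B; z \<in> carrier C\<rbrakk> \<Longrightarrow> reassoc z (AB.pt x y) = A_BC.pt x (BC.pt y z)"
  using AB.lift_pure[OF A_BC.is_add_group_tensor balanced_reassoc] by simp

lemma reassoc_hom: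
  assumes "z \<in> carrier C"
  shows "reassoc z \<in> module_homs R AB.T A_BC.T"
  using assms A_BC.pure_smult[symmetric] A_BC.smult_pure
    AB.lift_module_hom[OF A_BC.T_module A_BC.is_add_group_tensor balanced_reassoc]
  by simp

lemma balanced_assoc: "balanced_map R (tensor_algebra R A B) C A_BC.T (\<lambda>t z. reassoc z t)"
proof (rule AB_C.balanced_mapI[OF A_BC.T_module])
  fix t z assume h: "t \<in> carrier AB.TA" "z \<in> carrier C"
  then show "reassoc z t \<in> carrier A_BC.T"
    using module_homsD[OF reassoc_hom] by simp
next
  fix t t' z assume h: "t \<in> carrier AB.TA" "t' \<in> carrier AB.TA" "z \<in> carrier C"
  then show "reassoc z (t \<oplus>\<^bsub>AB.TA\<^esub> t') = reassoc z t \<oplus>\<^bsub>A_BC.T\<^esub> reassoc z t'"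
    using module_homsD[OF reassoc_hom] by simp
next
  fix t z z' assume h: "t \<in> carrier AB.TA" "z \<in> carrier C" "z' \<in> carrier C"
  from h(1) have "t \<in> carrier AB.T" by simp
  then show "reassoc (z \<oplus>\<^bsub>C\<^esub> z') t = reassoc z t \<oplus>\<^bsub>A_BC.T\<^esub> reassoc z' t"
  proof (induction t rule: AB.tensor_induct)
    case (pure x y)
    then show ?case
      using h A_BC.pure_add_right[of x "BC.pt y z" "BC.pt y z'"]
      by (simp add: reassoc_pure BC.pure_add_right)
  next
    case (add s t)
    note D = module_homsD[OF reassoc_hom]
    have "reassoc (z \<oplus>\<^bsub>C\<^esub> z') (s \<oplus>\<^bsub>AB.T\<^esub> t) =
        (reassoc z s \<oplus>\<^bsub>A_BC.T\<^esub> reassoc z' s) \<oplus>\<^bsub>A_BC.T\<^esub> (reassoc z t \<oplus>\<^bsub>A_BC.T\<^esub> reassoc z' t)"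
      using add h D(2)[of "z \<oplus>\<^bsub>C\<^esub> z'" s t] by simp
    also have "\<dots> = (reassoc z s \<oplus>\<^bsub>A_BC.T\<^esub> reassoc z t) \<oplus>\<^bsub>A_BC.T\<^esub> (reassoc z' s \<oplus>\<^bsub>A_BC.T\<^esub> reassoc z' t)"
      using D(1)[OF h(2) add(1)] D(1)[OF h(2) add(2)] D(1)[OF h(3) add(1)] D(1)[OF h(3) add(2)]
      by (simp add: A_BC.T.a_ac del: tensor_module_tensor_algebra)
    finally show ?case
      using D(2)[OF h(2) add(1,2)] D(2)[OF h(3) add(1,2)] by simp
  qed
next
  fix r t z assume h: "r \<in> carrier R" "t \<in> carrier AB.TA" "z \<in> carrier C"
  then show "reassoc z (r \<odot>\<^bsub>AB.TA\<^esub> t) = r \<odot>\<^bsub>A_BC.T\<^esub> reassoc z t"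
    using module_homsD[OF reassoc_hom] by simp
  from h(2) have "t \<in> carrier AB.T" by simp
  then show "reassoc (r \<odot>\<^bsub>C\<^esub> z) t = r \<odot>\<^bsub>A_BC.T\<^esub> reassoc z t"
  proof (induction t rule: AB.tensor_induct)
    case (pure x y)
    then show ?case
      using h A_BC.pure_smult[of r x "BC.pt y z"] A_BC.smult_pure[of r x "BC.pt y z"]
      by (simp add: reassoc_pure BC.pure_smult[symmetric] BC.smult_pure)
  next
    case (add s t)
    then show ?case
      using h module_homsD[OF reassoc_hom] A_BC.T.smult_r_distr by simp
  qed
qed

lemma tensor_assoc_pure:
  "\<lbrakk>x \<in> carrier A; y \<in> carrier B; z \<in> carrier C\<rbrakk> \<Longrightarrow>
    tensor_assoc R A B C (AB_C.pt (AB.pt x y) z) = A_BC.pt x (BC.pt y z)"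
  using AB_C.lift_pure[OF A_BC.is_add_group_tensor balanced_assoc, of "AB.pt x y" z]
  by (simp add: tensor_assoc_def Let_def reassoc_pure[simplified])

lemma tensor_assoc_hom: "tensor_assoc R A B C \<in> algebra_homs R AB_C.TA A_BC.TA"
proof -
  have L: "tensor_lift (tensor_group R A BC.TA) (\<lambda>t z. reassoc z t) \<in> module_homs R AB_C.T A_BC.T"
    by (rule AB_C.lift_module_hom[OF A_BC.T_module A_BC.is_add_group_tensor balanced_assoc])
      (use module_homsD[OF reassoc_hom] in simp)
  then have H: "tensor_assoc R A B C \<in> module_homs R AB_C.T A_BC.T"
    by (simp add: tensor_assoc_def[abs_def] Let_def eta_contract_eq)
  note D = module_homsD[OF H]
  show ?thesis
  proof (rule AB_C.algebra_homsI_TA)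
    show "tensor_assoc R A B C \<in> module_homs R AB_C.T A_BC.TA"
      using H by (simp add: module_homs_def)
    fix s z s' z' assume h: "s \<in> carrier AB.TA" "z \<in> carrier C" "s' \<in> carrier AB.TA" "z' \<in> carrier C"
    let ?f = "tensor_assoc R A B C"
    have s: "s \<in> carrier AB.T" and s': "s' \<in> carrier AB.T" using h by simp_all
    show "?f (AB_C.pt (s \<otimes>\<^bsub>AB.TA\<^esub> s') (z \<otimes>\<^bsub>C\<^esub> z')) =
        ?f (AB_C.pt s z) \<otimes>\<^bsub>A_BC.TA\<^esub> ?f (AB_C.pt s' z')"
      using s
    proof (induction s rule: AB.tensor_induct)
      case s: (pure x y)
      show ?case
        using s'
      proof (induction s' rule: AB.tensor_induct)
        case (pure x' y')
        then show ?case
          using s h(2,4) A_BC.mult_pure[of x "BC.pt y z" x' "BC.pt y' z'"]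
          by (simp add: AB.mult_pure tensor_assoc_pure[simplified] BC.mult_pure)
      next
        case (add t t')
        then show ?case
          using s h(2,4) AB_C.pure_add_left D A_BC.r_distr_TA AB_C.pure_closed
          by (simp add: AB.r_distr_TA AB.mult_closed_TA)
      qed
    next
      case (add t t')
      then show ?case
        using s' h(2,4) AB_C.pure_add_left D A_BC.l_distr_TA AB_C.pure_closed
        by (simp add: AB.l_distr_TA AB.mult_closed_TA)
    qed
  qed (use A_BC.TA.associative_algebra_axioms tensor_assoc_pure in simp_all)
qed

end

section \<open>Quotients, opposites and free algebras\<close>

lemma (in associative_algebra) ideal_smult_closed:
  assumes "ideal I M" "r \<in> carrier R" "x \<in> I"
  shows "r \<odot>\<^bsub>M\<^esub> x \<in> I"
proof -
  have x: "x \<in> carrier M" by (rule ideal.Icarr[OF assms(1,3)])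
  have "r \<odot>\<^bsub>M\<^esub> x = (r \<odot>\<^bsub>M\<^esub> \<one>\<^bsub>M\<^esub>) \<otimes>\<^bsub>M\<^esub> x"
    using assms(2) x by (simp add: smult_mult_left)
  moreover have "(r \<odot>\<^bsub>M\<^esub> \<one>\<^bsub>M\<^esub>) \<otimes>\<^bsub>M\<^esub> x \<in> I"
    using ideal.I_l_closed[OF assms(1,3)] assms(2) by simp
  ultimately show ?thesis by (rule ssubst)
qed

locale algebra_ideal = associative_algebra R A + ideal I A
  for R :: "('r, 'c) ring_scheme" (structure) and A :: "('r, 'a, 'd) module_scheme" and I
begin

abbreviation "Q \<equiv> quotient_algebra A I"

abbreviation "\<pi> x \<equiv> I +>\<^bsub>A\<^esub> x"

lemma carrier_Q: "carrier Q = \<pi> ` carrier A"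
  by (auto simp: quotient_algebra_def FactRing_def A_RCOSETS_def')

lemma \<pi>_closed [simp]: "x \<in> carrier A \<Longrightarrow> \<pi> x \<in> carrier Q"
  by (simp add: carrier_Q)

lemma \<pi>_eq_iff: "\<lbrakk>x \<in> carrier A; y \<in> carrier A\<rbrakk> \<Longrightarrow> \<pi> x = \<pi> y \<longleftrightarrow> x \<ominus>\<^bsub>A\<^esub> y \<in> I"
  using quotient_eq_iff_same_a_r_cos[OF ideal_axioms, of x y] by blast

lemma mult_Q: "\<lbrakk>x \<in> carrier A; y \<in> carrier A\<rbrakk> \<Longrightarrow> \<pi> x \<otimes>\<^bsub>Q\<^esub> \<pi> y = \<pi> (x \<otimes>\<^bsub>A\<^esub> y)"
  by (simp add: quotient_algebra_def FactRing_def rcoset_mult_add)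

lemma add_Q: "\<lbrakk>x \<in> carrier A; y \<in> carrier A\<rbrakk> \<Longrightarrow> \<pi> x \<oplus>\<^bsub>Q\<^esub> \<pi> y = \<pi> (x \<oplus>\<^bsub>A\<^esub> y)"
  by (simp add: quotient_algebra_def FactRing_def a_rcos_sum)

lemma one_Q: "\<one>\<^bsub>Q\<^esub> = \<pi> \<one>\<^bsub>A\<^esub>"
  by (simp add: quotient_algebra_def FactRing_def)

lemma zero_Q: "\<zero>\<^bsub>Q\<^esub> = \<pi> \<zero>\<^bsub>A\<^esub>"
  using a_rcos_const[of "\<zero>\<^bsub>A\<^esub>"] additive_subgroup.zero_closed[OF additive_subgroup_axioms]
  by (simp add: quotient_algebra_def FactRing_def)

lemma smult_Q:
  assumes r: "r \<in> carrier R" and x: "x \<in> carrier A"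
  shows "r \<odot>\<^bsub>Q\<^esub> \<pi> x = \<pi> (r \<odot>\<^bsub>A\<^esub> x)"
proof -
  have "\<pi> (r \<odot>\<^bsub>A\<^esub> y) = \<pi> (r \<odot>\<^bsub>A\<^esub> x)" if y: "y \<in> \<pi> x" for y
  proof -
    have yA: "y \<in> carrier A" using y x a_r_coset_subset_G[OF a_subset] by blast
    have "\<pi> y = \<pi> x" using a_repr_independence[OF y x] a_subgroup by (metis)
    then have "y \<ominus>\<^bsub>A\<^esub> x \<in> I" using \<pi>_eq_iff x yA by simp
    then have "r \<odot>\<^bsub>A\<^esub> (y \<ominus>\<^bsub>A\<^esub> x) \<in> I" by (rule ideal_smult_closed[OF ideal_axioms r])
    then show ?thesis
      using r x yA by (simp add: \<pi>_eq_iff a_minus_def smult_r_distr smult_r_minus)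
  qed
  moreover have "x \<in> \<pi> x" using x by (rule a_rcos_self)
  ultimately have "(\<Union>y\<in>\<pi> x. \<pi> (r \<odot>\<^bsub>A\<^esub> y)) = \<pi> (r \<odot>\<^bsub>A\<^esub> x)" by blast
  moreover have "r \<odot>\<^bsub>Q\<^esub> \<pi> x = (\<Union>y\<in>\<pi> x. \<pi> (r \<odot>\<^bsub>A\<^esub> y))"
    unfolding quotient_algebra_def by simp
  ultimately show ?thesis by (rule trans[rotated])
qed

lemma Q_ring: "ring Q"
proof -
  interpret F: ring "A Quot I" by (rule quotient_is_ring)
  show ?thesis
  proof (rule ringI)
    show "abelian_group Q"
      by (rule abelian_groupI) (use F.add.l_inv_ex in \<open>auto simp: quotient_algebra_def F.a_ac\<close>)
    show "Group.monoid Q"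
      by (rule monoidI) (auto simp: quotient_algebra_def F.m_assoc)
  qed (auto simp: quotient_algebra_def F.l_distr F.r_distr)
qed

lemma Q_module: "module R Q"
proof (rule moduleI)
  show "abelian_group Q" using Q_ring ring.is_abelian_group by blast
  show "cring R" by (rule R.cring_axioms)
next
  fix r x assume r: "r \<in> carrier R" and "x \<in> carrier Q"
  then obtain f where f: "f \<in> carrier A" "x = \<pi> f" by (auto simp: carrier_Q)
  show "r \<odot>\<^bsub>Q\<^esub> x \<in> carrier Q"
    using r f by (simp add: smult_Q)
next
  fix r s x assume r: "r \<in> carrier R" and s: "s \<in> carrier R" and "x \<in> carrier Q"
  then obtain f where f: "f \<in> carrier A" "x = \<pi> f" by (auto simp: carrier_Q)
  show "(r \<oplus> s) \<odot>\<^bsub>Q\<^esub> x = r \<odot>\<^bsub>Q\<^esub> x \<oplus>\<^bsub>Q\<^esub> s \<odot>\<^bsub>Q\<^esub> x"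
    using r s f by (simp add: smult_Q add_Q smult_l_distr)
  show "(r \<otimes> s) \<odot>\<^bsub>Q\<^esub> x = r \<odot>\<^bsub>Q\<^esub> (s \<odot>\<^bsub>Q\<^esub> x)"
    using r s f by (simp add: smult_Q smult_assoc1)
next
  fix r x y assume r: "r \<in> carrier R" and "x \<in> carrier Q" "y \<in> carrier Q"
  then obtain f g where f: "f \<in> carrier A" "x = \<pi> f" and g: "g \<in> carrier A" "y = \<pi> g"
    by (auto simp: carrier_Q)
  show "r \<odot>\<^bsub>Q\<^esub> (x \<oplus>\<^bsub>Q\<^esub> y) = r \<odot>\<^bsub>Q\<^esub> x \<oplus>\<^bsub>Q\<^esub> r \<odot>\<^bsub>Q\<^esub> y"
    using r f g by (simp add: smult_Q add_Q smult_r_distr)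
next
  fix x assume "x \<in> carrier Q"
  then obtain f where f: "f \<in> carrier A" "x = \<pi> f" by (auto simp: carrier_Q)
  then show "\<one> \<odot>\<^bsub>Q\<^esub> x = x"
    by (simp add: smult_Q)
qed

sublocale Q: associative_algebra R Q
proof (rule associative_algebraI)
  fix r x y assume r: "r \<in> carrier R" and "x \<in> carrier Q" "y \<in> carrier Q"
  then obtain f g where f: "f \<in> carrier A" "x = \<pi> f" and g: "g \<in> carrier A" "y = \<pi> g"
    by (auto simp: carrier_Q)
  show "(r \<odot>\<^bsub>Q\<^esub> x) \<otimes>\<^bsub>Q\<^esub> y = r \<odot>\<^bsub>Q\<^esub> (x \<otimes>\<^bsub>Q\<^esub> y)"
    using r f g by (simp add: smult_Q mult_Q smult_mult_left)
  show "x \<otimes>\<^bsub>Q\<^esub> (r \<odot>\<^bsub>Q\<^esub> y) = r \<odot>\<^bsub>Q\<^esub> (x \<otimes>\<^bsub>Q\<^esub> y)"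
    using r f g by (simp add: smult_Q mult_Q smult_mult_right)
qed (rule Q_module Q_ring)+

lemma \<pi>_hom: "\<pi> \<in> algebra_homs R A Q"
  by (intro algebra_homsI module_homsI) (simp_all add: add_Q mult_Q smult_Q one_Q)

lemma minus_Q: "\<lbrakk>x \<in> carrier A; y \<in> carrier A\<rbrakk> \<Longrightarrow> \<pi> x \<ominus>\<^bsub>Q\<^esub> \<pi> y = \<pi> (x \<ominus>\<^bsub>A\<^esub> y)"
proof -
  assume xy: "x \<in> carrier A" "y \<in> carrier A"
  have "\<pi> (\<ominus>\<^bsub>A\<^esub> y) \<oplus>\<^bsub>Q\<^esub> \<pi> y = \<zero>\<^bsub>Q\<^esub>"
    using xy by (simp add: add_Q zero_Q M.l_neg)
  then have "\<ominus>\<^bsub>Q\<^esub> \<pi> y = \<pi> (\<ominus>\<^bsub>A\<^esub> y)"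
    using xy Q.minus_equality by simp
  then show ?thesis using xy by (simp add: a_minus_def add_Q)
qed

lemma factor_hom:
  assumes f: "f \<in> algebra_homs R A C" and C: "associative_algebra R C"
    and 0: "\<And>x. x \<in> I \<Longrightarrow> f x = \<zero>\<^bsub>C\<^esub>"
  obtains g where "g \<in> algebra_homs R Q C" "\<And>x. x \<in> carrier A \<Longrightarrow> g (\<pi> x) = f x"
proof
  interpret C: associative_algebra R C by fact
  define g where "g c = f (SOME x. x \<in> c)" for c
  show g: "g (\<pi> x) = f x" if x: "x \<in> carrier A" for x
  proof -
    define y where "y = (SOME y. y \<in> \<pi> x)"
    have y: "y \<in> \<pi> x" unfolding y_def by (rule someI, rule a_rcos_self[OF x])
    then obtain h where h: "h \<in> I" "y = h \<oplus>\<^bsub>A\<^esub> x" by (auto simp: a_r_coset_def r_coset_def)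
    then have "f y = f x"
      using algebra_homsD[OF f] x 0 Icarr by simp
    then show ?thesis by (simp add: g_def y_def)
  qed
  show "g \<in> algebra_homs R Q C"
    by (intro algebra_homsI module_homsI)
      (auto simp: carrier_Q g add_Q smult_Q mult_Q one_Q algebra_homsD[OF f])
qed

end

definition opposite_algebra :: "('r, 'a, 'd) module_scheme \<Rightarrow> ('r, 'a, 'd) module_scheme" where
  "opposite_algebra A = A\<lparr>monoid.mult := (\<lambda>x y. y \<otimes>\<^bsub>A\<^esub> x)\<rparr>"

lemma opposite_algebra_simps [simp]:
  "carrier (opposite_algebra A) = carrier A"
  "one (opposite_algebra A) = one A"
  "ring.zero (opposite_algebra A) = ring.zero A"
  "add (opposite_algebra A) = add A"
  "module.smult (opposite_algebra A) = module.smult A"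
  "x \<otimes>\<^bsub>opposite_algebra A\<^esub> y = y \<otimes>\<^bsub>A\<^esub> x"
  by (simp_all add: opposite_algebra_def)

lemma opposite_associative_algebra:
  assumes "associative_algebra R A" shows "associative_algebra R (opposite_algebra A)"
proof -
  interpret A: associative_algebra R A by fact
  have ag: "abelian_group (opposite_algebra A)"
    by (rule abelian_groupI) (use A.add.l_inv_ex in \<open>auto simp: A.a_ac\<close>)
  show ?thesis
  proof (rule associative_algebraI)
    show "module R (opposite_algebra A)"
      by (rule moduleI) (simp_all add: ag A.R.cring_axioms A.smult_l_distr A.smult_r_distr A.smult_assoc1)
    show "ring (opposite_algebra A)"
    proof (rule ringI)
      show "Group.monoid (opposite_algebra A)"
        by (rule monoidI) (simp_all add: A.m_assoc)
    qed (simp_all add: ag A.l_distr A.r_distr)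
  qed (simp_all add: A.smult_mult_left A.smult_mult_right)
qed

lemma ring_of_type_simps [simp]:
  "carrier (ring_of_type_algebra :: 'k::comm_ring_1 ring) = UNIV"
  "x \<otimes>\<^bsub>ring_of_type_algebra :: 'k ring\<^esub> y = x * y"
  "\<one>\<^bsub>ring_of_type_algebra :: 'k ring\<^esub> = 1"
  "\<zero>\<^bsub>ring_of_type_algebra :: 'k ring\<^esub> = 0"
  "x \<oplus>\<^bsub>ring_of_type_algebra :: 'k ring\<^esub> y = x + y"
  by (simp_all add: ring_of_type_algebra_def)

lemma algebra_of_type_simps [simp]:
  "carrier (algebra_of_type s) = UNIV"
  "x \<otimes>\<^bsub>algebra_of_type s\<^esub> y = x * y"
  "\<one>\<^bsub>algebra_of_type s\<^esub> = 1"
  "\<zero>\<^bsub>algebra_of_type s\<^esub> = 0"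
  "x \<oplus>\<^bsub>algebra_of_type s\<^esub> y = x + y"
  "c \<odot>\<^bsub>algebra_of_type s\<^esub> x = s c x"
  by (simp_all add: algebra_of_type_def)

lemma associative_algebra_of_type:
  fixes s :: "'k::comm_ring_1 \<Rightarrow> 'a::ring_1 \<Rightarrow> 'a"
  assumes "\<And>c x y. s c (x + y) = s c x + s c y" "\<And>c d x. s (c + d) x = s c x + s d x"
    "\<And>c d x. s (c * d) x = s c (s d x)" "\<And>x. s 1 x = x"
    "\<And>c x y. s c x * y = s c (x * y)" "\<And>c x y. x * s c y = s c (x * y)"
  shows "associative_algebra ring_of_type_algebra (algebra_of_type s)"
proof -
  have ag: "abelian_group (algebra_of_type s)"
    by (rule abelian_groupI) (auto simp: algebra_simps intro: exI[of _ "- _"])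
  show ?thesis
  proof (rule associative_algebraI)
    show "module ring_of_type_algebra (algebra_of_type s)"
      by (rule moduleI) (simp_all add: ag assms cring_from_type_algebra)
    show "ring (algebra_of_type s)"
    proof (rule ringI)
      show "Group.monoid (algebra_of_type s)"
        by (rule monoidI) (simp_all add: algebra_simps)
    qed (simp_all add: ag algebra_simps)
  qed (simp_all add: assms)
qed

lemma minus_algebra_of_type:
  assumes "associative_algebra R (algebra_of_type s)"
  shows "x \<ominus>\<^bsub>algebra_of_type s\<^esub> y = x - y"
proof -
  interpret associative_algebra R "algebra_of_type s" by fact
  have "\<ominus>\<^bsub>algebra_of_type s\<^esub> y = - y" by (rule minus_equality) simp_all
  then show ?thesis by (simp add: a_minus_def)
qed

lemma sum_singles: "(\<Sum>w\<in>Poly_Mapping.keys f. Poly_Mapping.single w (Poly_Mapping.lookup f w)) = f"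
  by (rule poly_mapping_eqI)
    (auto simp: lookup_sum lookup_single when_def in_keys_iff sum.delta)

lemma poly_mapping_sum_induct [case_names single add]:
  assumes single: "\<And>w c. P (Poly_Mapping.single w c)" and add: "\<And>f g. P f \<Longrightarrow> P g \<Longrightarrow> P (f + g)"
  shows "P (f :: 'a \<Rightarrow>\<^sub>0 'b::comm_monoid_add)"
proof -
  have "P (\<Sum>w\<in>W. Poly_Mapping.single w (Poly_Mapping.lookup f w))" if "finite W" for W
    using that
  proof (induction W rule: finite_induct)
    case empty
    then show ?case using single[of _ 0] by simp
  qed (simp add: single add)
  from this[of "Poly_Mapping.keys f"] show ?thesis by (simp add: sum_singles)
qed

lemma fconst_0 [simp]: "fconst 0 = 0" and fconst_1 [simp]: "fconst 1 = 1"
  by (simp_all add: fconst_def)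

lemma fconst_add: "fconst (c + d) = fconst c + fconst d"
  by (simp add: fconst_def single_add)

lemma fconst_mult: "fconst (c * d) = fconst c * fconst d"
  by (simp add: fconst_def mult_single)

lemma fconst_numeral: "fconst (numeral n) = numeral n"
  by (simp add: fconst_def)

lemma fconst_commute: "f * fconst c = fconst (c :: 'k::comm_ring_1) * f"
  by (induction f rule: poly_mapping_sum_induct)
    (simp_all add: fconst_def mult_single algebra_simps)

lemma free_algebra_associative: "associative_algebra ring_of_type_algebra (free_algebra :: ('k::comm_ring_1, ('g, 'k) free_alg) module)"
  unfolding free_algebra_def
proof (rule associative_algebra_of_type)
  fix c and f h :: "('g, 'k) free_alg"
  show "f * (fconst c * h) = fconst c * (f * h)"
    using fconst_commute[of f c] by (metis mult.assoc)
qed (simp_all add: algebra_simps fconst_add fconst_mult)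

lemma free_algebra_simps [simp]:
  "carrier free_algebra = UNIV"
  "x \<otimes>\<^bsub>free_algebra\<^esub> y = x * y"
  "\<one>\<^bsub>free_algebra\<^esub> = 1"
  "\<zero>\<^bsub>free_algebra\<^esub> = 0"
  "x \<oplus>\<^bsub>free_algebra\<^esub> y = x + y"
  "c \<odot>\<^bsub>free_algebra\<^esub> x = fconst c * x"
  by (simp_all add: free_algebra_def)

lemma free_algebra_minus [simp]: "x \<ominus>\<^bsub>free_algebra :: ('k::comm_ring_1, ('g, 'k) free_alg) module\<^esub> y = x - y"
  using minus_algebra_of_type free_algebra_associative unfolding free_algebra_def by blast

lemma single_Word:
  fixes c :: "'k::ring_1"
  shows "Poly_Mapping.single (Word gs) c = fconst c * prod_list (map fvar gs)"
proof -
  have "Poly_Mapping.single (Word gs) (1 :: 'k::ring_1) = prod_list (map fvar gs)"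
  proof (induction gs)
    case Nil
    then show ?case by (simp add: zero_free_monoid_def[symmetric] flip: single_one)
  next
    case (Cons g gs)
    have "Poly_Mapping.single (Word (g # gs)) (1 :: 'k) = fvar g * Poly_Mapping.single (Word gs) 1"
      by (simp add: fvar_def mult_single)
    then show ?case using Cons by simp
  qed
  then have "fconst c * prod_list (map fvar gs) = fconst c * Poly_Mapping.single (Word gs) 1" by simp
  then show ?thesis by (simp add: fconst_def mult_single)
qed

lemma free_alg_induct [case_names const var add mult]:
  fixes f :: "('g, 'k::ring_1) free_alg"
  assumes const: "\<And>c. P (fconst c)" and var: "\<And>g. P (fvar g)"
    and add: "\<And>f h. P f \<Longrightarrow> P h \<Longrightarrow> P (f + h)" and mult: "\<And>f h. P f \<Longrightarrow> P h \<Longrightarrow> P (f * h)"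
  shows "P f"
proof (induction f rule: poly_mapping_sum_induct)
  case (single w c)
  obtain gs where w: "w = Word gs" by (cases w)
  have "P (prod_list (map fvar gs))"
    by (induction gs) (use const[of 1] var mult in simp_all)
  then show ?case using w const mult by (simp add: single_Word)
qed (rule add)

definition alg_eval :: "('k, 'm, 'd) module_scheme \<Rightarrow> ('w \<Rightarrow> 'm) \<Rightarrow> ('w \<Rightarrow>\<^sub>0 'k::zero) \<Rightarrow> 'm" where
  "alg_eval M h f = (\<Oplus>\<^bsub>M\<^esub>w\<in>Poly_Mapping.keys f. Poly_Mapping.lookup f w \<odot>\<^bsub>M\<^esub> h w)"

locale k_algebra = associative_algebra "ring_of_type_algebra :: 'k ring" M
  for M :: "('k::comm_ring_1, 'm, 'd) module_scheme"
begin

lemma zero_smult [simp]: "x \<in> carrier M \<Longrightarrow> 0 \<odot>\<^bsub>M\<^esub> x = \<zero>\<^bsub>M\<^esub>"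
  using smult_l_null by simp

lemma one_smult [simp]: "x \<in> carrier M \<Longrightarrow> 1 \<odot>\<^bsub>M\<^esub> x = x"
  using smult_one by simp

end

locale k_monoid_hom = k_algebra M
  for M :: "('k::comm_ring_1, 'm, 'd) module_scheme" +
  fixes h :: "'w::monoid_add \<Rightarrow> 'm"
  assumes h_closed [simp]: "h w \<in> carrier M"
    and h_zero: "h 0 = \<one>\<^bsub>M\<^esub>"
    and h_add: "h (w + w') = h w \<otimes>\<^bsub>M\<^esub> h w'"
begin

lemma alg_eval_superset:
  assumes "Poly_Mapping.keys f \<subseteq> W" "finite W"
  shows "alg_eval M h f = (\<Oplus>\<^bsub>M\<^esub>w\<in>W. Poly_Mapping.lookup f w \<odot>\<^bsub>M\<^esub> h w)"
  unfolding alg_eval_def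
  using assms by (intro M.add.finprod_mono_neutral_cong_left) (auto simp: in_keys_iff)

lemma alg_eval_closed [simp]: "alg_eval M h f \<in> carrier M"
  unfolding alg_eval_def by (intro finsum_closed) auto

lemma alg_eval_add: "alg_eval M h (f + g) = alg_eval M h f \<oplus>\<^bsub>M\<^esub> alg_eval M h g"
proof -
  define W where "W = Poly_Mapping.keys f \<union> Poly_Mapping.keys g"
  have W: "finite W" "Poly_Mapping.keys f \<subseteq> W" "Poly_Mapping.keys g \<subseteq> W" "Poly_Mapping.keys (f + g) \<subseteq> W"
    using keys_add[of f g] by (auto simp: W_def)
  have "(\<Oplus>\<^bsub>M\<^esub>w\<in>W. Poly_Mapping.lookup (f + g) w \<odot>\<^bsub>M\<^esub> h w) =
      (\<Oplus>\<^bsub>M\<^esub>w\<in>W. Poly_Mapping.lookup f w \<odot>\<^bsub>M\<^esub> h w \<oplus>\<^bsub>M\<^esub> Poly_Mapping.lookup g w \<odot>\<^bsub>M\<^esub> h w)"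
    using smult_l_distr by (intro finsum_cong') (auto simp: lookup_add)
  then show ?thesis
    using W by (simp add: alg_eval_superset finsum_addf)
qed

lemma alg_eval_single: "alg_eval M h (Poly_Mapping.single w c) = c \<odot>\<^bsub>M\<^esub> h w"
  by (cases "c = 0") (simp_all add: alg_eval_def finsum_insert)

lemma alg_eval_mult: "alg_eval M h (f * g) = alg_eval M h f \<otimes>\<^bsub>M\<^esub> alg_eval M h g"
proof (induction f rule: poly_mapping_sum_induct)
  case f: (single w c)
  show ?case
  proof (induction g rule: poly_mapping_sum_induct)
    case (single w' c')
    show ?case
      using smult_mult_left[of c "h w" "c' \<odot>\<^bsub>M\<^esub> h w'"]
        smult_mult_right[of c' "h w" "h w'"]
        smult_assoc1[of c c' "h w \<otimes>\<^bsub>M\<^esub> h w'"]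
      by (simp add: mult_single alg_eval_single h_add)
  qed (simp add: algebra_simps alg_eval_add r_distr)
qed (simp add: algebra_simps alg_eval_add l_distr)

lemma alg_eval_const: "alg_eval M h (Poly_Mapping.single 0 c) = c \<odot>\<^bsub>M\<^esub> \<one>\<^bsub>M\<^esub>"
  by (simp add: alg_eval_single h_zero)

lemma alg_eval_one: "alg_eval M h 1 = \<one>\<^bsub>M\<^esub>"
  using alg_eval_const[of 1] by simp

lemma alg_eval_zero: "alg_eval M h 0 = \<zero>\<^bsub>M\<^esub>"
  by (simp add: alg_eval_def)

end

fun word_eval :: "('r, 'm, 'd) module_scheme \<Rightarrow> ('g \<Rightarrow> 'm) \<Rightarrow> 'g free_monoid \<Rightarrow> 'm" where
  "word_eval M v (Word gs) = foldr (\<lambda>g m. v g \<otimes>\<^bsub>M\<^esub> m) gs \<one>\<^bsub>M\<^esub>"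

abbreviation free_eval :: "('k, 'm, 'd) module_scheme \<Rightarrow> ('g \<Rightarrow> 'm) \<Rightarrow> ('g, 'k::ring_1) free_alg \<Rightarrow> 'm" where
  "free_eval M v \<equiv> alg_eval M (word_eval M v)"

context k_algebra
begin

lemma word_eval_closed [simp]:
  assumes v: "\<And>g. v g \<in> carrier M"
  shows "word_eval M v w \<in> carrier M"
proof (cases w)
  case (Word gs)
  have "foldr (\<lambda>g m. v g \<otimes>\<^bsub>M\<^esub> m) gs \<one>\<^bsub>M\<^esub> \<in> carrier M" by (induction gs) (simp_all add: v)
  then show ?thesis using Word by simp
qed

lemma word_eval_add:
  assumes v: "\<And>g. v g \<in> carrier M"
  shows "word_eval M v (w + w') = word_eval M v w \<otimes>\<^bsub>M\<^esub> word_eval M v w'"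
proof (cases w; cases w')
  fix gs hs assume w: "w = Word gs" "w' = Word hs"
  have c: "foldr (\<lambda>g m. v g \<otimes>\<^bsub>M\<^esub> m) gs \<one>\<^bsub>M\<^esub> \<in> carrier M" for gs
    using word_eval_closed[OF v, where w = "Word gs"] by simp
  have "foldr (\<lambda>g m. v g \<otimes>\<^bsub>M\<^esub> m) (gs @ hs) \<one>\<^bsub>M\<^esub> =
      foldr (\<lambda>g m. v g \<otimes>\<^bsub>M\<^esub> m) gs \<one>\<^bsub>M\<^esub> \<otimes>\<^bsub>M\<^esub> foldr (\<lambda>g m. v g \<otimes>\<^bsub>M\<^esub> m) hs \<one>\<^bsub>M\<^esub>"
  proof (induction gs)
    case (Cons g gs)
    then show ?case using c[of gs] c[of hs] v by (simp add: m_assoc)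
  qed (use c[of hs] in simp)
  then show ?thesis using w by simp
qed

lemma free_eval_var:
  assumes "\<And>g. v g \<in> carrier M"
  shows "free_eval M v (fvar g) = v g"
proof -
  interpret k_monoid_hom M "word_eval M v"
    by unfold_locales (simp_all add: assms word_eval_add zero_free_monoid_def)
  show ?thesis using assms by (simp add: fvar_def alg_eval_single)
qed

lemma free_eval_hom:
  assumes "\<And>g. v g \<in> carrier M"
  shows "free_eval M v \<in> algebra_homs ring_of_type_algebra free_algebra M"
proof -
  interpret k_monoid_hom M "word_eval M v"
    by unfold_locales (simp_all add: assms word_eval_add zero_free_monoid_def)
  show ?thesis
  proof (intro algebra_homsI module_homsI)
    fix c f
    show "free_eval M v (c \<odot>\<^bsub>free_algebra\<^esub> f) = c \<odot>\<^bsub>M\<^esub> free_eval M v f"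
      using smult_mult_left[of c "\<one>\<^bsub>M\<^esub>" "free_eval M v f"] alg_eval_const
      by (simp add: alg_eval_mult fconst_def)
  qed (simp_all add: alg_eval_add alg_eval_mult alg_eval_one)
qed

end

lemma free_algebra_hom_unique:
  fixes r :: "('g, 'k::comm_ring_1) free_alg"
  assumes f: "f \<in> algebra_homs ring_of_type_algebra free_algebra M"
    and g: "g \<in> algebra_homs ring_of_type_algebra free_algebra M"
    and "\<And>z. f (fvar z) = g (fvar z)"
  shows "f r = g r"
proof (induction r rule: free_alg_induct)
  case (const c)
  show ?case using algebra_homsD(5)[OF f, of c 1] algebra_homsD(5)[OF g, of c 1]
      algebra_homsD(6)[OF f] algebra_homsD(6)[OF g] by simp
qed (use algebra_homsD[OF f] algebra_homsD[OF g] assms(3) in simp_all)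

section \<open>Calculations\<close>

locale two_sided_ideal =
  fixes K :: "'r::ring_1 set"
  assumes zero: "0 \<in> K" and add: "\<lbrakk>f \<in> K; g \<in> K\<rbrakk> \<Longrightarrow> f + g \<in> K"
    and left: "g \<in> K \<Longrightarrow> f * g \<in> K" and right: "f \<in> K \<Longrightarrow> f * g \<in> K"
begin

lemma minus: "f \<in> K \<Longrightarrow> - f \<in> K"
  using left[of f "- 1"] by simp

lemma diff: "\<lbrakk>f \<in> K; g \<in> K\<rbrakk> \<Longrightarrow> f - g \<in> K"
  using add[of f "- g"] minus[of g] by simp

lemmas closure = add diff minus left right

end

lemma unroll_numerals:
  fixes f :: "'r::ring_1"
  shows "2 * f = f + f" "3 * f = f + f + f" "6 * f = 3 * f + 3 * f"
    "9 * f = 3 * f + 3 * f + 3 * f" "27 * f = 9 * f + 9 * f + 9 * f"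
proof -
  have "(3::'r) = 1 + 1 + 1" "(6::'r) = 3 + 3" "(9::'r) = 3 + 3 + 3" "(27::'r) = 9 + 9 + 9" by simp_all
  then show "2 * f = f + f" "3 * f = f + f + f" "6 * f = 3 * f + 3 * f"
    "9 * f = 3 * f + 3 * f + 3 * f" "27 * f = 9 * f + 9 * f + 9 * f"
    by (simp_all only: distrib_right mult_1_left mult_2)
qed

locale shift =
  fixes C P :: "'r::ring_1" and x y a b u z
  assumes C: "\<And>f. f * C = C * f" and P: "\<And>f. f * P = P * f"
  defines "u \<equiv> 3 * x + 1 - C * a" and "z \<equiv> y - P * b"
begin

lemma C': "f * (C * g) = C * (f * g)"
  by (metis C mult.assoc)

lemma P': "f * (P * g) = P * (f * g)"
  by (metis P mult.assoc)

lemma shift_linear: "a * a * u + a * u * a + u * a * a =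
    3 * (a * a * x + a * x * a + x * a * a + a * a - C * (a * a * a))"
  unfolding u_def by (simp add: algebra_simps C C'[of a] unroll_numerals)

lemma shift_quadratic_aux: "a * u * u + u * a * u + u * u * a =
    9 * (a * x * x + x * a * x + x * x * a + a * x + x * a)
     - 6 * (C * (a * a * x + a * x * a + x * a * a + a * a)) + 3 * a + 3 * (C * (C * (a * a * a)))"
  unfolding u_def by (simp add: algebra_simps C[of a] C[of x] C'[of a] C'[of x] unroll_numerals)

lemma shift_quadratic:
  assumes E: "3 * E = C * C - 1"
  shows "a * u * u + u * a * u + u * u * a - 3 * (a - a * a * a) =
    9 * (a * x * x + x * a * x + x * x * a + a * x + x * a - E * (a * a * a))
     - 6 * (C * (a * a * x + a * x * a + x * a * a + a * a - C * (a * a * a)))"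
proof -
  have "9 * (E * w) = 3 * ((3 * E) * w)" for w by (simp add: algebra_simps)
  then have "9 * (E * w) = 3 * (C * (C * w)) - 3 * w" for w by (simp add: E algebra_simps)
  moreover have "6 * (C * (C * w)) = 3 * (C * (C * w)) + 3 * (C * (C * w))" for w
    by (rule unroll_numerals)
  ultimately show ?thesis
    unfolding shift_quadratic_aux right_diff_distrib by (simp add: algebra_simps)
qed

lemma shift_cubic:
  assumes PC: "27 * (P * P) = C * C * C - 3 * C + 2"
  shows "27 * (z * z) - (u * u * u - 3 * u + 2 - 2 * (a * a * a)) =
    27 * (y * y - (x * x + x * x * x)) - 27 * (P * (b * y + y * b - 2 * (P * (b * b))))
    - 27 * (P * (P * (b * b - a * a * a)))
    + C * (a * u * u + u * a * u + u * u * a - 3 * (a - a * a * a))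
    + C * (C * (a * a * u + a * u * a + u * a * a))"
proof -
  define t where "t = 3 * x + 1"
  have ut: "u + C * a = t" by (simp add: u_def t_def)
  have e1: "27 * (z * z) = 27 * (y * y) - 27 * (P * (b * y + y * b)) + 27 * (P * (P * (b * b)))"
    unfolding z_def by (simp add: algebra_simps P[of y] P[of b] P'[of y] P'[of b])
  have e2: "27 * (x * x + x * x * x) = t * t * t - 3 * t + 2"
    unfolding t_def by (simp add: algebra_simps unroll_numerals)
  have "(u + C * a) * (u + C * a) * (u + C * a) = u * u * u + C * (a * u * u + u * a * u + u * u * a)
      + C * (C * (a * a * u + a * u * a + u * a * a)) + C * (C * (C * (a * a * a)))"
    by (simp add: algebra_simps C[of a] C'[of a] C[of u] C'[of u])
  then have e3: "t * t * t = u * u * u + C * (a * u * u + u * a * u + u * u * a)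
      + C * (C * (a * a * u + a * u * a + u * a * a)) + C * (C * (C * (a * a * a)))"
    by (simp only: ut)
  have "27 * (P * (P * w)) = (27 * (P * P)) * w" for w by (simp add: mult.assoc)
  then have e4: "27 * (P * (P * w)) = C * (C * (C * w)) - 3 * (C * w) + 2 * w" for w
    by (simp add: PC algebra_simps)
  have e5: "3 * u = 3 * t - 3 * (C * a)" by (simp add: ut[symmetric] algebra_simps)
  have e6: "C * (w - 3 * v) = C * w - 3 * (C * v)" for v w
    by (simp add: algebra_simps C[of 3, symmetric] flip: mult.assoc)
  have e7: "P * (w - 2 * (P * v)) = P * w - 2 * (P * (P * v))" for v w
    by (simp add: algebra_simps P[of 2, symmetric] flip: mult.assoc)
  have e8: "27 * (w - 2 * v) = 27 * w - (27 * v + 27 * v)" for v w :: 'r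
    by (simp add: algebra_simps mult_2)
  show ?thesis
    unfolding right_diff_distrib[of 27 "y * y"] e1 e2 e3 e5 e6 e7 e8
      right_diff_distrib[of P "b * b"] right_diff_distrib[of P "P * (b * b)"]
      right_diff_distrib[of 27 "P * (P * (b * b))"] e4
    by (simp add: algebra_simps)
qed

lemma shift_commutators:
  "b * z + z * b = b * y + y * b - 2 * (P * (b * b))"
  "z * u - u * z = 3 * (y * x - x * y) - C * (y * a - a * y) - 3 * (P * (b * x - x * b)) + P * (C * (b * a - a * b))"
  "z * a - a * z = (y * a - a * y) - P * (b * a - a * b)"
  "b * u - u * b = 3 * (b * x - x * b) - C * (b * a - a * b)"
  unfolding u_def z_def
  by (simp_all add: algebra_simps unroll_numerals C[of a] C[of b] C[of x] C[of y] C[of P] C'[of a] C'[of b] C'[of x] C'[of y] C'[of P]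
      P[of a] P[of b] P[of x] P[of y] P'[of a] P'[of b] P'[of x] P'[of y])

end

text \<open>The relations in the shifted generators.\<close>

definition shifted_set :: "'r \<Rightarrow> 'r \<Rightarrow> 'r \<Rightarrow> 'r \<Rightarrow> 'r \<Rightarrow> 'r::ring_1 set" where
  "shifted_set u z a a' b =
    {a * a' - 1, a' * a - 1, b * b - a * a * a, b * a - a * b, z * a - a * z, b * u - u * b,
     z * u - u * z, b * z + z * b,
     a * a * u + a * u * a + u * a * a,
     a * u * u + u * a * u + u * u * a - 3 * (a - a * a * a),
     27 * (z * z) - (u * u * u - 3 * u + 2 - 2 * (a * a * a))}"

lemma shifted_setD:
  assumes "shifted_set u z a a' b \<subseteq> K"
  shows "a * a' - 1 \<in> K"
    and "a' * a - 1 \<in> K"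
    and "b * b - a * a * a \<in> K"
    and "b * a - a * b \<in> K"
    and "z * a - a * z \<in> K"
    and "b * u - u * b \<in> K"
    and "z * u - u * z \<in> K"
    and "b * z + z * b \<in> K"
    and "a * a * u + a * u * a + u * a * a \<in> K"
    and "a * u * u + u * a * u + u * u * a - 3 * (a - a * a * a) \<in> K"
    and "27 * (z * z) - (u * u * u - 3 * u + 2 - 2 * (a * a * a)) \<in> K"
  using assms by (auto simp: shifted_set_def)

lemma numeral_commute: "(f :: 'r::ring_1) * numeral n = numeral n * f"
  by (metis of_nat_numeral mult_of_nat_commute)

lemma numeral_left_commute: "(f :: 'r::ring_1) * (numeral n * g) = numeral n * (f * g)"
  by (metis mult.assoc numeral_commute)

lemma commute_left:
  fixes f g h :: "'r::ring_1"
  shows "g * f = f * g \<Longrightarrow> g * (f * h) = f * (g * h)"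
  by (simp only: mult.assoc[symmetric])

lemma (in two_sided_ideal) shifted_set_tensor:
  assumes L: "shifted_set uL zL aL a'L bL \<subseteq> K" and R: "shifted_set uR zR aR a'R bR \<subseteq> K"
    and LR: "\<And>f g. \<lbrakk>f \<in> {uL, zL, aL, a'L, bL}; g \<in> {uR, zR, aR, a'R, bR}\<rbrakk> \<Longrightarrow> g * f = f * g"
  shows "shifted_set (uR + uL * aR) (zR + zL * bR) (aL * aR) (a'L * a'R) (bL * bR) \<subseteq> K"
proof -
  note c = LR[of uL uR] LR[of uL zR] LR[of uL aR] LR[of uL a'R] LR[of uL bR]
    LR[of zL uR] LR[of zL zR] LR[of zL aR] LR[of zL a'R] LR[of zL bR]
    LR[of aL uR] LR[of aL zR] LR[of aL aR] LR[of aL a'R] LR[of aL bR]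
    LR[of a'L uR] LR[of a'L zR] LR[of a'L aR] LR[of a'L a'R] LR[of a'L bR]
    LR[of bL uR] LR[of bL zR] LR[of bL aR] LR[of bL a'R] LR[of bL bR]
  note c = c[simplified]
  note simps = c c[THEN commute_left] numeral_left_commute[of uL] numeral_left_commute[of uR]
    numeral_left_commute[of zL] numeral_left_commute[of zR]
    numeral_left_commute[of aL] numeral_left_commute[of aR]
  note l = shifted_setD[OF L] and r = shifted_setD[OF R]
  let ?u = "uR + uL * aR" and ?z = "zR + zL * bR" and ?a = "aL * aR" and ?a' = "a'L * a'R" and ?b = "bL * bR"
  let ?U = "\<lambda>a u. a * a * u + a * u * a + u * a * a"
  let ?V = "\<lambda>a u. a * u * u + u * a * u + u * u * a - 3 * (a - a * a * a)"
  let ?Z = "\<lambda>a u z. 27 * (z * z) - (u * u * u - 3 * u + 2 - 2 * (a * a * a))"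
  have e1: "?a * ?a' - 1 = (aL * a'L - 1) * (aR * a'R) + (aR * a'R - 1)"
    by (simp add: algebra_simps simps)
  have m1: "?a * ?a' - 1 \<in> K"
    unfolding e1 by (rule add[OF right[OF l(1)] r(1)])
  have e2: "?a' * ?a - 1 = (a'L * aL - 1) * (a'R * aR) + (a'R * aR - 1)"
    by (simp add: algebra_simps simps)
  have m2: "?a' * ?a - 1 \<in> K"
    unfolding e2 by (rule add[OF right[OF l(2)] r(2)])
  have e3: "?b * ?b - ?a * ?a * ?a =
      (bL * bL - aL * aL * aL) * (bR * bR) + aL * aL * aL * (bR * bR - aR * aR * aR)"
    by (simp add: algebra_simps simps)
  have m3: "?b * ?b - ?a * ?a * ?a \<in> K"
    unfolding e3 by (rule add[OF right[OF l(3)] left[OF r(3)]])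
  have e4: "?b * ?a - ?a * ?b = (bL * aL - aL * bL) * (bR * aR) + aL * bL * (bR * aR - aR * bR)"
    by (simp add: algebra_simps simps)
  have m4: "?b * ?a - ?a * ?b \<in> K"
    unfolding e4 by (rule add[OF right[OF l(4)] left[OF r(4)]])
  have e5: "?z * ?a - ?a * ?z = aL * (zR * aR - aR * zR) + (zL * aL - aL * zL) * (bR * aR)
      + aL * zL * (bR * aR - aR * bR)"
    by (simp add: algebra_simps simps)
  have m5: "?z * ?a - ?a * ?z \<in> K"
    unfolding e5 by (rule add[OF add[OF left[OF r(5)] right[OF l(5)]] left[OF r(4)]])
  have e6: "?b * ?u - ?u * ?b = bL * (bR * uR - uR * bR) + (bL * uL - uL * bL) * (bR * aR)
      + uL * bL * (bR * aR - aR * bR)"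
    by (simp add: algebra_simps simps)
  have m6: "?b * ?u - ?u * ?b \<in> K"
    unfolding e6 by (rule add[OF add[OF left[OF r(6)] right[OF l(6)]] left[OF r(4)]])
  have e7: "?z * ?u - ?u * ?z = (zR * uR - uR * zR) + uL * (zR * aR - aR * zR)
      + zL * (bR * uR - uR * bR) + (zL * uL - uL * zL) * (bR * aR) + uL * zL * (bR * aR - aR * bR)"
    by (simp add: algebra_simps simps)
  have m7: "?z * ?u - ?u * ?z \<in> K"
    unfolding e7 by (rule add[OF add[OF add[OF add[OF r(7) left[OF r(5)]] left[OF r(6)]] right[OF l(7)]] left[OF r(4)]])
  have e8: "?b * ?z + ?z * ?b = bL * (bR * zR + zR * bR) + (bL * zL + zL * bL) * (bR * bR)"
    by (simp add: algebra_simps simps)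
  have m8: "?b * ?z + ?z * ?b \<in> K"
    unfolding e8 by (rule add[OF left[OF r(8)] right[OF l(8)]])
  have e9: "?U ?a ?u = aL * aL * ?U aR uR + ?U aL uL * (aR * aR * aR)"
    by (simp add: algebra_simps simps)
  have m9: "?U ?a ?u \<in> K"
    unfolding e9 by (rule add[OF left[OF r(9)] right[OF l(9)]])
  have e10: "?V ?a ?u = aL * ?V aR uR + ?V aL uL * (aR * aR * aR) + (aL * uL + uL * aL) * ?U aR uR"
    by (simp add: algebra_simps simps)
  have m10: "?V ?a ?u \<in> K"
    unfolding e10 by (rule add[OF add[OF left[OF r(10)] right[OF l(10)]] left[OF r(9)]])
  have e11: "?Z ?a ?u ?z = ?Z aR uR zR + ?Z aL uL zL * (aR * aR * aR) + 27 * (zL * (bR * zR + zR * bR))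
      + 27 * (zL * zL * (bR * bR - aR * aR * aR)) - uL * ?V aR uR - uL * uL * ?U aR uR"
    by (simp add: algebra_simps simps)
  have m11: "?Z ?a ?u ?z \<in> K"
    unfolding e11 by (rule diff[OF diff[OF add[OF add[OF add[OF r(11) right[OF l(11)]] left[OF left[OF r(8)]]] left[OF left[OF r(3)]]] left[OF r(10)]] left[OF r(9)]])
  show ?thesis
    unfolding shifted_set_def using m1 m2 m3 m4 m5 m6 m7 m8 m9 m10 m11 by simp
qed

text \<open>The relations in the shifted generators, in an arbitrary ring.\<close>

locale shifted_algebra =
  fixes u z a a' b :: "'r::ring_1"
  assumes relations: "shifted_set u z a a' b \<subseteq> {0}"
begin

lemma rels: "a * a' = 1" "a' * a = 1" "b * b = a * a * a" "b * a = a * b" "z * a = a * z" "b * u = u * b"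
    "z * u = u * z" "b * z = - (z * b)" "a * a * u + a * u * a + u * a * a = 0"
    "a * u * u + u * a * u + u * u * a = 3 * (a - a * a * a)"
    "27 * (z * z) = u * u * u - 3 * u + 2 - 2 * (a * a * a)"
  using shifted_setD[OF relations] by (auto simp: eq_neg_iff_add_eq_0)

lemma cancel [simp]: "a * a' = 1" "a' * a = 1" "a * (a' * f) = f" "a' * (a * f) = f"
  using rels(1,2) by (simp_all add: mult.assoc[symmetric])

lemma inverse_commute:
  assumes "f * a = a * f" shows "f * a' = a' * f"
proof -
  have "a' * (f * a) * a' = a' * (a * f) * a'" by (simp only: assms)
  then show ?thesis by (simp add: mult.assoc)
qed

definition u1 where "u1 = a * u * a'"

definition u2 where "u2 = a * a * u * a' * a'"

lemma conj_sum: "u + u1 + u2 = 0"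
proof -
  have "(a * a * u + a * u * a + u * a * a) * a' * a' = u2 + u1 + u"
    by (simp add: u1_def u2_def algebra_simps)
  then show ?thesis unfolding rels(9) by (simp add: algebra_simps)
qed

lemma u2_eq: "u2 = - u - u1"
  using conj_sum by (simp add: algebra_simps eq_neg_iff_add_eq_0)

lemma cube_commute: "a * a * a * u = u * a * a * a"
proof -
  have "a * (a * a * u + a * u * a + u * a * a) = (a * a * u + a * u * a + u * a * a) * a"
    by (simp only: rels(9)) simp
  then show ?thesis by (simp add: algebra_simps)
qed

lemma move: "u * a' = a' * u1" "u1 * a' = a' * u2" "u2 * a' = a' * u"
proof -
  show "u * a' = a' * u1" by (simp add: u1_def mult.assoc)
  show "u1 * a' = a' * u2" by (simp add: u1_def u2_def mult.assoc)
  have "a' * (a * a * a * u) * a' * a' * a' = a' * (u * a * a * a) * a' * a' * a'"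
    by (simp only: cube_commute)
  then show "u2 * a' = a' * u" by (simp add: u2_def mult.assoc)
qed

lemma move_left: "u * (a' * f) = a' * (u1 * f)" "u1 * (a' * f) = a' * (u2 * f)"
    "u2 * (a' * f) = a' * (u * f)"
  using move by (simp_all only: mult.assoc[symmetric])

lemma conj_quadratic: "u1 * u1 + u * u1 + u * u = 3 * (1 - a * a)"
proof -
  have "a * u = u1 * a" by (simp add: u1_def mult.assoc)
  then have au: "a * (u * f) = u1 * (a * f)" for f by (metis mult.assoc)
  have "(u1 * u1 + u * u1 + u * u) * a = a * u * u + u * a * u + u * u * a"
    using au au[of 1] by (simp add: algebra_simps)
  also have "\<dots> = (3 * (1 - a * a)) * a"
    by (simp only: rels(10)) (simp add: algebra_simps)
  finally have "(u1 * u1 + u * u1 + u * u) * a * a' = (3 * (1 - a * a)) * a * a'" by simp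
  then show ?thesis by (simp add: mult.assoc)
qed

definition b' where "b' = a' * a' * a' * b"

lemma b'_rels: "b' * b = 1" "b * b' = 1" "b' * a = a * b'" "b' * u = u * b'" "b' * z = - (z * b')"
  "b' * b' = a' * a' * a'"
proof -
  have ba': "b * a' = a' * b" and za': "z * a' = a' * z"
    using inverse_commute rels(4,5) by auto
  have ba'l: "b * (a' * f) = a' * (b * f)" and za'l: "z * (a' * f) = a' * (z * f)"
    and bal: "b * (a * f) = a * (b * f)" for f
    using ba' za' rels(4) by (simp_all only: mult.assoc[symmetric])
  have bb: "b * b = a * (a * a)" using rels(3) by (simp add: mult.assoc)
  show 1: "b' * b = 1" by (simp add: b'_def mult.assoc bb)
  show "b * b' = 1" by (simp add: b'_def mult.assoc ba'l bb)
  show "b' * a = a * b'" by (simp add: b'_def mult.assoc rels(4))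
  have "u * a' * a' * a' = a' * a' * a' * u" by (simp add: mult.assoc move move_left)
  then have "u * (a' * (a' * (a' * f))) = a' * (a' * (a' * (u * f)))" for f
    by (metis mult.assoc)
  then show "b' * u = u * b'" by (simp add: b'_def mult.assoc rels(6))
  show "b' * z = - (z * b')" by (simp add: b'_def mult.assoc rels(8) za'l)
  show "b' * b' = a' * a' * a'"  by (simp add: b'_def mult.assoc ba'l bb)
qed

text \<open>The shifted relations hold, with all products reversed, for \<open>- u a\<inverse>\<close>, \<open>- z b\<inverse>\<close>,
  \<open>a\<inverse>\<close>, \<open>a\<close> and \<open>b\<inverse>\<close>.\<close>

lemma antipode_relations:
  defines "U \<equiv> - (u * a')" and "Z \<equiv> - (z * b')"
  shows "b' * b' = a' * a' * a'" "a' * b' = b' * a'" "a' * Z = Z * a'" "U * b' = b' * U" "U * Z = Z * U"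
    "Z * b' = - (b' * Z)" "U * a' * a' + a' * U * a' + a' * a' * U = 0"
    "U * U * a' + U * a' * U + a' * U * U = 3 * (a' - a' * a' * a')"
    "27 * (Z * Z) = U * U * U - 3 * U + 2 - 2 * (a' * a' * a')"
proof -
  have ca: "a' * b' = b' * a'" using inverse_commute[OF b'_rels(3)] by simp
  have za: "z * a' = a' * z" by (rule inverse_commute[OF rels(5)])
  have zal: "z * (a' * f) = a' * (z * f)" and bal: "b' * (a' * f) = a' * (b' * f)"
    and bul: "b' * (u * f) = u * (b' * f)" and zul: "z * (u * f) = u * (z * f)"
    and bzl: "b' * (z * f) = - (z * (b' * f))" for f
    using za ca b'_rels(4,5) rels(7) by (simp_all only: mult.assoc[symmetric]) simp_all
  show "b' * b' = a' * a' * a'" by (rule b'_rels)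
  show "a' * b' = b' * a'" by (rule ca)
  show "a' * Z = Z * a'" by (simp add: Z_def mult.assoc ca[symmetric] zal)
  show "U * b' = b' * U" by (simp add: U_def mult.assoc ca bul)
  show "U * Z = Z * U"
    by (simp add: U_def Z_def mult.assoc bul zul ca[symmetric] flip: zal)
  show "Z * b' = - (b' * Z)" by (simp add: Z_def bzl mult.assoc)
  have "u * u2 + u * u1 + u2 * u1 = - (u1 * u1 + u * u1 + u * u)"
    by (simp add: u2_eq algebra_simps)
  then have bu1: "u * u2 + u * u1 + u2 * u1 = - (3 * (1 - a * a))"
    by (simp only: conj_quadratic)
  have "U * a' * a' + a' * U * a' + a' * a' * U = - (a' * (a' * (a' * (u + u1 + u2))))"
    by (simp add: U_def mult.assoc move move_left algebra_simps)
  then show "U * a' * a' + a' * U * a' + a' * a' * U = 0"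
    using conj_sum by simp
  have "U * U * a' + U * a' * U + a' * U * U = a' * (a' * (a' * (u * u2 + u * u1 + u2 * u1)))"
    by (simp add: U_def mult.assoc move move_left algebra_simps)
  then show "U * U * a' + U * a' * U + a' * U * U = 3 * (a' - a' * a' * a')"
    unfolding bu1 by (simp add: algebra_simps numeral_left_commute numeral_commute[of a'])
  have UUU: "U * U * U = - (a' * (a' * (a' * (u * u2 * u1))))"
    by (simp add: U_def mult.assoc move move_left algebra_simps)
  have "u * u2 * u1 = - (u * (u1 * u1 + u * u1 + u * u)) + u * u * u"
    by (simp add: u2_eq algebra_simps)
  also have "\<dots> = u * u * u - 3 * u + 3 * (u * a * a)"
    unfolding conj_quadratic by (simp add: algebra_simps numeral_left_commute numeral_commute[of u])
  finally have uuu: "u * u2 * u1 = u * u * u - 3 * u + 3 * (u * a * a)" .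
  have uaa: "a' * (a' * (a' * (u * a * a))) = u * a'"
  proof -
    have "a' * (a' * (a' * (u * a * a * a))) = u"
      by (simp only: cube_commute[symmetric]) (simp add: mult.assoc)
    then have "a' * (a' * (a' * (u * a * a * a))) * a' = u * a'" by simp
    then show ?thesis by (simp add: mult.assoc)
  qed
  have "27 * (Z * Z) = - (a' * (a' * (a' * (27 * (z * z)))))"
    by (simp add: Z_def mult.assoc bzl b'_rels(6) zal za numeral_left_commute)
  also have "\<dots> = - (a' * (a' * (a' * (u * u * u - 3 * u + 2 - 2 * (a * a * a)))))"
    by (simp only: rels(11))
  also have "\<dots> = - (a' * (a' * (a' * (u * u2 * u1)))) + 3 * (u * a') + 2 - 2 * (a' * (a' * a'))"
    unfolding uuu uaa[symmetric]
    by (simp add: algebra_simps numeral_left_commute numeral_commute[of a'])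
  finally show "27 * (Z * Z) = U * U * U - 3 * U + 2 - 2 * (a' * a' * a')"
    unfolding UUU by (simp add: U_def mult.assoc)
qed

text \<open>Over a ring that contains a primitive cube root of unity.\<close>

definition v where "v w = u1 - w * u"

text \<open>Conjugation by \<open>a\<close> has the eigenvalues \<open>w\<close> and \<open>w\<^sup>2\<close> on the span of \<open>u\<close> and its conjugates.\<close>

lemma eigenvector:
  assumes w: "w * w + w + 1 = 0" and c: "\<And>f. f * w = w * f"
  shows "a * u = (v w + w * u) * a" "a * v w = w * w * v w * a"
    "v w * u = w * u * v w - w * w * v w * v w + 3 * (w * w) * (1 - a * a)"
proof -
  have wl: "f * (w * g) = w * (f * g)" for f g by (metis c mult.assoc)
  have ww: "w * w = - w - 1" using w by (simp add: algebra_simps eq_neg_iff_add_eq_0)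
  have www: "w * (w * f) = - (w * f) - f" for f
    by (simp add: mult.assoc[symmetric] ww algebra_simps)
  show au: "a * u = (v w + w * u) * a" by (simp add: v_def u1_def mult.assoc)
  have "a * u1 = u2 * a" by (simp add: u1_def u2_def mult.assoc)
  moreover have "a * u = u1 * a" by (simp add: u1_def mult.assoc)
  ultimately show "a * v w = w * w * v w * a"
    by (simp add: v_def mult.assoc wl[of a] algebra_simps u2_eq www)
  have "v w * u - (w * u * v w - w * w * v w * v w) = w * w * (u1 * u1 + u * u1 + u * u)"
    by (simp add: v_def algebra_simps wl[of u] wl[of u1] c[of u] c[of u1] www)
  then show "v w * u = w * u * v w - w * w * v w * v w + 3 * (w * w) * (1 - a * a)"
    unfolding conj_quadratic by (simp add: algebra_simps numeral_left_commute numeral_commute[of w])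
qed

end

lemma eigenvector_converse:
  fixes u v a w :: "'r::ring_1"
  assumes w: "w * w + w + 1 = 0" and c: "\<And>f. f * w = w * f"
    and au: "a * u = (v + w * u) * a" and av: "a * v = w * w * v * a"
    and vu: "v * u = w * u * v - w * w * v * v + 3 * (w * w) * (1 - a * a)"
  shows "a * a * u + a * u * a + u * a * a = 0"
    "a * u * u + u * a * u + u * u * a = 3 * (a - a * a * a)"
proof -
  have wl: "f * (w * g) = w * (f * g)" for f g by (metis c mult.assoc)
  have ww: "w * w = - w - 1" using w by (simp add: algebra_simps eq_neg_iff_add_eq_0)
  have www: "w * (w * f) = - (w * f) - f" for f
    by (simp add: mult.assoc[symmetric] ww algebra_simps)
  have aul: "a * (u * f) = v * (a * f) + w * (u * (a * f))" for f
    using arg_cong[OF au, of "\<lambda>g. g * f"] by (simp add: algebra_simps)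
  have avl: "a * (v * f) = w * (w * (v * (a * f)))" for f
    using arg_cong[OF av, of "\<lambda>g. g * f"] by (simp add: algebra_simps)
  have vul: "v * (u * f) = w * (u * (v * f)) - w * (w * (v * (v * f))) + 3 * (w * (w * (f - a * (a * f))))" for f
    using arg_cong[OF vu, of "\<lambda>g. g * f"] by (simp add: algebra_simps)
  show "a * a * u + a * u * a + u * a * a = 0"
    using aul[of 1] avl[of 1] by (simp add: algebra_simps aul avl wl[of a] www)
  show "a * u * u + u * a * u + u * u * a = 3 * (a - a * a * a)"
    using aul[of 1] avl[of 1]
    by (simp add: algebra_simps aul avl vul wl[of a] wl[of u] wl[of v] www numeral_left_commute)
qed

section \<open>The algebra in shifted generators\<close>

lemma ideal_two_sided:
  assumes "ideal I (free_algebra :: ('k::comm_ring_1, ('g, 'k) free_alg) module)"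
  shows "two_sided_ideal I"
proof -
  interpret ideal I "free_algebra :: ('k, ('g, 'k) free_alg) module" by fact
  show ?thesis
  proof
    show "0 \<in> I" using additive_subgroup.zero_closed[OF additive_subgroup_axioms] by simp
    show "f + g \<in> I" if "f \<in> I" "g \<in> I" for f g
      using additive_subgroup.a_closed[OF additive_subgroup_axioms that] by simp
    show "f * g \<in> I" if "g \<in> I" for f g
      using I_l_closed[OF that, of f] by simp
    show "f * g \<in> I" if "f \<in> I" for f g
      using I_r_closed[OF that, of g] by simp
  qed
qed

lemma kernel_ideal:
  assumes M: "associative_algebra ring_of_type_algebra M"
    and f: "f \<in> algebra_homs ring_of_type_algebra free_algebra M"
  shows "ideal {r. f r = \<zero>\<^bsub>M\<^esub>} (free_algebra :: ('k::comm_ring_1, ('g, 'k) free_alg) module)"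
proof -
  interpret F: associative_algebra ring_of_type_algebra "free_algebra :: ('k, ('g, 'k) free_alg) module"
    by (rule free_algebra_associative)
  interpret M: associative_algebra ring_of_type_algebra M by fact
  have "ring_hom_ring (free_algebra :: ('k, ('g, 'k) free_alg) module) M f"
    using f F.ring_axioms M.ring_axioms
    by (simp add: ring_hom_ring_def ring_hom_ring_axioms_def algebra_homs_def)
  from ring_hom_ring.kernel_is_ideal[OF this] show ?thesis
    by (simp add: a_kernel_def kernel_def)
qed

lemma genideal_free_minimal:
  assumes "ideal I (free_algebra :: ('k::comm_ring_1, ('g, 'k) free_alg) module)" "S \<subseteq> I"
  shows "Idl\<^bsub>free_algebra\<^esub> S \<subseteq> I"
  unfolding genideal_def using assms by blast

lemma genideal_free:
  "ideal (Idl\<^bsub>free_algebra\<^esub> S) (free_algebra :: ('k::comm_ring_1, ('g, 'k) free_alg) module)"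
  "S \<subseteq> Idl\<^bsub>free_algebra\<^esub> S"
proof -
  interpret F: associative_algebra ring_of_type_algebra "free_algebra :: ('k, ('g, 'k) free_alg) module"
    by (rule free_algebra_associative)
  show "ideal (Idl\<^bsub>free_algebra\<^esub> S) (free_algebra :: ('k, ('g, 'k) free_alg) module)"
    by (rule F.genideal_ideal) simp
  show "S \<subseteq> Idl\<^bsub>free_algebra\<^esub> S"
    by (rule F.genideal_self) simp
qed

definition ring_map :: "('a::ring_1 \<Rightarrow> 'b::ring_1) \<Rightarrow> bool" where
  "ring_map f \<longleftrightarrow> f 1 = 1 \<and> (\<forall>x y. f (x + y) = f x + f y \<and> f (x * y) = f x * f y)"

lemma ring_mapD:
  assumes "ring_map f"
  shows "f 0 = 0" "f 1 = 1" "f (x + y) = f x + f y" "f (x * y) = f x * f y" "f (- x) = - f x"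
    "f (x - y) = f x - f y" "f (numeral n) = numeral n"
proof -
  show 0: "f 0 = 0" using assms[unfolded ring_map_def] by (metis add_cancel_right_right)
  show 1: "f 1 = 1" "f (x + y) = f x + f y" "f (x * y) = f x * f y" for x y
    using assms by (auto simp: ring_map_def)
  show m: "f (- x) = - f x" for x using 0 1(2)[of x "- x"] by (simp add: eq_neg_iff_add_eq_0 add.commute)
  show "f (x - y) = f x - f y" using 1(2)[of x "- y"] m[of y] by simp
  have "f (of_nat n) = of_nat n" for n by (induction n) (simp_all add: 0 1)
  from this[of "numeral n"] show "f (numeral n) = numeral n" by simp
qed

lemma algebra_hom_ring_map:
  "f \<in> algebra_homs R free_algebra (algebra_of_type s) \<Longrightarrow> ring_map f"
  unfolding ring_map_def using algebra_homsD[of f R free_algebra "algebra_of_type s"] by simp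

lemma algebra_hom_const:
  fixes f :: "('g, 'k::comm_ring_1) free_alg \<Rightarrow> 'a::ring_1"
  shows "f \<in> algebra_homs ring_of_type_algebra free_algebra (algebra_of_type s) \<Longrightarrow> f (fconst c) = s c 1"
  using algebra_homsD(5)[of f ring_of_type_algebra free_algebra "algebra_of_type s" c 1]
    algebra_homsD(6)[of f ring_of_type_algebra free_algebra "algebra_of_type s"] by simp

lemma ring_map_shifted_set:
  assumes "ring_map f"
  shows "f ` shifted_set u z a a' b = shifted_set (f u) (f z) (f a) (f a') (f b)"
  using ring_mapD[OF assms] by (simp add: shifted_set_def)

lemma k_algebra_of_type:
  fixes s :: "'k::comm_ring_1 \<Rightarrow> 'a::ring_1 \<Rightarrow> 'a"
  assumes "associative_algebra ring_of_type_algebra (algebra_of_type s)"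
  shows "k_algebra (algebra_of_type s)"
  using assms by (simp add: k_algebra_def)

definition shifted_ideal :: "(gen, 'k::field) free_alg set" where
  "shifted_ideal = Idl\<^bsub>free_algebra\<^esub> (shifted_set (fvar Gx) (fvar Gy) (fvar Ga) (fvar Gainv) (fvar Gb))"

interpretation shifted_ideal: two_sided_ideal shifted_ideal
  unfolding shifted_ideal_def by (rule ideal_two_sided[OF genideal_free(1)])

lemma shifted_ideal_gens:
  "shifted_set (fvar Gx) (fvar Gy) (fvar Ga) (fvar Gainv) (fvar Gb) \<subseteq> shifted_ideal"
  unfolding shifted_ideal_def by (rule genideal_free(2))

lemma one_notin_shifted_ideal: "1 \<notin> (shifted_ideal :: (gen, 'k::field) free_alg set)"
proof -
  let ?M = "algebra_of_type ((*) :: 'k \<Rightarrow> 'k \<Rightarrow> 'k)"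
  have M: "associative_algebra ring_of_type_algebra ?M"
    by (rule associative_algebra_of_type) (simp_all add: algebra_simps)
  interpret k_algebra ?M by (rule k_algebra_of_type[OF M])
  define v where "v g = (if g = Gx \<or> g = Gy then 0 else 1 :: 'k)" for g
  have h: "free_eval ?M v \<in> algebra_homs ring_of_type_algebra free_algebra ?M"
    by (rule free_eval_hom) simp
  have var: "free_eval ?M v (fvar g) = v g" for g by (rule free_eval_var) simp
  note R = algebra_hom_ring_map[OF h]
  have "free_eval ?M v ` shifted_set (fvar Gx) (fvar Gy) (fvar Ga) (fvar Gainv) (fvar Gb) \<subseteq> {0}"
    unfolding ring_map_shifted_set[OF R] var by (simp add: shifted_set_def v_def)
  then have "shifted_ideal \<subseteq> {r. free_eval ?M v r = \<zero>\<^bsub>?M\<^esub>}"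
    unfolding shifted_ideal_def by (intro genideal_free_minimal kernel_ideal[OF M h]) auto
  then show ?thesis using ring_mapD(2)[OF R] by auto
qed

quotient_type (overloaded) 'k shifted_alg = "(gen, 'k::field) free_alg" / "\<lambda>f g. f - g \<in> shifted_ideal"
proof (rule equivpI)
  show "reflp (\<lambda>f g. f - g \<in> (shifted_ideal :: (gen, 'k) free_alg set))"
    by (simp add: reflp_def shifted_ideal.zero)
  show "symp (\<lambda>f g. f - g \<in> (shifted_ideal :: (gen, 'k) free_alg set))"
    unfolding symp_def using shifted_ideal.minus by fastforce
  show "transp (\<lambda>f g. f - g \<in> (shifted_ideal :: (gen, 'k) free_alg set))"
    unfolding transp_def using shifted_ideal.add by fastforce
qed

lemma shifted_ideal_cong:
  assumes "f - f' \<in> shifted_ideal"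
  shows "- f - - f' \<in> shifted_ideal"
    and "g - g' \<in> shifted_ideal \<Longrightarrow> f - g - (f' - g') \<in> shifted_ideal"
    and "g - g' \<in> shifted_ideal \<Longrightarrow> f * g - f' * g' \<in> shifted_ideal"
proof -
  show "- f - - f' \<in> shifted_ideal" using shifted_ideal.minus[OF assms] by simp
  assume g: "g - g' \<in> shifted_ideal"
  show "f - g - (f' - g') \<in> shifted_ideal"
    using shifted_ideal.diff[OF assms g] by (simp add: algebra_simps)
  have "(f - f') * g + f' * (g - g') \<in> shifted_ideal"
    using assms g by (intro shifted_ideal.add shifted_ideal.left shifted_ideal.right)
  then show "f * g - f' * g' \<in> shifted_ideal" by (simp add: algebra_simps)
qed

instantiation shifted_alg :: (field) ring_1
begin

lift_definition zero_shifted_alg :: "'a shifted_alg" is 0 .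
lift_definition one_shifted_alg :: "'a shifted_alg" is 1 .
lift_definition plus_shifted_alg :: "'a shifted_alg \<Rightarrow> 'a shifted_alg \<Rightarrow> 'a shifted_alg" is "(+)"
  using shifted_ideal.add by (metis add_diff_add)
lift_definition minus_shifted_alg :: "'a shifted_alg \<Rightarrow> 'a shifted_alg \<Rightarrow> 'a shifted_alg" is "(-)"
  by (rule shifted_ideal_cong)
lift_definition uminus_shifted_alg :: "'a shifted_alg \<Rightarrow> 'a shifted_alg" is "uminus"
  by (rule shifted_ideal_cong)
lift_definition times_shifted_alg :: "'a shifted_alg \<Rightarrow> 'a shifted_alg \<Rightarrow> 'a shifted_alg" is "(*)"
  by (rule shifted_ideal_cong)

instance
proof
  fix x y z :: "'a shifted_alg"
  show "x + y + z = x + (y + z)" "x * y * z = x * (y * z)" "(x + y) * z = x * z + y * z"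
    "x * (y + z) = x * y + x * z" "x + y = y + x" "x - y = x + - y"
    "0 + x = x" "- x + x = 0" "1 * x = x" "x * 1 = x"
    by (transfer; simp add: algebra_simps shifted_ideal.zero)+
  show "(0 :: 'a shifted_alg) \<noteq> 1"
    by transfer (use one_notin_shifted_ideal shifted_ideal.minus in fastforce)
qed

end

abbreviation cl :: "(gen, 'k::field) free_alg \<Rightarrow> 'k shifted_alg" where
  "cl \<equiv> abs_shifted_alg"

lemma cl_ring_map: "ring_map (cl :: (gen, 'k::field) free_alg \<Rightarrow> 'k shifted_alg)"
  unfolding ring_map_def
  by (simp add: one_shifted_alg.abs_eq plus_shifted_alg.abs_eq times_shifted_alg.abs_eq)

lemma cl_eq_iff: "cl f = cl g \<longleftrightarrow> f - g \<in> shifted_ideal"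
  by (rule shifted_alg.abs_eq_iff)

lemma cl_surj: obtains f where "r = cl f"
  using Quotient_abs_rep[OF Quotient_shifted_alg, of r] by metis

definition scale :: "'k::field \<Rightarrow> 'k shifted_alg \<Rightarrow> 'k shifted_alg" where
  "scale c r = cl (fconst c) * r"

lemma scalar_central: "r * cl (fconst c) = cl (fconst c) * r"
proof -
  obtain f where "r = cl f" by (rule cl_surj)
  then show ?thesis
    by (simp add: fconst_commute[of f c] flip: ring_mapD(4)[OF cl_ring_map])
qed

abbreviation NA :: "('k::field, 'k shifted_alg) module" where
  "NA \<equiv> algebra_of_type scale"

lemma NA_associative: "associative_algebra ring_of_type_algebra NA"
proof (rule associative_algebra_of_type)
  fix c f g
  show "f * scale c g = scale c (f * g)"
    by (simp add: scale_def mult.assoc[symmetric] scalar_central)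
qed (simp_all add: scale_def fconst_add fconst_mult ring_mapD[OF cl_ring_map] algebra_simps)

lemma cl_hom: "cl \<in> algebra_homs ring_of_type_algebra free_algebra NA"
  by (intro algebra_homsI module_homsI) (simp_all add: ring_mapD[OF cl_ring_map] scale_def)

lemma shifted_alg_induct [case_names const var add mult]:
  fixes r :: "'k::field shifted_alg"
  assumes "\<And>c. P (cl (fconst c))" "\<And>g. P (cl (fvar g))"
    "\<And>f h. P f \<Longrightarrow> P h \<Longrightarrow> P (f + h)" "\<And>f h. P f \<Longrightarrow> P h \<Longrightarrow> P (f * h)"
  shows "P r"
proof -
  obtain f where r: "r = cl f" by (rule cl_surj)
  show ?thesis
    unfolding r by (induction f rule: free_alg_induct) (simp_all add: assms ring_mapD[OF cl_ring_map])
qed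

text \<open>The universal property of the algebra: a homomorphism out of it is a choice of values of
  the generators that satisfies the shifted relations.\<close>

lemma NA_hom_exists:
  fixes M :: "('k::field, 'm, 'd) module_scheme"
  assumes "k_algebra M" and v: "\<And>g. v g \<in> carrier M"
    and rel: "\<And>r. r \<in> shifted_set (fvar Gx) (fvar Gy) (fvar Ga) (fvar Gainv) (fvar Gb) \<Longrightarrow>
      free_eval M v r = \<zero>\<^bsub>M\<^esub>"
  obtains g where "g \<in> algebra_homs ring_of_type_algebra NA M" "\<And>f. g (cl f) = free_eval M v f"
proof
  interpret k_algebra M by fact
  define g where "g r = free_eval M v (rep_shifted_alg r)" for r
  have h: "free_eval M v \<in> algebra_homs ring_of_type_algebra free_algebra M"
    by (rule free_eval_hom[OF v])
  note D = algebra_homsD[OF h, simplified]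
  have "shifted_ideal \<subseteq> {r. free_eval M v r = \<zero>\<^bsub>M\<^esub>}"
    unfolding shifted_ideal_def using rel
    by (intro genideal_free_minimal kernel_ideal[OF associative_algebra_axioms h]) auto
  then have ker: "free_eval M v r = \<zero>\<^bsub>M\<^esub>" if "r \<in> shifted_ideal" for r using that by auto
  show g: "g (cl f) = free_eval M v f" for f
  proof -
    have "rep_shifted_alg (cl f) - f \<in> shifted_ideal"
      using cl_eq_iff[of "rep_shifted_alg (cl f)" f] Quotient_abs_rep[OF Quotient_shifted_alg] by metis
    then have "free_eval M v ((rep_shifted_alg (cl f) - f) + f) = free_eval M v f"
      using ker D(2,3) by (metis M.l_zero)
    then show ?thesis by (simp add: g_def)
  qed
  show "g \<in> algebra_homs ring_of_type_algebra NA M"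
  proof (intro algebra_homsI module_homsI)
    fix r s :: "'k shifted_alg"
    obtain f where f: "r = cl f" by (rule cl_surj)
    obtain h where h: "s = cl h" by (rule cl_surj)
    show "g r \<in> carrier M" by (simp add: f g D)
    show "g (r \<oplus>\<^bsub>NA\<^esub> s) = g r \<oplus>\<^bsub>M\<^esub> g s"
      by (simp add: f h g D flip: ring_mapD[OF cl_ring_map])
    show "g (r \<otimes>\<^bsub>NA\<^esub> s) = g r \<otimes>\<^bsub>M\<^esub> g s"
      by (simp add: f h g D flip: ring_mapD[OF cl_ring_map])
    show "g (c \<odot>\<^bsub>NA\<^esub> r) = c \<odot>\<^bsub>M\<^esub> g r" for c
      using g[of "fconst c * f"] D(5)[of c f] by (simp add: f g scale_def ring_mapD[OF cl_ring_map])
  next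
    have "g (cl 1) = \<one>\<^bsub>M\<^esub>" by (simp add: g D)
    then show "g \<one>\<^bsub>NA\<^esub> = \<one>\<^bsub>M\<^esub>" by (simp add: ring_mapD[OF cl_ring_map])
  qed
qed

lemma NA_hom_unique:
  assumes f: "f \<in> algebra_homs ring_of_type_algebra NA M"
    and g: "g \<in> algebra_homs ring_of_type_algebra NA M"
    and "\<And>t. f (cl (fvar t)) = g (cl (fvar t))"
  shows "f r = g r"
proof -
  obtain h where r: "r = cl h" by (rule cl_surj)
  show ?thesis
    unfolding r
    using free_algebra_hom_unique[OF algebra_homs_comp[OF cl_hom f] algebra_homs_comp[OF cl_hom g]] assms(3)
    by blast
qed

abbreviation "nu \<equiv> cl (fvar Gx)"
abbreviation "nz \<equiv> cl (fvar Gy)"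
abbreviation "na \<equiv> cl (fvar Ga)"
abbreviation "na' \<equiv> cl (fvar Gainv)"
abbreviation "nb \<equiv> cl (fvar Gb)"

interpretation NA: shifted_algebra nu nz na na' nb
proof
  have "cl ` shifted_set (fvar Gx) (fvar Gy) (fvar Ga) (fvar Gainv) (fvar Gb) \<subseteq> {0}"
    using shifted_ideal_gens by (auto simp: cl_eq_iff simp flip: ring_mapD(1)[OF cl_ring_map])
  then show "shifted_set nu nz na na' nb \<subseteq> {0}"
    by (simp add: ring_map_shifted_set[OF cl_ring_map])
qed

definition nodal_set :: "'r \<Rightarrow> 'r \<Rightarrow> 'r \<Rightarrow> 'r \<Rightarrow> 'r \<Rightarrow> 'r \<Rightarrow> 'r \<Rightarrow> 'r \<Rightarrow> 'r::ring_1 set" where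
  "nodal_set C P E x y a a' b =
    {a * a' - 1, a' * a - 1, y * y - (x * x + x * x * x), b * b - a * a * a, b * a - a * b,
     y * a - a * y, b * x - x * b, y * x - x * y, b * y + y * b - 2 * (P * (b * b)),
     a * a * x + a * x * a + x * a * a + a * a - C * (a * a * a),
     a * x * x + x * a * x + x * x * a + a * x + x * a - E * (a * a * a)}"

lemma nodal_relations_eq:
  "nodal_relations q p = nodal_set (fconst (1 + 3 * q)) (fconst p) (fconst ((2 + 3 * q) * q))
    (fvar Gx) (fvar Gy) (fvar Ga) (fvar Gainv) (fvar Gb)"
proof -
  have 1: "b * y - (- (y * b) + fconst (2 * p) * b ^ 2) = b * y + y * b - 2 * (fconst p * (b * b))"
    for b y :: "(gen, 'a) free_alg"
    by (simp add: power2_eq_square fconst_mult fconst_numeral algebra_simps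
        numeral_left_commute[of "fconst p"])
  have 2: "a ^ 2 * x - (- (x * a ^ 2) - a * x * a - a ^ 2 + C * a ^ 3) =
      a * a * x + a * x * a + x * a * a + a * a - C * (a * a * a)" for a x C :: "(gen, 'a) free_alg"
    by (simp add: power2_eq_square power3_eq_cube algebra_simps)
  have 3: "a * x ^ 2 - (- (a * x) - x * a - x ^ 2 * a - x * a * x + E * a ^ 3) =
      a * x * x + x * a * x + x * x * a + a * x + x * a - E * (a * a * a)" for a x E :: "(gen, 'a) free_alg"
    by (simp add: power2_eq_square power3_eq_cube algebra_simps)
  show ?thesis
    unfolding nodal_relations_def nodal_set_def Let_def 1 2 3
    by (simp add: power2_eq_square power3_eq_cube)
qed

lemma ring_map_nodal_set:
  assumes "ring_map f"
  shows "f ` nodal_set C P E x y a a' b = nodal_set (f C) (f P) (f E) (f x) (f y) (f a) (f a') (f b)"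
  using ring_mapD[OF assms] by (simp add: nodal_set_def)

context shift
begin

lemma nodal_imp_shifted:
  assumes K: "two_sided_ideal K" and N: "nodal_set C P E x y a a' b \<subseteq> K"
    and E: "3 * E = C * C - 1" and PC: "27 * (P * P) = C * C * C - 3 * C + 2"
  shows "shifted_set u z a a' b \<subseteq> K"
proof -
  interpret K: two_sided_ideal K by fact
  have n: "a * a' - 1 \<in> K" "a' * a - 1 \<in> K" "y * y - (x * x + x * x * x) \<in> K" "b * b - a * a * a \<in> K"
    "b * a - a * b \<in> K" "y * a - a * y \<in> K" "b * x - x * b \<in> K" "y * x - x * y \<in> K"
    "b * y + y * b - 2 * (P * (b * b)) \<in> K"
    "a * a * x + a * x * a + x * a * a + a * a - C * (a * a * a) \<in> K"
    "a * x * x + x * a * x + x * x * a + a * x + x * a - E * (a * a * a) \<in> K"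
    using N by (auto simp: nodal_set_def)
  have U: "a * a * u + a * u * a + u * a * a \<in> K"
    unfolding shift_linear by (rule K.left[OF n(10)])
  have V: "a * u * u + u * a * u + u * u * a - 3 * (a - a * a * a) \<in> K"
    unfolding shift_quadratic[OF E] by (rule K.diff[OF K.left[OF n(11)] K.left[OF K.left[OF n(10)]]])
  have "27 * (z * z) - (u * u * u - 3 * u + 2 - 2 * (a * a * a)) \<in> K"
    unfolding shift_cubic[OF PC]
    by (rule K.add[OF K.add[OF K.diff[OF K.diff[OF K.left[OF n(3)] K.left[OF K.left[OF n(9)]]]
      K.left[OF K.left[OF K.left[OF n(4)]]]] K.left[OF V]] K.left[OF K.left[OF U]]])
  moreover have "b * z + z * b \<in> K" unfolding shift_commutators by (rule n)
  moreover have "z * u - u * z \<in> K" unfolding shift_commutators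
    by (rule K.add[OF K.diff[OF K.diff[OF K.left[OF n(8)] K.left[OF n(6)]] K.left[OF K.left[OF n(7)]]]
      K.left[OF K.left[OF n(5)]]])
  moreover have "z * a - a * z \<in> K" unfolding shift_commutators
    by (rule K.diff[OF n(6) K.left[OF n(5)]])
  moreover have "b * u - u * b \<in> K" unfolding shift_commutators
    by (rule K.diff[OF K.left[OF n(7)] K.left[OF n(5)]])
  ultimately show ?thesis
    using U V n by (simp add: shifted_set_def)
qed

lemma shifted_imp_nodal:
  assumes S: "shifted_set u z a a' b \<subseteq> {0}" and three': "\<And>f. \<lbrakk>f * C = C * f; 3 * f = 0\<rbrakk> \<Longrightarrow> f = 0"
    and E: "3 * E = C * C - 1" and PC: "27 * (P * P) = C * C * C - 3 * C + 2"
  shows "nodal_set C P E x y a a' b \<subseteq> {0}"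
proof -
  note three = three'[OF C]
  note s' = shifted_setD[OF S, unfolded singleton_iff]
  have nine: "f = 0" if "9 * f = 0" for f :: 'r
    using that three[of "3 * f"] three[of f] by (simp add: mult.assoc[symmetric])
  have tw7: "f = 0" if "27 * f = 0" for f :: 'r
    using that nine[of "3 * f"] three[of f] by (simp add: mult.assoc[symmetric])
  have r4: "b * b - a * a * a = 0" by (rule s'(3))
  have r5: "b * a - a * b = 0" by (rule s'(4))
  have r6: "y * a - a * y = 0" using s'(5) unfolding shift_commutators r5 by simp
  have "3 * (b * x - x * b) = 0" using s'(6) unfolding shift_commutators r5 by simp
  then have r7: "b * x - x * b = 0" by (rule three)
  have "3 * (y * x - x * y) = 0" using s'(7) unfolding shift_commutators r5 r6 r7 by simp
  then have r8: "y * x - x * y = 0" by (rule three)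
  have r9: "b * y + y * b - 2 * (P * (b * b)) = 0" using s'(8) unfolding shift_commutators .
  have r10: "a * a * x + a * x * a + x * a * a + a * a - C * (a * a * a) = 0"
    using s'(9) unfolding shift_linear by (rule three)
  have "9 * (a * x * x + x * a * x + x * x * a + a * x + x * a - E * (a * a * a)) = 0"
    using s'(10) unfolding shift_quadratic[OF E] r10 by simp
  then have r11: "a * x * x + x * a * x + x * x * a + a * x + x * a - E * (a * a * a) = 0"
    by (rule nine)
  have "27 * (y * y - (x * x + x * x * x)) = 0"
    using s'(11) unfolding shift_cubic[OF PC] r4 r9 s'(9,10) by simp
  then have r3: "y * y - (x * x + x * x * x) = 0" by (rule tw7)
  show ?thesis
    using s'(1,2) r3 r4 r5 r6 r7 r8 r9 r10 r11 by (simp only: nodal_set_def insert_subset singleton_iff) simp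
qed

end

section \<open>The algebra of the nodal cubic\<close>

abbreviation kk :: "'k::field ring" where "kk \<equiv> ring_of_type_algebra"

locale nodal =
  fixes q p :: "'k::field_char_0"
  assumes pq: "p ^ 2 = q ^ 2 + q ^ 3"
begin

abbreviation "A \<equiv> nodal_hopf q p"
abbreviation "I \<equiv> nodal_ideal q p"
abbreviation "gx \<equiv> nodal_gen q p Gx"
abbreviation "gy \<equiv> nodal_gen q p Gy"
abbreviation "ga \<equiv> nodal_gen q p Ga"
abbreviation "ga' \<equiv> nodal_gen q p Gainv"
abbreviation "gb \<equiv> nodal_gen q p Gb"

sublocale FA: algebra_ideal kk "free_algebra :: ('k, (gen, 'k) free_alg) module" I
  unfolding algebra_ideal_def nodal_ideal_def using free_algebra_associative genideal_free(1) by blast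

abbreviation "pr f \<equiv> FA.\<pi> f"

lemma Q_eq: "quotient_algebra free_algebra I = A"
  by (simp add: nodal_hopf_def)

sublocale A: k_algebra A
  using FA.Q.associative_algebra_axioms by (simp add: Q_eq k_algebra_def)

lemma pr_gen: "pr (fvar g) = nodal_gen q p g"
  by (simp add: nodal_gen_def)

lemma pr_hom: "pr \<in> algebra_homs kk free_algebra A"
  using FA.\<pi>_hom by (simp add: Q_eq)

lemma nodal_ideal_gens: "nodal_relations q p \<subseteq> I"
  unfolding nodal_ideal_def by (rule genideal_free(2))

lemma fconst_shift:
  "3 * fconst ((2 + 3 * q) * q) = fconst (1 + 3 * q) * fconst (1 + 3 * q) - (1 :: ('g, 'k) free_alg)"
  "27 * (fconst p * fconst p) = fconst (1 + 3 * q) * fconst (1 + 3 * q) * fconst (1 + 3 * q)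
    - 3 * fconst (1 + 3 * q) + (2 :: ('g, 'k) free_alg)"
proof -
  have m: "fconst c - fconst d = (fconst (c - d) :: ('g, 'k) free_alg)" for c d
    by (simp add: fconst_def single_diff)
  have n: "numeral n = (fconst (numeral n) :: ('g, 'k) free_alg)" for n by (simp add: fconst_numeral)
  have o: "1 = (fconst 1 :: ('g, 'k) free_alg)" by simp
  have "3 * ((2 + 3 * q) * q) = (1 + 3 * q) * (1 + 3 * q) - 1" by (simp add: algebra_simps)
  then show "3 * fconst ((2 + 3 * q) * q) = fconst (1 + 3 * q) * fconst (1 + 3 * q) - (1 :: ('g, 'k) free_alg)"
    unfolding n o by (simp only: fconst_mult[symmetric] m)
  have "27 * (p * p) = 27 * (q ^ 2 + q ^ 3)" using pq by (simp add: power2_eq_square)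
  also have "\<dots> = (1 + 3 * q) * (1 + 3 * q) * (1 + 3 * q) - 3 * (1 + 3 * q) + 2"
    by (simp add: algebra_simps power2_eq_square power3_eq_cube)
  finally show "27 * (fconst p * fconst p) = fconst (1 + 3 * q) * fconst (1 + 3 * q) * fconst (1 + 3 * q)
    - 3 * fconst (1 + 3 * q) + (2 :: ('g, 'k) free_alg)"
    unfolding n by (simp only: fconst_mult[symmetric] m fconst_add[symmetric])
qed

definition sub_gen :: "gen \<Rightarrow> (gen, 'k) free_alg" where
  "sub_gen g = (if g = Gx then 3 * fvar Gx + 1 - fconst (1 + 3 * q) * fvar Ga
    else if g = Gy then fvar Gy - fconst p * fvar Gb else fvar g)"

definition sub :: "(gen, 'k) free_alg \<Rightarrow> (gen, 'k) free_alg" where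
  "sub = free_eval free_algebra sub_gen"

lemma sub_hom: "sub \<in> algebra_homs kk free_algebra free_algebra"
  unfolding sub_def
  by (rule k_algebra.free_eval_hom) (simp_all add: k_algebra_def free_algebra_associative)

lemma sub_ring_map: "ring_map sub"
  using algebra_hom_ring_map sub_hom unfolding free_algebra_def by blast

lemma sub_var: "sub (fvar g) = sub_gen g"
  unfolding sub_def
  by (rule k_algebra.free_eval_var) (simp_all add: k_algebra_def free_algebra_associative)

lemma sub_const: "sub (fconst c) = fconst c"
  using algebra_homsD(5)[OF sub_hom, of c 1] algebra_homsD(6)[OF sub_hom] by simp

lemma shifted_in_nodal:
  "r \<in> shifted_set (fvar Gx) (fvar Gy) (fvar Ga) (fvar Gainv) (fvar Gb) \<Longrightarrow> sub r \<in> I"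
proof -
  interpret F: shift "fconst (1 + 3 * q)" "fconst p" "fvar Gx" "fvar Gy" "fvar Ga" "fvar Gb"
    "3 * fvar Gx + 1 - fconst (1 + 3 * q) * fvar Ga" "fvar Gy - fconst p * fvar Gb :: (gen, 'k) free_alg"
    by unfold_locales (simp_all add: fconst_commute)
  have "shifted_set (3 * fvar Gx + 1 - fconst (1 + 3 * q) * fvar Ga) (fvar Gy - fconst p * fvar Gb)
      (fvar Ga) (fvar Gainv) (fvar Gb) \<subseteq> I"
    using F.nodal_imp_shifted[OF ideal_two_sided[OF FA.ideal_axioms]
        nodal_ideal_gens[unfolded nodal_relations_eq] fconst_shift] .
  moreover have "sub ` shifted_set (fvar Gx) (fvar Gy) (fvar Ga) (fvar Gainv) (fvar Gb) =
      shifted_set (3 * fvar Gx + 1 - fconst (1 + 3 * q) * fvar Ga) (fvar Gy - fconst p * fvar Gb)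
      (fvar Ga) (fvar Gainv) (fvar Gb)"
    unfolding ring_map_shifted_set[OF sub_ring_map] sub_var by (simp add: sub_gen_def)
  ultimately show "r \<in> shifted_set (fvar Gx) (fvar Gy) (fvar Ga) (fvar Gainv) (fvar Gb) \<Longrightarrow> sub r \<in> I"
    by blast
qed

lemma pr_zero: "f \<in> I \<Longrightarrow> pr f = \<zero>\<^bsub>A\<^esub>"
  using FA.\<pi>_eq_iff[of f 0] FA.zero_Q by (simp add: Q_eq)

definition j :: "'k shifted_alg \<Rightarrow> (gen, 'k) free_alg set" where
  "j = (SOME g. g \<in> algebra_homs kk NA A \<and> (\<forall>f. g (cl f) = pr (sub f)))"

lemma j: "j \<in> algebra_homs kk NA A" "j (cl f) = pr (sub f)"
proof -
  let ?v = "\<lambda>g. pr (sub_gen g)"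
  have v: "?v g \<in> carrier A" for g using FA.\<pi>_closed by (simp add: Q_eq)
  have ps: "(\<lambda>f. pr (sub f)) \<in> algebra_homs kk free_algebra A"
    by (rule algebra_homs_comp[OF sub_hom pr_hom])
  have e: "free_eval A ?v f = pr (sub f)" for f
    by (rule free_algebra_hom_unique[OF A.free_eval_hom[OF v] ps])
      (simp only: A.free_eval_var[OF v] sub_var)
  obtain g where "g \<in> algebra_homs kk NA A" "\<And>f. g (cl f) = free_eval A ?v f"
  proof (rule NA_hom_exists[of A ?v])
    show "free_eval A ?v r = \<zero>\<^bsub>A\<^esub>"
      if "r \<in> shifted_set (fvar Gx) (fvar Gy) (fvar Ga) (fvar Gainv) (fvar Gb)" for r
      unfolding e by (rule pr_zero[OF shifted_in_nodal[OF that]])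
  qed (use v A.k_algebra_axioms in blast)+
  then have "\<exists>g. g \<in> algebra_homs kk NA A \<and> (\<forall>f. g (cl f) = pr (sub f))" using e by auto
  from someI_ex[OF this] show "j \<in> algebra_homs kk NA A" "j (cl f) = pr (sub f)"
    unfolding j_def by blast+
qed

definition "nx = cl (fconst (1 / 3)) * (nu - 1 + cl (fconst (1 + 3 * q)) * na)"
definition "ny = nz + cl (fconst p) * nb"

definition inv_gen :: "gen \<Rightarrow> 'k shifted_alg" where
  "inv_gen g = (if g = Gx then nx else if g = Gy then ny else cl (fvar g))"

lemma third: "cl (fconst (1 / 3)) * (3 * f) = f" "3 * (cl (fconst (1 / 3)) * f) = f" for f :: "'k shifted_alg"
proof -
  have "cl (fconst (1 / 3)) * cl 3 = (cl (fconst (1 / 3 * 3)) :: 'k shifted_alg)"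
    by (simp only: fconst_numeral[symmetric] fconst_mult[symmetric] flip: ring_mapD[OF cl_ring_map])
  then have 1: "cl (fconst (1 / 3)) * 3 = (1 :: 'k shifted_alg)"
    by (simp add: ring_mapD[OF cl_ring_map])
  then show "cl (fconst (1 / 3)) * (3 * f) = f" by (simp add: mult.assoc[symmetric])
  have "3 * cl (fconst (1 / 3)) = (1 :: 'k shifted_alg)" using 1 by (simp add: numeral_commute)
  then show "3 * (cl (fconst (1 / 3)) * f) = f" by (simp add: mult.assoc[symmetric])
qed

lemma nu_eq: "nu = 3 * nx + 1 - cl (fconst (1 + 3 * q)) * na" and nz_eq: "nz = ny - cl (fconst p) * nb"
  by (simp_all add: nx_def ny_def third)

lemma nodal_set_nx: "nodal_set (cl (fconst (1 + 3 * q))) (cl (fconst p)) (cl (fconst ((2 + 3 * q) * q)))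
    nx ny na na' nb \<subseteq> {0}"
proof -
  interpret F: shift "cl (fconst (1 + 3 * q))" "cl (fconst p)" nx ny na nb nu nz
    by unfold_locales (simp_all add: scalar_central nu_eq[symmetric] nz_eq[symmetric])
  have E: "3 * cl (fconst ((2 + 3 * q) * q)) = cl (fconst (1 + 3 * q)) * cl (fconst (1 + 3 * q)) - 1"
    using arg_cong[OF fconst_shift(1), of cl] by (simp add: ring_mapD[OF cl_ring_map])
  have PC: "27 * (cl (fconst p) * cl (fconst p)) =
      cl (fconst (1 + 3 * q)) * cl (fconst (1 + 3 * q)) * cl (fconst (1 + 3 * q)) - 3 * cl (fconst (1 + 3 * q)) + 2"
    using arg_cong[OF fconst_shift(2), of cl] by (simp add: ring_mapD[OF cl_ring_map])
  have "f = 0" if "f * cl (fconst (1 + 3 * q)) = cl (fconst (1 + 3 * q)) * f" "3 * f = 0" for f :: "'k shifted_alg"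
    using third(1)[of f] that by simp
  from F.shifted_imp_nodal[OF NA.relations this E PC] show ?thesis .
qed

lemma inverse_exists:
  obtains i where "i \<in> algebra_homs kk A NA" "\<And>g. i (nodal_gen q p g) = inv_gen g"
proof -
  interpret N: k_algebra "NA :: ('k, 'k shifted_alg) module"
    by (rule k_algebra_of_type[OF NA_associative])
  have h: "free_eval NA inv_gen \<in> algebra_homs kk free_algebra NA" by (rule N.free_eval_hom) simp
  have var: "free_eval NA inv_gen (fvar g) = inv_gen g" for g by (rule N.free_eval_var) simp
  note R = algebra_hom_ring_map[OF h]
  have const: "free_eval NA inv_gen (fconst c) = cl (fconst c)" for c
    using algebra_hom_const[OF h, of c] by (simp add: scale_def)
  have "free_eval NA inv_gen ` nodal_relations q p \<subseteq> {0}"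
    unfolding nodal_relations_eq ring_map_nodal_set[OF R] var const
    using nodal_set_nx by (simp add: inv_gen_def)
  then have "I \<subseteq> {r. free_eval NA inv_gen r = \<zero>\<^bsub>NA\<^esub>}"
    unfolding nodal_ideal_def
    by (intro genideal_free_minimal kernel_ideal[OF NA_associative h]) auto
  then have 0: "free_eval NA inv_gen r = \<zero>\<^bsub>NA\<^esub>" if "r \<in> I" for r using that by blast
  obtain i where i: "i \<in> algebra_homs kk FA.Q NA" "\<And>f. i (pr f) = free_eval NA inv_gen f"
    by (rule FA.factor_hom[OF h NA_associative 0]) auto
  show thesis
    using that[of i] i(1) i(2)[of "fvar _"] by (simp add: Q_eq pr_gen var)
qed

lemma j_gens: "j nx = gx" "j ny = gy" "j na = ga" "j na' = ga'" "j nb = gb"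
proof -
  have "nx = cl (fconst (1 / 3) * (fvar Gx - 1 + fconst (1 + 3 * q) * fvar Ga))"
    by (simp add: nx_def ring_mapD[OF cl_ring_map])
  moreover have "sub (fconst (1 / 3) * (fvar Gx - 1 + fconst (1 + 3 * q) * fvar Ga)) = fconst (1 / 3) * (3 * fvar Gx)"
    by (simp add: ring_mapD[OF sub_ring_map] sub_var sub_gen_def sub_const)
  moreover have "fconst (1 / 3) * (3 * fvar Gx) = (fvar Gx :: (gen, 'k) free_alg)"
  proof -
    have "fconst (1 / 3) * (3 * fvar Gx) = fconst (1 / 3 * 3) * (fvar Gx :: (gen, 'k) free_alg)"
      by (simp only: fconst_mult fconst_numeral mult.assoc)
    then show ?thesis by simp
  qed
  ultimately show "j nx = gx" by (simp add: j(2) pr_gen)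
  have "ny = cl (fvar Gy + fconst p * fvar Gb)"
    by (simp add: ny_def ring_mapD[OF cl_ring_map])
  moreover have "sub (fvar Gy + fconst p * fvar Gb) = fvar Gy"
    by (simp add: ring_mapD[OF sub_ring_map] sub_var sub_gen_def sub_const)
  ultimately show "j ny = gy" by (simp add: j(2) pr_gen)
  show "j na = ga" "j na' = ga'" "j nb = gb"
    by (simp_all add: j(2) pr_gen sub_var sub_gen_def)
qed

lemma j_bij: "bij_betw j UNIV (carrier A)"
proof -
  obtain i where i: "i \<in> algebra_homs kk A NA" "\<And>g. i (nodal_gen q p g) = inv_gen g"
    using inverse_exists by metis
  have j_inv_gen: "j (inv_gen g) = nodal_gen q p g" for g
    by (cases g) (simp_all add: inv_gen_def j_gens)
  have "j (i (pr f)) = pr f" for f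
    by (rule free_algebra_hom_unique[OF algebra_homs_comp[OF algebra_homs_comp[OF pr_hom i(1)] j(1)] pr_hom])
      (simp add: pr_gen i j_inv_gen)
  then have ji: "j (i z) = z" if "z \<in> carrier A" for z
    using that FA.carrier_Q by (auto simp: Q_eq)
  have id: "(\<lambda>r. r) \<in> algebra_homs kk NA NA"
    by (intro algebra_homsI module_homsI) simp_all
  have jc: "j r \<in> carrier A" for r using algebra_homsD(2)[OF j(1), of r] by simp
  have gen: "i (j (cl (fvar g))) = cl (fvar g)" for g
  proof (cases g)
    case Gx
    have "nu = 3 * nx + 1 - cl (fconst (1 + 3 * q)) * na" by (rule nu_eq)
    have "i (j (3 * nx + 1 - cl (fconst (1 + 3 * q)) * na)) = 3 * nx + 1 - cl (fconst (1 + 3 * q)) * na"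
    proof -
      have h: "(\<lambda>f. i (j (cl f))) \<in> algebra_homs kk free_algebra NA"
        by (rule algebra_homs_comp[OF algebra_homs_comp[OF cl_hom j(1)] i(1)])
      have R: "ring_map (\<lambda>r. i (j r))"
        unfolding ring_map_def
        using algebra_homsD[OF algebra_homs_comp[OF j(1) i(1)]] by simp
      have c: "i (j (cl (fconst c))) = cl (fconst c)" for c
        using algebra_hom_const[OF h, of c] by (simp add: scale_def)
      show ?thesis
        by (simp add: ring_mapD[OF R] c j_gens i inv_gen_def)
    qed
    then show ?thesis using Gx nu_eq by simp
  next
    case Gy
    have "i (j (ny - cl (fconst p) * nb)) = ny - cl (fconst p) * nb"
    proof -
      have h: "(\<lambda>f. i (j (cl f))) \<in> algebra_homs kk free_algebra NA"
        by (rule algebra_homs_comp[OF algebra_homs_comp[OF cl_hom j(1)] i(1)])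
      have R: "ring_map (\<lambda>r. i (j r))"
        unfolding ring_map_def
        using algebra_homsD[OF algebra_homs_comp[OF j(1) i(1)]] by simp
      have c: "i (j (cl (fconst c))) = cl (fconst c)" for c
        using algebra_hom_const[OF h, of c] by (simp add: scale_def)
      show ?thesis
        by (simp add: ring_mapD[OF R] c j_gens i inv_gen_def)
    qed
    then show ?thesis using Gy nz_eq by simp
  qed (simp_all add: j_gens i inv_gen_def)
  have ij: "i (j r) = r" for r
    by (rule NA_hom_unique[OF algebra_homs_comp[OF j(1) i(1)] id]) (rule gen)
  show ?thesis
    by (rule bij_betw_byWitness[where f' = i]) (use ij ji jc in auto)
qed

lemma j_simps: "j r \<in> carrier A" "j (r + s) = j r \<oplus>\<^bsub>A\<^esub> j s" "j (r * s) = j r \<otimes>\<^bsub>A\<^esub> j s"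
  "j 1 = \<one>\<^bsub>A\<^esub>" "j (cl (fconst c) * r) = c \<odot>\<^bsub>A\<^esub> j r" "j 0 = \<zero>\<^bsub>A\<^esub>" "j (r - s) = j r \<ominus>\<^bsub>A\<^esub> j s"
proof -
  note D = algebra_homsD[OF j(1), simplified]
  show 1: "j r \<in> carrier A" "j (r + s) = j r \<oplus>\<^bsub>A\<^esub> j s" "j (r * s) = j r \<otimes>\<^bsub>A\<^esub> j s"
    "j 1 = \<one>\<^bsub>A\<^esub>" "j (cl (fconst c) * r) = c \<odot>\<^bsub>A\<^esub> j r" for r s
    using D(5)[of c r] by (simp_all add: D scale_def)
  show "j 0 = \<zero>\<^bsub>A\<^esub>" using 1(2)[of 0 0] 1(1)[of 0] by (metis A.M.add.l_cancel_one' add_0)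
  have "j (r - s) \<oplus>\<^bsub>A\<^esub> j s = j r" using 1(2)[of "r - s" s] by simp
  then show "j (r - s) = j r \<ominus>\<^bsub>A\<^esub> j s"
    using 1(1)[of "r - s"] 1(1)[of s] by (simp add: a_minus_def A.a_assoc A.r_neg flip: \<open>_ = j r\<close>)
qed

lemma carrier_A: "carrier A = range j"
  using j_bij by (simp add: bij_betw_def)

lemma j_eq_iff: "j r = j s \<longleftrightarrow> r = s"
  using j_bij by (auto simp: bij_betw_def inj_def)

end

section \<open>A representation by linear operators\<close>

text \<open>The representation space consists of the functions on an index set with values in \<open>k[T]\<close>.
  Only \<open>k\<close>-linearity is imposed, since multiplication by \<open>T\<close> does not commute with the action of \<open>A\<close>.\<close>

typedef (overloaded) ('i, 'k) lop = "{f :: ('i \<Rightarrow> 'k::field poly) \<Rightarrow> 'i \<Rightarrow> 'k poly.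
    (\<forall>G H. f (\<lambda>m. G m + H m) = (\<lambda>m. f G m + f H m)) \<and>
    (\<forall>c G. f (\<lambda>m. Polynomial.smult c (G m)) = (\<lambda>m. Polynomial.smult c (f G m)))}"
  morphisms ap Abs_lop
  by (rule exI[of _ "\<lambda>G. G"]) simp

setup_lifting type_definition_lop

lemma ap_add: "ap T (\<lambda>m. G m + H m) = (\<lambda>m. ap T G m + ap T H m)"
  and ap_const: "ap T (\<lambda>m. Polynomial.smult c (G m)) = (\<lambda>m. Polynomial.smult c (ap T G m))"
  using ap[of T] by auto

lemma lop_eqI: "(\<And>G m. ap T G m = ap T' G m) \<Longrightarrow> T = T'"
  by (simp add: ap_inject[symmetric] fun_eq_iff)

instantiation lop :: (type, field) ring_1
begin

lift_definition zero_lop :: "('a, 'b) lop" is "\<lambda>G m. 0" by simp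
lift_definition one_lop :: "('a, 'b) lop" is "\<lambda>G. G" by simp
lift_definition plus_lop :: "('a, 'b) lop \<Rightarrow> ('a, 'b) lop \<Rightarrow> ('a, 'b) lop" is "\<lambda>f g G m. f G m + g G m"
  by (auto simp: algebra_simps smult_add_right smult_diff_right)
lift_definition minus_lop :: "('a, 'b) lop \<Rightarrow> ('a, 'b) lop \<Rightarrow> ('a, 'b) lop" is "\<lambda>f g G m. f G m - g G m"
  by (auto simp: algebra_simps smult_add_right smult_diff_right)
lift_definition uminus_lop :: "('a, 'b) lop \<Rightarrow> ('a, 'b) lop" is "\<lambda>f G m. - f G m"
  by (auto simp: algebra_simps smult_add_right smult_diff_right)
lift_definition times_lop :: "('a, 'b) lop \<Rightarrow> ('a, 'b) lop \<Rightarrow> ('a, 'b) lop" is "\<lambda>f g G. f (g G)"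
  by simp

instance
proof
  fix x y z :: "('a, 'b) lop"
  show "x + y + z = x + (y + z)" "x + y = y + x" "0 + x = x" "- x + x = 0" "x - y = x + - y"
    "x * y * z = x * (y * z)" "1 * x = x" "x * 1 = x" "(x + y) * z = x * z + y * z"
    by (rule lop_eqI; simp add: plus_lop.rep_eq zero_lop.rep_eq uminus_lop.rep_eq minus_lop.rep_eq
        times_lop.rep_eq one_lop.rep_eq algebra_simps)+
  show "x * (y + z) = x * y + x * z"
    by (rule lop_eqI) (simp add: plus_lop.rep_eq times_lop.rep_eq ap_add)
  show "(0 :: ('a, 'b) lop) \<noteq> 1"
  proof
    assume "(0 :: ('a, 'b) lop) = 1"
    then have "ap (0 :: ('a, 'b) lop) (\<lambda>_. 1) undefined = ap 1 (\<lambda>_. 1) undefined" by simp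
    then show False by (simp add: zero_lop.rep_eq one_lop.rep_eq)
  qed
qed

end

lemma ap_simps: "ap 0 G m = 0" "ap 1 G m = G m" "ap (S + T) G m = ap S G m + ap T G m"
  "ap (S - T) G m = ap S G m - ap T G m" "ap (- T) G m = - ap T G m" "ap (S * T) G = ap S (ap T G)"
  by (simp_all add: zero_lop.rep_eq one_lop.rep_eq plus_lop.rep_eq minus_lop.rep_eq uminus_lop.rep_eq times_lop.rep_eq)

lemma ap_numeral: "ap (numeral n) G m = numeral n * G m"
proof -
  have "ap (of_nat n) G m = of_nat n * G m" for n
    by (induction n) (simp_all add: ap_simps algebra_simps)
  from this[of "numeral n"] show ?thesis by simp
qed

lift_definition lconst :: "'k::field \<Rightarrow> ('i, 'k) lop" is "\<lambda>c G m. Polynomial.smult c (G m)"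
  by (auto simp: algebra_simps smult_add_right smult_diff_right)

lemma lconst: "ap (lconst c) G m = Polynomial.smult c (G m)"
  by (simp add: lconst.rep_eq)

lemma lconst_commute: "T * lconst c = lconst c * T"
  by (rule lop_eqI) (simp add: ap_simps lconst lconst.rep_eq[of c] ap_const)

lemma lop_associative: "associative_algebra ring_of_type_algebra
    (algebra_of_type (\<lambda>c (T :: ('i, 'k::field) lop). lconst c * T))"
proof (rule associative_algebra_of_type)
  fix c d and S T :: "('i, 'k) lop"
  show "S * (lconst c * T) = lconst c * (S * T)" by (rule commute_left[OF lconst_commute])
  have "lconst (c + d) = (lconst c + lconst d :: ('i, 'k) lop)" "lconst (c * d) = (lconst c * lconst d :: ('i, 'k) lop)"
    "lconst 1 = (1 :: ('i, 'k) lop)"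
    by (rule lop_eqI; simp add: ap_simps lconst lconst.rep_eq smult_add_left)+
  then show "lconst (c + d) * T = lconst c * T + lconst d * T" "lconst (c * d) * T = lconst c * (lconst d * T)"
    "lconst 1 * T = T"
    by (simp_all add: algebra_simps)
qed (simp_all add: algebra_simps)

text \<open>The element \<open>u\<^sup>3 - 3 u\<close> commutes with \<open>a\<close>.\<close>

lemma cubic_commute:
  fixes u a :: "'r::ring_1"
  assumes U: "a * a * u + a * u * a + u * a * a = 0"
    and V: "a * u * u + u * a * u + u * u * a = 3 * (a - a * a * a)"
  shows "a * (u * u * u - 3 * u) = (u * u * u - 3 * u) * a"
proof -
  have "a * (a * a * u + a * u * a + u * a * a) = (a * a * u + a * u * a + u * a * a) * a"
    by (simp only: U) simp
  then have c: "a * (a * (a * u)) = u * (a * (a * a))" by (simp add: algebra_simps)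
  have "a * (u * u * u) - u * u * u * a = (a * u * u + u * a * u + u * u * a) * u - u * (a * u * u + u * a * u + u * u * a)"
    by (simp add: algebra_simps)
  also have "\<dots> = 3 * (a * u) - 3 * (u * a)"
    unfolding V by (simp add: algebra_simps c numeral_left_commute[of u])
  finally show ?thesis by (simp add: algebra_simps numeral_commute[of a] numeral_left_commute[of a])
qed

text \<open>The action describes right multiplication on the conjectured basis in dual form: an
  element \<open>r\<close> sends \<open>G\<close> to the function whose value at \<open>m\<close> is obtained by expanding \<open>e\<^sub>m r\<close> in the basis
  elements \<open>e\<^sub>n\<close> and replacing each \<open>e\<^sub>n\<close> by \<open>G n\<close>. Thus products act in the order in which they are written.\<close>

locale nodal_representation =
  fixes q p w :: "'k::field_char_0"
  assumes pq: "p ^ 2 = q ^ 2 + q ^ 3" and w: "w * w + w + 1 = 0"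
begin

declare [[simproc del: ring_eq_cancel_factor ring_eq_cancel_numeral_factor inteq_cancel_numerals]]

definition "W = [:w:]"
definition "cc = [:1 + 3 * q:]"
definition "pp = [:p:]"
definition "TT = ([:0, 1:] :: 'k poly)"
definition "TX = TT * TT - 1"
definition "TY = TT * TT * TT - TT"

lemma WW: "W * W = - W - 1"
proof -
  have "W * W + W + 1 = [:w * w + w + 1:]" by (simp add: W_def one_pCons)
  then have h: "W * W + W + 1 = 0" using w by simp
  have "W * W = (W * W + W + 1) - W - 1" by simp
  also have "\<dots> = - W - 1" unfolding h by simp
  finally show ?thesis .
qed

lemma TX_TY: "TY * TY = TX * TX + TX * TX * TX"
  unfolding TX_def TY_def by Groebner_Basis.algebra

text \<open>\<open>wp l\<close> is \<open>w ^ l\<close> for an integer \<open>l\<close>; \<open>gm l\<close> is the coefficient of \<open>v a\<^sup>l\<close> in \<open>a\<^sup>l u\<close>.\<close>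

definition wp :: "int \<Rightarrow> 'k poly" where
  "wp l = (if l mod 3 = 0 then 1 else if l mod 3 = 1 then W else W * W)"

definition gm :: "int \<Rightarrow> 'k poly" where
  "gm l = (if l mod 3 = 0 then 0 else if l mod 3 = 1 then 1 else - 1)"

lemma mod3: obtains "l mod 3 = (0::int)" | "l mod 3 = (1::int)" | "l mod 3 = (2::int)"
proof -
  have "0 \<le> l mod 3" "l mod 3 < 3" by simp_all
  then have "l mod 3 = 0 \<or> l mod 3 = 1 \<or> l mod 3 = 2" by linarith
  then show thesis by (elim disjE) (rule that, assumption)+
qed

lemma wp_gm:
  "wp 0 = 1" "gm 0 = 0" "wp (l + 1) = W * wp l" "wp (l + 2) = W * W * wp l" "wp (l + 3) = wp l" "gm (l + 3) = gm l"
  "wp l * (wp l * wp l) = 1" "gm (l + 1) = wp l * wp l + W * gm l"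
  "gm l - W * gm l = W * W * (wp l - wp l * wp l)"
proof -
  show "wp 0 = 1" "gm 0 = 0" "wp (l + 3) = wp l" "gm (l + 3) = gm l"
    by (simp_all add: wp_def gm_def)
  have m0: "(l + 1) mod 3 = 1" "(l + 2) mod 3 = 2" if "l mod 3 = 0" using that by presburger+
  have m1: "(l + 1) mod 3 = 2" "(l + 2) mod 3 = 0" if "l mod 3 = 1" using that by presburger+
  have m2: "(l + 1) mod 3 = 0" "(l + 2) mod 3 = 1" if "l mod 3 = 2" using that by presburger+
  have "wp (l + 1) = W * wp l \<and> wp (l + 2) = W * W * wp l \<and> wp l * (wp l * wp l) = 1 \<and>
    gm (l + 1) = wp l * wp l + W * gm l \<and> gm l - W * gm l = W * W * (wp l - wp l * wp l)"
  proof (cases l rule: mod3)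
    case 1
    then have v: "wp l = 1" "wp (l + 1) = W" "wp (l + 2) = W * W" "gm l = 0" "gm (l + 1) = 1"
      by (simp_all add: wp_def gm_def m0)
    show ?thesis unfolding v by (intro conjI; ((simp; fail) | use WW in Groebner_Basis.algebra))
  next
    case 2
    then have v: "wp l = W" "wp (l + 1) = W * W" "wp (l + 2) = 1" "gm l = 1" "gm (l + 1) = - 1"
      by (simp_all add: wp_def gm_def m1)
    show ?thesis unfolding v by (intro conjI; ((simp; fail) | use WW in Groebner_Basis.algebra))
  next
    case 3
    then have v: "wp l = W * W" "wp (l + 1) = 1" "wp (l + 2) = W" "gm l = - 1" "gm (l + 1) = 0"
      by (simp_all add: wp_def gm_def m2)
    show ?thesis unfolding v by (intro conjI; ((simp; fail) | use WW in Groebner_Basis.algebra))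
  qed
  then show "wp (l + 1) = W * wp l" "wp (l + 2) = W * W * wp l" "wp l * (wp l * wp l) = 1"
    "gm (l + 1) = wp l * wp l + W * gm l" "gm l - W * gm l = W * W * (wp l - wp l * wp l)"
    by blast+
qed

text \<open>The coefficients that arise when \<open>u\<close> is moved to the left through \<open>v\<^sup>i\<close> by the rule for \<open>v u\<close>.\<close>

fun eta al be :: "nat \<Rightarrow> 'k poly" where
  "eta 0 = 0" | "eta (Suc n) = W * eta n - W * W" |
  "al 0 = 0" | "al (Suc n) = W * al n + 3 * (W * W)" |
  "be 0 = 0" | "be (Suc n) = W * W * be n - 3 * (W * W)"

lift_definition opa :: "(nat \<times> int \<times> bool, 'k) lop" is "\<lambda>G (i, l, f). G (i, l + 1, f)"
  by (auto simp: algebra_simps fun_eq_iff smult_add_right smult_diff_right)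
lift_definition opa' :: "(nat \<times> int \<times> bool, 'k) lop" is "\<lambda>G (i, l, f). G (i, l - 1, f)"
  by (auto simp: algebra_simps fun_eq_iff smult_add_right smult_diff_right)
lift_definition opb :: "(nat \<times> int \<times> bool, 'k) lop" is
  "\<lambda>G (i, l, f). if f then G (i, l + 3, False) else G (i, l, True)"
  by (auto simp: algebra_simps fun_eq_iff smult_add_right smult_diff_right)
lift_definition opz :: "(nat \<times> int \<times> bool, 'k) lop" is
  "\<lambda>G (i, l, f). if f then - (TY * G (i, l, True)) + pp * G (i, l + 3, False)
    else TY * G (i, l, False) - pp * G (i, l, True)"
  by (auto simp: algebra_simps fun_eq_iff smult_add_right smult_diff_right)
lift_definition opv :: "(nat \<times> int \<times> bool, 'k) lop" is
  "\<lambda>G (i, l, f). wp l * wp l * G (Suc i, l, f)"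
  by (auto simp: algebra_simps fun_eq_iff smult_add_right smult_diff_right)
lift_definition opu :: "(nat \<times> int \<times> bool, 'k) lop" is
  "\<lambda>G (i, l, f). wp l * (W ^ i * ((3 * TX + 1) * G (i, l, f) - cc * (W ^ i * W ^ i) * G (i, l + 1, f))
      + eta i * G (Suc i, l, f) + al i * G (i - 1, l, f) + be i * G (i - 1, l + 2, f))
    + gm l * G (Suc i, l, f)"
  by (auto simp: algebra_simps fun_eq_iff smult_add_right smult_diff_right)

lemmas op_eqs = opa.rep_eq opa'.rep_eq opb.rep_eq opz.rep_eq opv.rep_eq opu.rep_eq

lemma ap_lconst: "ap (lconst w) G m = W * G m" "ap (lconst (1 + 3 * q)) G m = cc * G m" "ap (lconst p) G m = pp * G m"
  by (simp_all add: lconst W_def cc_def pp_def)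

lemma op_rels1: "opa * opa' = 1" "opa' * opa = 1" "opb * opb = opa * opa * opa" "opb * opa = opa * opb"
  "opz * opa = opa * opz" "opb * opz = - (opz * opb)"
  by (rule lop_eqI, clarsimp simp: ap_simps op_eqs algebra_simps)+

lemma op_rels2: "opb * opu = opu * opb" "opz * opu = opu * opz"
  by (rule lop_eqI, clarsimp simp: ap_simps op_eqs wp_gm(5,6) algebra_simps)+

lemma op_au: "opa * opu = (opv + lconst w * opu) * opa"
  by (rule lop_eqI) (clarsimp simp: ap_simps ap_lconst op_eqs wp_gm(3,8) algebra_simps)

lemma op_av: "opa * opv = lconst w * lconst w * opv * opa"
  by (rule lop_eqI) (clarsimp simp: ap_simps ap_lconst op_eqs wp_gm(3) algebra_simps)

lemma op_vu: "opv * opu = lconst w * opu * opv - lconst w * lconst w * opv * opv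
    + 3 * (lconst w * lconst w) * (1 - opa * opa)"
proof (rule lop_eqI)
  fix G :: "nat \<times> int \<times> bool \<Rightarrow> 'k poly" and m :: "nat \<times> int \<times> bool"
  obtain i l f where m: "m = (i, l, f)" by (cases m)
  define s where "s = wp l"
  have s3: "s * (s * s) = 1" "s * (s * (s * h)) = h" for h
    using wp_gm(7)[of l] by (simp_all add: s_def mult.assoc[symmetric])
  have W3: "W * (W * W) = 1" "W * (W * (W * h)) = h" for h
  proof -
    show 1: "W * (W * W) = 1" by (simp add: WW algebra_simps)
    then show "W * (W * (W * h)) = h" by (simp add: mult.assoc[symmetric])
  qed
  define P Q0 Q1 Q2 R0 R2 where "P = G (Suc i, l, f)" and "Q0 = gm l" and "Q1 = G (Suc i, l + 1, f)"
    and "Q2 = G (Suc (Suc i), l, f)" and "R0 = G (i, l, f)" and "R2 = G (i, l + 2, f)"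
  note defs = P_def[symmetric] Q1_def[symmetric] Q2_def[symmetric] R0_def[symmetric] R2_def[symmetric] Q0_def[symmetric]
  define X0 X2 where "X0 = G (Suc (i - Suc 0), l, f)" and "X2 = G (Suc (i - Suc 0), l + 2, f)"
  have al0: "al i = 0 \<and> be i = 0 \<or> X0 = R0 \<and> X2 = R2"
    by (cases i) (simp_all add: X0_def X2_def R0_def R2_def)
  have "ap (opv * opu) G m = s * s * (s * (W * W ^ i * ((3 * TX + 1) * P - cc * (W * W ^ i * (W * W ^ i)) * Q1)
      + (W * eta i - W * W) * Q2 + (W * al i + 3 * (W * W)) * R0 + (W * W * be i - 3 * (W * W)) * R2) + Q0 * Q2)"
    by (simp add: m ap_simps op_eqs s_def[symmetric] defs)
  also have "\<dots> = W * (s * (W ^ i * ((3 * TX + 1) * (s * s * P) - cc * (W ^ i * W ^ i) * ((W * s) * (W * s) * Q1))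
      + eta i * (s * s * Q2)) + s * (s * s * (al i * R0)) + s * ((W * W * s) * (W * W * s) * (be i * R2)) + Q0 * (s * s * Q2))
      - W * W * (s * s * (s * s * Q2)) + 3 * (W * W) * (R0 - R2)
      + s * s * Q2 * ((Q0 - W * Q0) - W * W * (s - s * s))"
    by (simp add: algebra_simps s3 W3)
  also have "(Q0 - W * Q0) - W * W * (s - s * s) = 0"
    using wp_gm(9)[of l] by (simp add: Q0_def s_def)
  also have "W * (s * (W ^ i * ((3 * TX + 1) * (s * s * P) - cc * (W ^ i * W ^ i) * ((W * s) * (W * s) * Q1))
      + eta i * (s * s * Q2)) + s * (s * s * (al i * R0)) + s * ((W * W * s) * (W * W * s) * (be i * R2)) + Q0 * (s * s * Q2))
      - W * W * (s * s * (s * s * Q2)) + 3 * (W * W) * (R0 - R2) + s * s * Q2 * 0 =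
      ap (lconst w * opu * opv - lconst w * lconst w * opv * opv + 3 * (lconst w * lconst w) * (1 - opa * opa)) G m"
    by (simp add: m ap_simps ap_lconst ap_numeral op_eqs wp_gm(3,4) s_def[symmetric] defs X0_def[symmetric] X2_def[symmetric];
      rule disjE[OF al0]; simp add: algebra_simps s3 W3 R2_def)
  finally show "ap (opv * opu) G m = ap (lconst w * opu * opv - lconst w * lconst w * opv * opv
    + 3 * (lconst w * lconst w) * (1 - opa * opa)) G m" .
qed

lemma lconst_w: "lconst w * lconst w + lconst w + 1 = (0 :: ('i, 'k) lop)"
proof (rule lop_eqI)
  fix G :: "'i \<Rightarrow> 'k poly" and m
  have "W * (W * G m) + W * G m + G m = (W * W + W + 1) * G m" by (simp add: algebra_simps)
  then show "ap (lconst w * lconst w + lconst w + 1) G m = ap 0 G m"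
    by (simp add: ap_simps ap_lconst WW)
qed

lemmas op_UV = eigenvector_converse[OF lconst_w lconst_commute op_au op_av op_vu]

text \<open>The cubic equation is the one relation that is not a straightening rule. Its right-hand side, up to
  a multiple of \<open>a\<^sup>3\<close>, is \<open>(3 x + 1)\<^sup>3 - 3 (3 x + 1)\<close>, which commutes with \<open>a\<close> and \<open>v\<close>. Hence it acts by a scalar
  polynomial everywhere once it does so at the index \<open>(0, 0, f)\<close>.\<close>

lemma op_Z: "27 * (opz * opz) = opu * opu * opu - 3 * opu + 2 - 2 * (opa * opa * opa)"
proof -
  define s where "s = opu * opu * opu - 3 * opu"
  have sa: "opa * s = s * opa" unfolding s_def by (rule cubic_commute[OF op_UV])
  have su: "opu * s = s * opu" by (simp add: s_def algebra_simps numeral_left_commute[of opu])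
  have opv: "opv = opa * opu * opa' - lconst w * opu"
  proof -
    have "opa * opu * opa' = (opv + lconst w * opu) * (opa * opa')" by (simp only: op_au mult.assoc)
    then show ?thesis by (simp add: op_rels1)
  qed
  have sa': "opa' * s = s * opa'"
  proof -
    have "opa' * (opa * s) * opa' = opa' * (s * opa) * opa'" by (simp only: sa)
    then have "(opa' * opa) * (s * opa') = (opa' * s) * (opa * opa')" by (simp only: mult.assoc)
    then show ?thesis by (simp add: op_rels1)
  qed
  have sv: "opv * s = s * opv"
  proof -
    have "opa * opu * opa' * s = opa * (opu * (opa' * s))" by (simp only: mult.assoc)
    also have "\<dots> = opa * (opu * s) * opa'" by (simp only: sa' mult.assoc)
    also have "\<dots> = opa * s * opu * opa'" by (simp only: su mult.assoc)
    also have "\<dots> = s * (opa * opu * opa')" by (simp only: sa mult.assoc)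
    finally have 1: "opa * opu * opa' * s = s * (opa * opu * opa')" .
    have 2: "lconst w * opu * s = s * (lconst w * opu)"
      by (simp only: mult.assoc su) (simp only: commute_left[OF lconst_commute])
    show ?thesis unfolding opv by (simp only: left_diff_distrib right_diff_distrib 1 2)
  qed
  define S where "S = s + lconst (1 + 3 * q) * lconst (1 + 3 * q) * lconst (1 + 3 * q) * (opa * opa * opa)
    - 3 * (lconst (1 + 3 * q) * (opa * opa * opa))"
  define t where "t = opu + lconst (1 + 3 * q) * opa"
  have comm: "opa * S = S * opa" "opa' * S = S * opa'" "opv * S = S * opv"
  proof -
    have c: "T * (lconst c * T') = lconst c * (T * T')" for T T' :: "(nat \<times> int \<times> bool, 'k) lop" and c
      by (rule commute_left[OF lconst_commute])
    have a3: "T * (opa * opa * opa) = (opa * opa * opa) * T" if "T \<in> {opa, opa', opv}" for T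
    proof -
      have "opv * (opa * opa * opa) = opa * opa * opa * opv"
      proof (rule lop_eqI)
        fix G m show "ap (opv * (opa * opa * opa)) G m = ap (opa * opa * opa * opv) G m"
          by (cases m) (simp add: ap_simps op_eqs add.assoc wp_gm(5))
      qed
      moreover have "opa' * (opa * opa * opa) = opa * opa * opa * opa'"
        by (rule lop_eqI) (clarsimp simp: ap_simps op_eqs)
      ultimately show ?thesis using that by (auto simp: mult.assoc)
    qed
    have "T * S = S * T" if T: "T \<in> {opa, opa', opv}" and Ts: "T * s = s * T" for T
      unfolding S_def
      by (simp add: distrib_left distrib_right left_diff_distrib right_diff_distrib Ts mult.assoc c[of T]
          numeral_left_commute[of T] a3[OF T, unfolded mult.assoc])
    then show "opa * S = S * opa" "opa' * S = S * opa'" "opv * S = S * opv" using sa sa' sv by auto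
  qed
  have tS: "t * t * t - 3 * t = S"
  proof -
    define C where "C = (lconst (1 + 3 * q) :: (nat \<times> int \<times> bool, 'k) lop)"
    have c: "T * C = C * T" "T * (C * T') = C * (T * T')" for T T'
      unfolding C_def by (rule lconst_commute, rule commute_left[OF lconst_commute])
    have "t * t * t = opu * opu * opu + C * (opa * opu * opu + opu * opa * opu + opu * opu * opa)
      + C * (C * (opa * opa * opu + opa * opu * opa + opu * opa * opa)) + C * (C * (C * (opa * opa * opa)))"
      unfolding t_def C_def[symmetric] by (simp add: algebra_simps c(1)[of opa] c(1)[of opu] c(2)[of opa] c(2)[of opu])
    also have "\<dots> = opu * opu * opu + C * (3 * (opa - opa * opa * opa)) + C * (C * (C * (opa * opa * opa)))"
      unfolding op_UV by simp
    finally show ?thesis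
      unfolding S_def s_def t_def C_def[symmetric] by (simp add: algebra_simps numeral_left_commute[of C])
  qed
  define \<Sigma> where "\<Sigma> = (3 * TX + 1) * (3 * TX + 1) * (3 * TX + 1) - 3 * (3 * TX + 1)"
  have t0: "ap t G (0, 0, f) = (3 * TX + 1) * G (0, 0, f)" for G f
    by (simp add: t_def ap_simps ap_lconst op_eqs wp_gm)
  have S00: "ap S G (0, 0, f) = \<Sigma> * G (0, 0, f)" for G f
    unfolding tS[symmetric] by (simp add: ap_simps ap_numeral t0 \<Sigma>_def algebra_simps)
  have S0p: "ap S G (0, int n, f) = \<Sigma> * G (0, int n, f)" for G n f
  proof (induction n arbitrary: G)
    case (Suc n)
    have "ap S G (0, int (Suc n), f) = ap (opa * S) G (0, int n, f)" by (simp add: ap_simps op_eqs add.commute)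
    also have "\<dots> = \<Sigma> * ap opa G (0, int n, f)" unfolding comm by (simp add: ap_simps Suc)
    finally show ?case by (simp add: op_eqs add.commute)
  qed (simp add: S00)
  have S0m: "ap S G (0, - int n, f) = \<Sigma> * G (0, - int n, f)" for G n f
  proof (induction n arbitrary: G)
    case (Suc n)
    have e: "- 1 - int n = - int n - 1" by simp
    have "ap S G (0, - int (Suc n), f) = ap (opa' * S) G (0, - int n, f)" by (simp add: ap_simps op_eqs e)
    also have "\<dots> = \<Sigma> * ap opa' G (0, - int n, f)" unfolding comm by (simp add: ap_simps Suc)
    finally show ?case by (simp add: op_eqs e)
  qed (simp add: S00)
  have S0: "ap S G (0, l, f) = \<Sigma> * G (0, l, f)" for G l f
    by (cases l rule: int_cases2) (use S0p S0m in auto)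
  have SG: "ap S G (i, l, f) = \<Sigma> * G (i, l, f)" for G i l f
  proof (induction i arbitrary: G)
    case (Suc i)
    have "wp l * wp l * ap S G (Suc i, l, f) = ap (opv * S) G (i, l, f)" by (simp add: ap_simps op_eqs)
    also have "\<dots> = \<Sigma> * ap opv G (i, l, f)" unfolding comm by (simp add: ap_simps Suc)
    finally have "wp l * (wp l * (wp l * ap S G (Suc i, l, f))) = wp l * (wp l * (wp l * (\<Sigma> * G (Suc i, l, f))))"
      by (simp add: op_eqs algebra_simps)
    then show ?case using wp_gm(7)[of l] by (simp add: mult.assoc[symmetric])
  qed (simp add: S0)
  have zz: "ap (opz * opz) G (i, l, f) = (TX * TX + TX * TX * TX) * G (i, l, f) - pp * pp * G (i, l + 3, f)" for G i l f
  proof -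
    have H: "TY * (TY * h) = TX * (TX * h) + TX * (TX * (TX * h))" for h
    proof -
      have "TY * (TY * h) = (TY * TY) * h" by (simp only: mult.assoc)
      then show ?thesis unfolding TX_TY by (simp only: mult.assoc distrib_right)
    qed
    show ?thesis by (cases f; simp add: ap_simps op_eqs algebra_simps H)
  qed
  define c where "c = 1 + 3 * q"
  have "27 * (p * p) = 27 * (q ^ 2 + q ^ 3)" using pq by (simp add: power2_eq_square)
  also have "\<dots> = c * c * c - 3 * c + 2"
    by (simp add: c_def algebra_simps power2_eq_square power3_eq_cube)
  finally have e: "27 * (p * p) = c * c * c - 3 * c + 2" .
  have "27 * (pp * pp) = [:27 * (p * p):]"
    by (simp add: pp_def numeral_poly algebra_simps)
  moreover have "[:c * c * c - 3 * c + 2:] = cc * cc * cc - 3 * cc + 2"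
    unfolding cc_def c_def[symmetric] by (simp add: numeral_poly algebra_simps)
  ultimately have pc: "27 * (pp * pp) = cc * cc * cc - 3 * cc + 2" by (simp only: e)
  show ?thesis
  proof (rule lop_eqI)
    fix G :: "nat \<times> int \<times> bool \<Rightarrow> 'k poly" and m :: "nat \<times> int \<times> bool"
    obtain i l f where m: "m = (i, l, f)" by (cases m)
    define g h where "g = G m" and "h = G (i, l + 3, f)"
    have a3: "ap (opa * opa * opa) G m = h" by (simp add: m h_def ap_simps op_eqs add.assoc)
    have 3: "ap (lconst (1 + 3 * q) * lconst (1 + 3 * q) * lconst (1 + 3 * q) * T) G m = cc * (cc * (cc * ap T G m))"
      "ap (3 * (lconst (1 + 3 * q) * T)) G m = 3 * (cc * ap T G m)" for T
      by (simp_all only: ap_simps ap_lconst ap_numeral)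
    have "\<Sigma> * g = ap s G m + cc * (cc * (cc * h)) - 3 * (cc * h)"
      using SG[of G i l f] unfolding S_def ap_simps(3,4) m[symmetric] 3 a3 g_def[symmetric] by simp
    then have "27 * ((TX * TX + TX * TX * TX) * g - pp * pp * h) = ap s G m + 2 * g - 2 * h"
      unfolding \<Sigma>_def using pc by Groebner_Basis.algebra
    moreover have "ap (27 * (opz * opz)) G m = 27 * ((TX * TX + TX * TX * TX) * g - pp * pp * h)"
      using zz[of G i l f] by (simp only: ap_simps(6)[of 27] ap_numeral m g_def h_def)
    moreover have "ap (s + 2 - 2 * (opa * opa * opa)) G m = ap s G m + 2 * g - 2 * h"
      by (simp only: ap_simps(3,4) ap_simps(6)[of 2] ap_numeral a3 g_def)
    ultimately show "ap (27 * (opz * opz)) G m = ap (opu * opu * opu - 3 * opu + 2 - 2 * (opa * opa * opa)) G m"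
      unfolding s_def[symmetric] by (simp only:)
  qed
qed

lemma op_shifted: "shifted_set opu opz opa opa' opb \<subseteq> {0}"
  using op_rels1 op_rels2 op_UV op_Z by (simp add: shifted_set_def)

end

section \<open>Evaluation of polynomials\<close>

text \<open>Evaluation at \<open>x\<close> of a polynomial whose coefficients are mapped by \<open>h\<close>; the values may lie in a
  noncommutative ring.\<close>

definition pev :: "('c::ring_1 \<Rightarrow> 'r::ring_1) \<Rightarrow> 'r \<Rightarrow> 'c poly \<Rightarrow> 'r" where
  "pev h x P = fold_coeffs (\<lambda>c r. h c + r * x) P 0"

lemma pev_0 [simp]: "pev h x 0 = 0"
  by (simp add: pev_def)

lemma pev_pCons:
  assumes "h 0 = 0"
  shows "pev h x (pCons c P) = h c + pev h x P * x"
proof (cases "c = 0 \<and> P = 0")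
  case True
  then show ?thesis using assms by simp
next
  case False
  then show ?thesis by (cases "c = 0") (simp_all add: pev_def)
qed

lemma pev_ring_map:
  fixes h :: "'c::comm_ring_1 \<Rightarrow> 'r::ring_1"
  assumes h: "ring_map h" and x: "\<And>c. x * h c = h c * x"
  shows "ring_map (pev h x)"
proof -
  note H = ring_mapD[OF h] and C = pev_pCons[of h, OF ring_mapD(1)[OF h]]
  have xx: "x * pev h x P = pev h x P * x" for P
    by (induction P) (simp_all add: C distrib_left distrib_right x mult.assoc[symmetric])
  have add: "pev h x (P + Q) = pev h x P + pev h x Q" for P Q
    by (induction P Q rule: poly_induct2) (simp_all add: C H algebra_simps)
  have sm: "pev h x (Polynomial.smult c P) = h c * pev h x P" for c P
  proof (induction P)
    case (pCons a P)
    have "h a * h c = h c * h a" using H(4)[of a c] H(4)[of c a] by (simp add: mult.commute)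
    with pCons show ?case by (simp add: C H algebra_simps)
  qed simp
  have mult: "pev h x (P * Q) = pev h x P * pev h x Q" for P Q
  proof (induction P)
    case (pCons c P)
    then show ?case by (simp add: add sm C H distrib_right mult.assoc xx)
  qed simp
  have "pev h x 1 = 1" unfolding one_pCons by (simp add: C H)
  then show ?thesis by (simp add: ring_map_def add mult)
qed

lemma pev_commute:
  assumes "h 0 = 0" "\<And>c. y * h c = h c * y" "y * x = x * y"
  shows "y * pev h x P = pev h x P * y"
proof (induction P)
  case (pCons c P)
  have "y * (pev h x P * x) = pev h x P * x * y"
    using pCons assms(3) by (metis mult.assoc)
  then show ?case by (simp add: pev_pCons[of h, OF assms(1)] distrib_left distrib_right assms(2))
qed simp

lemma ring_map_comp: "ring_map f \<Longrightarrow> ring_map g \<Longrightarrow> ring_map (\<lambda>r. f (g r))"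
  by (simp add: ring_map_def)

section \<open>The coordinate ring inside the algebra\<close>

definition cubic :: "'k::field poly poly" where
  "cubic = poly_Y ^ 2 - poly_X ^ 2 - poly_X ^ 3"

text \<open>The cubic is monic in \<open>Y\<close>.\<close>

lemma cubic_division:
  fixes P :: "'k::field poly poly"
  obtains Q R0 R1 where "P = cubic * Q + [:R0, R1:]"
proof -
  have "\<exists>Q R0 R1. P = cubic * Q + [:R0, R1:]"
  proof (induction P)
    case 0
    have "0 = cubic * 0 + [:0, 0:]" by simp
    then show ?case by blast
  next
    case (pCons p P)
    then obtain Q R0 R1 where P: "P = cubic * Q + [:R0, R1:]" by blast
    let ?X = "[:0, 1:] :: 'k poly"
    have c: "cubic = [: - (?X * ?X + ?X * ?X * ?X), 0, 1:]"
      by (simp add: cubic_def poly_X_def poly_Y_def power2_eq_square power3_eq_cube)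
    have "pCons p P = [:p:] + [:0, 1:] * P" by simp
    also have "\<dots> = cubic * ([:0, 1:] * Q) + ([:p:] + [:0, 1:] * [:R0, R1:])"
      unfolding P by (simp only: distrib_left mult.left_commute ac_simps)
    also have "[:p:] + [:0, 1:] * [:R0, R1:] = cubic * [:R1:] + [:p + R1 * (?X * ?X + ?X * ?X * ?X), R0:]"
    proof -
      have "cubic * [:R1:] = [: - (R1 * (?X * ?X + ?X * ?X * ?X)), 0, R1:]"
        unfolding c by (simp add: mult.commute[of _ R1])
      then show ?thesis by simp
    qed
    finally have "pCons p P = cubic * ([:0, 1:] * Q + [:R1:]) + [:p + R1 * (?X * ?X + ?X * ?X * ?X), R0:]"
      by (simp only: distrib_left add.assoc)
    then show ?case by blast
  qed
  then show thesis using that by blast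
qed

locale nodal_basis = nodal q p + nodal_representation q p w for q p w :: "'k::field_char_0"
begin

abbreviation sc :: "'k \<Rightarrow> 'k shifted_alg" where "sc c \<equiv> cl (fconst c)"

lemma sc_ring_map: "ring_map sc"
  by (simp add: ring_map_def ring_mapD[OF cl_ring_map] fconst_add fconst_mult)

lemmas scD = ring_mapD[OF sc_ring_map] ring_mapD(1,2,7)[OF cl_ring_map]

lemma nx_rels: "ny * nx = nx * ny" "ny * ny = nx * nx + nx * nx * nx"
  using nodal_set_nx by (auto simp: nodal_set_def)

definition psi1 :: "'k poly \<Rightarrow> 'k shifted_alg" where "psi1 = pev sc nx"
definition psi :: "'k poly poly \<Rightarrow> 'k shifted_alg" where "psi = pev psi1 ny"

lemma psi1_ring_map: "ring_map psi1"
  unfolding psi1_def by (rule pev_ring_map[OF sc_ring_map]) (simp add: scalar_central)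

lemma psi_ring_map: "ring_map psi"
  unfolding psi_def
proof (rule pev_ring_map[OF psi1_ring_map])
  show "ny * psi1 c = psi1 c * ny" for c
    unfolding psi1_def by (rule pev_commute) (simp_all add: scalar_central scD nx_rels)
qed

lemmas psiD = ring_mapD[OF psi_ring_map]

lemma psi1_pCons: "psi1 (pCons c P) = sc c + psi1 P * nx"
  unfolding psi1_def by (rule pev_pCons) (simp add: scD)

lemma psi_pCons: "psi (pCons c P) = psi1 c + psi P * ny"
  unfolding psi_def by (rule pev_pCons) (simp add: ring_mapD[OF psi1_ring_map])

lemma psi1_0: "psi1 0 = 0" and psi_0: "psi 0 = 0"
  by (simp_all add: psi1_def psi_def)

lemma psi_simps: "psi [:[:c:]:] = sc c" "psi poly_X = nx" "psi poly_Y = ny"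
  by (simp_all add: psi_pCons psi1_pCons psi1_0 psi_0 poly_X_def poly_Y_def scD ring_mapD(2)[OF psi1_ring_map])

lemma psi_cubic: "psi cubic = 0"
  by (simp add: cubic_def psiD psi_simps nx_rels power2_eq_square power3_eq_cube)

definition evc :: "'k poly poly \<Rightarrow> 'k poly" where "evc = pev (\<lambda>R. pcompose R TX) TY"

lemma pcompose_ring_map: "ring_map (\<lambda>R. pcompose R TX)"
  by (simp add: ring_map_def pcompose_add pcompose_mult pcompose_1)

lemma evc_ring_map: "ring_map evc"
  unfolding evc_def by (rule pev_ring_map[OF pcompose_ring_map]) (rule mult.commute)

lemma evc_pCons: "evc (pCons c P) = pcompose c TX + evc P * TY"
  unfolding evc_def by (rule pev_pCons) simp

lemma evc_0: "evc 0 = 0"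
  by (simp add: evc_def)

lemma evc_cubic: "evc cubic = 0"
proof -
  have "evc poly_X = TX" by (simp add: poly_X_def evc_pCons evc_0 pcompose_pCons)
  moreover have "evc poly_Y = TY" by (simp add: poly_Y_def evc_pCons evc_0 pcompose_pCons pcompose_1)
  ultimately show ?thesis
    by (simp only: cubic_def ring_mapD[OF evc_ring_map] power2_eq_square power3_eq_cube TX_TY) simp
qed

lemma degree_TX_TY: "degree TX = 2" "degree TY = 3"
proof -
  have X: "TX = [:-1, 0, 1:]" by (simp add: TX_def TT_def one_pCons)
  show "degree TX = 2" by (subst X) (simp add: numeral_2_eq_2)
  have Y: "TY = [:0, -1, 0, 1:]" by (simp add: TY_def TT_def)
  show "degree TY = 3" by (subst Y) (simp add: numeral_3_eq_3)
qed

text \<open>On a remainder \<open>R0(X) + R1(X) Y\<close>, the first summand has even and the second odd degree in \<open>T\<close>.\<close>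

lemma evc_eq_0:
  assumes "evc P = 0" obtains Q where "P = cubic * Q"
proof -
  obtain Q R0 R1 where P: "P = cubic * Q + [:R0, R1:]" by (rule cubic_division)
  have e: "pcompose R0 TX = - (pcompose R1 TX * TY)"
    using assms unfolding P
    by (simp add: ring_mapD[OF evc_ring_map] evc_cubic evc_pCons evc_0 eq_neg_iff_add_eq_0)
  have R1: "R1 = 0"
  proof (rule ccontr)
    assume "R1 \<noteq> 0"
    then have "pcompose R1 TX \<noteq> 0" using pcompose_eq_0[of R1 TX] degree_TX_TY by auto
    moreover have "TY \<noteq> 0" using degree_TX_TY by auto
    ultimately have "degree (pcompose R1 TX * TY) = degree R1 * 2 + 3"
      by (simp add: degree_mult_eq degree_pcompose degree_TX_TY)
    moreover have "degree (pcompose R0 TX) = degree R0 * 2" by (simp add: degree_pcompose degree_TX_TY)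
    ultimately have "degree R0 * 2 = degree R1 * 2 + 3" using e by simp
    then show False by presburger
  qed
  then have "pcompose R0 TX = 0" using e by simp
  then have "R0 = 0" using pcompose_eq_0[of R0 TX] degree_TX_TY by simp
  then show thesis using that[of Q] P R1 by simp
qed

definition op_gen :: "gen \<Rightarrow> (nat \<times> int \<times> bool, 'k) lop" where
  "op_gen t = (case t of Gx \<Rightarrow> opu | Gy \<Rightarrow> opz | Ga \<Rightarrow> opa | Gainv \<Rightarrow> opa' | Gb \<Rightarrow> opb)"

lemma representation_exists:
  "\<exists>g. ring_map g \<and> (\<forall>c. g (sc c) = lconst c) \<and> (\<forall>t. g (cl (fvar t)) = op_gen t)"
proof -
  let ?M = "algebra_of_type (\<lambda>c (T :: (nat \<times> int \<times> bool, 'k) lop). lconst c * T)"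
  have M: "k_algebra ?M" by (rule k_algebra_of_type[OF lop_associative])
  interpret M: k_algebra ?M by (rule M)
  have h: "free_eval ?M op_gen \<in> algebra_homs kk free_algebra ?M" by (rule M.free_eval_hom) simp
  have var: "free_eval ?M op_gen (fvar t) = op_gen t" for t by (rule M.free_eval_var) simp
  have "free_eval ?M op_gen ` shifted_set (fvar Gx) (fvar Gy) (fvar Ga) (fvar Gainv) (fvar Gb) \<subseteq> {0}"
    unfolding ring_map_shifted_set[OF algebra_hom_ring_map[OF h]] var
    using op_shifted by (simp add: op_gen_def)
  then have rel: "free_eval ?M op_gen r = \<zero>\<^bsub>?M\<^esub>"
    if "r \<in> shifted_set (fvar Gx) (fvar Gy) (fvar Ga) (fvar Gainv) (fvar Gb)" for r
    using that by auto
  obtain g where g: "g \<in> algebra_homs kk NA ?M" "\<And>f. g (cl f) = free_eval ?M op_gen f"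
    using NA_hom_exists[of ?M op_gen, OF M _ rel] by auto
  have "ring_map g" unfolding ring_map_def using algebra_homsD[OF g(1)] by simp
  moreover have "g (sc c) = lconst c" for c
    using algebra_hom_const[OF h, of c] by (simp add: g(2))
  ultimately show ?thesis using g(2) var by auto
qed

definition Theta :: "'k shifted_alg \<Rightarrow> (nat \<times> int \<times> bool, 'k) lop" where
  "Theta = (SOME g. ring_map g \<and> (\<forall>c. g (sc c) = lconst c) \<and> (\<forall>t. g (cl (fvar t)) = op_gen t))"

lemma Theta: "ring_map Theta" "Theta (sc c) = lconst c" "Theta (cl (fvar t)) = op_gen t"
  using someI_ex[OF representation_exists] unfolding Theta_def by blast+

lemmas ThetaD = ring_mapD[OF Theta(1)]

lemma Theta_gens: "Theta nu = opu" "Theta nz = opz" "Theta na = opa" "Theta na' = opa'" "Theta nb = opb"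
  by (simp_all add: Theta op_gen_def)

lemma Theta_coordinates:
  "ap (Theta nx) G (0, 0, False) = TX * G (0, 0, False)" "ap (Theta ny) G (0, 0, False) = TY * G (0, 0, False)"
proof -
  have "ap (Theta (nu - 1 + sc (1 + 3 * q) * na)) G (0, 0, False) = 3 * (TX * G (0, 0, False))"
    by (simp add: ThetaD Theta_gens Theta(2) ap_simps ap_lconst op_eqs wp_gm(1,2)) (simp add: algebra_simps)
  then show "ap (Theta nx) G (0, 0, False) = TX * G (0, 0, False)"
    by (simp only: nx_def ThetaD(4) Theta(2) ap_simps(6) lconst) (simp add: numeral_poly)
  show "ap (Theta ny) G (0, 0, False) = TY * G (0, 0, False)"
    by (simp add: ny_def ThetaD Theta_gens Theta(2) ap_simps ap_lconst op_eqs)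
qed

lemma Theta_psi: "ap (Theta (psi P)) G (0, 0, False) = evc P * G (0, 0, False)"
proof (induction P arbitrary: G)
  case 0
  show ?case by (simp add: psi_0 evc_0 ThetaD ap_simps)
next
  case (pCons R P)
  have "ap (Theta (psi1 R)) G (0, 0, False) = pcompose R TX * G (0, 0, False)" for G
  proof (induction R arbitrary: G)
    case 0
    show ?case by (simp add: psi1_0 ThetaD ap_simps)
  next
    case (pCons c R)
    then show ?case
      by (simp add: psi1_pCons ThetaD Theta(2) ap_simps lconst Theta_coordinates pcompose_pCons algebra_simps)
  qed
  with pCons show ?case
    by (simp add: psi_pCons evc_pCons ThetaD ap_simps Theta_coordinates algebra_simps)
qed

lemma psi_eq_0_iff: "psi P = 0 \<longleftrightarrow> evc P = 0"
proof
  assume "psi P = 0"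
  then show "evc P = 0" using Theta_psi[of P "\<lambda>_. 1"] by (simp add: ThetaD ap_simps)
next
  assume "evc P = 0"
  then obtain Q where "P = cubic * Q" by (rule evc_eq_0)
  then show "psi P = 0" by (simp add: psiD psi_cubic)
qed

section \<open>A basis\<close>

definition nv :: "'k shifted_alg" where "nv = na * nu * na' - sc w * nu"

definition apow :: "int \<Rightarrow> 'k shifted_alg" where
  "apow l = (if 0 \<le> l then na ^ nat l else na' ^ nat (- l))"

definition bs :: "nat \<times> int \<times> bool \<Rightarrow> 'k shifted_alg" where
  "bs = (\<lambda>(i, l, f). nv ^ i * apow l * (if f then nb else 1))"

lemma sc_w: "sc w * sc w + sc w + 1 = 0"
  using arg_cong[OF w, of sc] by (simp add: scD)

lemma nv_rels: "na * nu = (nv + sc w * nu) * na" "na * nv = sc w * sc w * nv * na"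
    "nv * nu = sc w * nu * nv - sc w * sc w * nv * nv + 3 * (sc w * sc w) * (1 - na * na)"
  using NA.eigenvector[OF sc_w scalar_central] by (simp_all add: NA.v_def NA.u1_def nv_def)

lemma apow_Suc: "apow (l + 1) = apow l * na" "apow (l - 1) = apow l * na'"
    "apow (l + 1) = na * apow l" "apow (l - 1) = na' * apow l"
proof -
  have 1: "apow (l + 1) = apow l * na" for l
  proof (cases "0 \<le> l")
    case True
    then show ?thesis by (simp add: apow_def nat_add_distrib power_commutes)
  next
    case False
    then have "nat (- l) = Suc (nat (- l - 1))" by simp
    then have "(na' :: 'k shifted_alg) ^ nat (- l) * na = na' ^ nat (- l - 1)"
      by (simp only: power_Suc2 mult.assoc) simp
    then show ?thesis using False by (cases "l = - 1") (simp_all add: apow_def)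
  qed
  have a: "na * na ^ n = na ^ n * na" "na' * na ^ n = na ^ n * na'" "na * na' ^ n = na' ^ n * na"
    "na' * na' ^ n = na' ^ n * (na' :: 'k shifted_alg)" for n
    by (rule power_commuting_commutes[symmetric]; simp)+
  have c: "na * apow l = apow l * na" "na' * apow l = apow l * na'" for l
    by (simp_all add: apow_def a)
  show "apow (l + 1) = apow l * na" "apow (l + 1) = na * apow l" using 1 c by simp_all
  show "apow (l - 1) = apow l * na'"
    using 1[of "l - 1"] by (simp add: mult.assoc)
  then show "apow (l - 1) = na' * apow l" using c by simp
qed

lemma sc_move: "r * (sc c * s) = sc c * (r * s)"
  by (rule commute_left[OF scalar_central])

text \<open>The elements past which \<open>u\<close> and \<open>v\<close> can be moved to the left.\<close>

definition straight :: "'k shifted_alg \<Rightarrow> bool" where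
  "straight r \<longleftrightarrow> (\<exists>c d e. r * nu = sc c * (nu * r) + sc d * (nv * r) \<and> r * nv = sc e * (nv * r))"

lemma straight_mult:
  assumes "straight r" "straight s"
  shows "straight (r * s)"
proof -
  obtain c d e where r: "r * nu = sc c * (nu * r) + sc d * (nv * r)" "r * nv = sc e * (nv * r)"
    using assms(1) unfolding straight_def by blast
  obtain c' d' e' where s: "s * nu = sc c' * (nu * s) + sc d' * (nv * s)" "s * nv = sc e' * (nv * s)"
    using assms(2) unfolding straight_def by blast
  have rr: "r * (nu * h) = sc c * (nu * (r * h)) + sc d * (nv * (r * h))" "r * (nv * h) = sc e * (nv * (r * h))" for h
    using arg_cong[OF r(1), of "\<lambda>x. x * h"] arg_cong[OF r(2), of "\<lambda>x. x * h"]
    by (simp_all only: mult.assoc distrib_right)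
  have "r * s * nu = sc (c' * c) * (nu * (r * s)) + sc (c' * d + d' * e) * (nv * (r * s))"
    by (simp only: mult.assoc s distrib_left distrib_right sc_move[of r] rr scD(3,4) add.assoc)
  moreover have "r * s * nv = sc (e' * e) * (nv * (r * s))"
    by (simp only: mult.assoc s sc_move[of r] rr scD(4))
  ultimately show ?thesis unfolding straight_def by blast
qed

lemma sc_www: "sc w * (sc w * (sc w * h)) = h"
proof -
  have h: "w * w = - w - 1" using w by (simp add: algebra_simps eq_neg_iff_add_eq_0)
  have "w * w * w = (- w - 1) * w" by (simp only: h)
  also have "\<dots> = - (w * w) - w" by (simp add: algebra_simps)
  also have "\<dots> = 1" unfolding h by simp
  finally have h3: "w * w * w = 1" .
  have "sc w * sc w * sc w = sc (w * w * w)" by (simp only: scD(4))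
  also have "\<dots> = 1" unfolding h3 by (simp add: scD)
  finally have "sc w * sc w * sc w = 1" .
  then show ?thesis by (simp flip: mult.assoc)
qed

lemma straight_gens: "straight 1" "straight na" "straight na'"
proof -
  have "1 * nu = sc 1 * (nu * 1) + sc 0 * (nv * 1)" "1 * nv = sc 1 * (nv * 1)" by (simp_all add: scD)
  then show "straight 1" unfolding straight_def by blast
  have av: "na * nv = sc w * (sc w * (nv * na))" and au: "na * nu = sc w * (nu * na) + nv * na"
    using nv_rels(1,2) by (simp_all add: mult.assoc distrib_right add.commute)
  have "na * nu = sc w * (nu * na) + sc 1 * (nv * na)" "na * nv = sc (w * w) * (nv * na)"
    by (simp_all only: au av scD(4) mult.assoc) (simp add: scD)
  then show "straight na" unfolding straight_def by blast
  have "na * (sc w * (nv * na')) = sc w * (na * nv * na')" by (simp only: sc_move[of na] mult.assoc)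
  also have "\<dots> = nv" unfolding av by (simp only: mult.assoc sc_www NA.cancel mult_1_right)
  finally have 1: "na * (sc w * (nv * na')) = nv" .
  have 1: "na' * nv = sc w * (nv * na')"
    using arg_cong[OF 1, of "\<lambda>x. na' * x", symmetric] by (simp only: NA.cancel)
  have "na * (sc (w * w) * (nu * na') + sc (- 1) * (nv * na')) =
      sc w * (sc w * (na * nu * na')) - na * nv * na'"
    by (simp add: sc_move[of na] mult.assoc scD distrib_left right_diff_distrib)
  also have "\<dots> = nu"
    unfolding au av by (simp only: distrib_left distrib_right mult.assoc sc_www NA.cancel mult_1_right) simp
  finally have 2: "na * (sc (w * w) * (nu * na') + sc (- 1) * (nv * na')) = nu" .
  have "na' * nu = sc (w * w) * (nu * na') + sc (- 1) * (nv * na')"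
    using arg_cong[OF 2, of "\<lambda>x. na' * x", symmetric] by (simp only: NA.cancel)
  with 1 show "straight na'" unfolding straight_def by blast
qed

lemma apow_0: "apow 0 = 1"
  by (simp add: apow_def)

lemma straight_apow: "straight (apow l)"
  by (induction l rule: int_induct[of _ 0])
    (simp_all only: apow_0 apow_Suc(1,2) straight_gens straight_mult)

lemma commute_basis:
  assumes "g * nu = nu * g" "g * na = na * g"
  shows "g * nv = nv * g" "g * nv ^ i = nv ^ i * g" "g * apow l = apow l * g"
proof -
  have a': "g * na' = na' * g" by (rule NA.inverse_commute[OF assms(2)])
  have l: "g * (nu * h) = nu * (g * h)" "g * (na * h) = na * (g * h)" for h
    using assms by (simp_all flip: mult.assoc)
  show 1: "g * nv = nv * g"
    by (simp add: nv_def right_diff_distrib left_diff_distrib mult.assoc sc_move[of g] l a' assms)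
  show "g * nv ^ i = nv ^ i * g"
    by (rule power_commuting_commutes[OF 1[symmetric], symmetric])
  show "g * apow l = apow l * g"
    using power_commuting_commutes[OF assms(2)[symmetric]] power_commuting_commutes[OF a'[symmetric]]
    by (simp add: apow_def)
qed

text \<open>The \<open>B\<close>-span of the basis elements. It is closed under right multiplication by all generators and
  contains \<open>1\<close>.\<close>

inductive_set Sp :: "'k shifted_alg set" where
  Sp0: "0 \<in> Sp"
| SpS: "s \<in> Sp \<Longrightarrow> psi P * bs m + s \<in> Sp"

lemma Sp_add: "s \<in> Sp \<Longrightarrow> t \<in> Sp \<Longrightarrow> s + t \<in> Sp"
  by (induction rule: Sp.induct) (simp_all add: add.assoc SpS)

lemma Sp_psi: "s \<in> Sp \<Longrightarrow> psi Q * s \<in> Sp"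
  by (induction rule: Sp.induct) (simp_all add: distrib_left Sp0 SpS flip: psiD(4) mult.assoc)

lemma Sp_sc: "s \<in> Sp \<Longrightarrow> sc c * s \<in> Sp"
  using Sp_psi[of s "[:[:c:]:]"] by (simp add: psi_simps)

lemma Sp_diff: "s \<in> Sp \<Longrightarrow> t \<in> Sp \<Longrightarrow> s - t \<in> Sp"
  using Sp_add[OF _ Sp_sc[of t "- 1"]] by (simp add: scD)

lemma Sp_bs: "bs m \<in> Sp"
  using SpS[OF Sp0, of 1 m] by (simp add: psiD)

lemma Sp_right: "(\<And>m. bs m * g \<in> Sp) \<Longrightarrow> s \<in> Sp \<Longrightarrow> s * g \<in> Sp"
  by (rotate_tac -1, induction rule: Sp.induct) (simp_all add: distrib_right Sp0 Sp_add Sp_psi mult.assoc)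

lemma Sp_a: "s \<in> Sp \<Longrightarrow> s * na \<in> Sp" "s \<in> Sp \<Longrightarrow> s * na' \<in> Sp"
proof -
  have "bs (i, l, f) * na = bs (i, l + 1, f)" "bs (i, l, f) * na' = bs (i, l - 1, f)" for i l f
    by (simp_all add: bs_def apow_Suc(1,2) mult.assoc NA.rels(4) NA.inverse_commute[OF NA.rels(4)])
  then have "bs m * na \<in> Sp" "bs m * na' \<in> Sp" for m
    by (cases m; simp add: Sp_bs)+
  then show "s \<in> Sp \<Longrightarrow> s * na \<in> Sp" "s \<in> Sp \<Longrightarrow> s * na' \<in> Sp"
    by (auto intro: Sp_right)
qed

lemma Sp_b: "s \<in> Sp \<Longrightarrow> s * nb \<in> Sp"
proof (rule Sp_right)
  fix m :: "nat \<times> int \<times> bool"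
  obtain i l f where m: "m = (i, l, f)" by (cases m)
  show "bs m * nb \<in> Sp"
  proof (cases f)
    case True
    have "bs m * nb = bs (i, l, False) * na * na * na"
      using True by (simp add: m bs_def mult.assoc NA.rels(3)[unfolded mult.assoc])
    then show ?thesis by (simp add: Sp_a Sp_bs)
  next
    case False
    then have "bs m * nb = bs (i, l, True)" by (simp add: m bs_def)
    then show ?thesis by (simp add: Sp_bs)
  qed
qed

lemma Sp_v: "s \<in> Sp \<Longrightarrow> s * nv \<in> Sp"
proof (rule Sp_right)
  fix m :: "nat \<times> int \<times> bool"
  obtain i l f where m: "m = (i, l, f)" by (cases m)
  obtain e where e: "apow l * nv = sc e * (nv * apow l)" using straight_apow[of l] unfolding straight_def by blast
  have "nb * nv = nv * nb" by (rule commute_basis[OF NA.rels(6,4)])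
  then have "bs m * nv = nv ^ i * (apow l * nv) * (if f then nb else 1)" by (simp add: m bs_def mult.assoc)
  also have "\<dots> = sc e * bs (Suc i, l, f)"
    unfolding e by (simp add: bs_def sc_move[of "nv ^ i"] mult.assoc power_commutes)
      (simp add: mult.assoc[symmetric] power_commutes)
  finally show "bs m * nv \<in> Sp" by (simp add: Sp_sc Sp_bs)
qed

lemma Sp_apow: "s \<in> Sp \<Longrightarrow> s * apow l \<in> Sp"
  by (induction l rule: int_induct[of _ 0]) (simp_all add: apow_0 apow_Suc(1,2) Sp_a flip: mult.assoc)

lemma Sp_v_power_u: "nv ^ i * nu \<in> Sp"
proof (induction i)
  case 0
  have "nu = psi (3 * poly_X + 1) * bs (0, 0, False) - sc (1 + 3 * q) * bs (0, 1, False)"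
    unfolding nu_eq by (simp add: psiD psi_simps bs_def apow_def)
  then show ?case using Sp_diff[OF Sp_psi Sp_sc, OF Sp_bs Sp_bs] by simp
next
  case (Suc i)
  have "bs (i, 0, False) = nv ^ i" for i by (simp add: bs_def apow_def)
  then have b: "nv ^ i \<in> Sp" for i using Sp_bs by metis
  have "nv ^ Suc i * nu = nv ^ i * (nv * nu)" by (simp only: power_Suc2 mult.assoc)
  also have "\<dots> = sc w * (nv ^ i * nu * nv) - sc (w * w) * (nv ^ i * nv * nv)
      + sc (3 * (w * w)) * (nv ^ i - nv ^ i * na * na)"
    unfolding nv_rels(3)
    by (simp add: mult.assoc scD distrib_left right_diff_distrib sc_move[of "nv ^ i"] scalar_central[of "nv ^ i"]
        numeral_left_commute[of "nv ^ i"])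
  finally show ?case using Suc b by (simp only: Sp_add Sp_diff Sp_sc Sp_v Sp_a)
qed

lemma Sp_u: "s \<in> Sp \<Longrightarrow> s * nu \<in> Sp"
proof (rule Sp_right)
  fix m :: "nat \<times> int \<times> bool"
  obtain i l f where m: "m = (i, l, f)" by (cases m)
  obtain c d where e: "apow l * nu = sc c * (nu * apow l) + sc d * (nv * apow l)"
    using straight_apow[of l] unfolding straight_def by blast
  have "nv ^ i * apow l * nu = nv ^ i * (apow l * nu)" by (simp only: mult.assoc)
  also have "\<dots> = sc c * (nv ^ i * nu * apow l) + sc d * bs (Suc i, l, False)"
    unfolding e by (simp add: distrib_left sc_move[of "nv ^ i"] bs_def mult.assoc)
      (simp add: mult.assoc[symmetric] power_commutes)
  finally have F: "nv ^ i * apow l * nu \<in> Sp" by (simp only: Sp_add Sp_sc Sp_apow Sp_v_power_u Sp_bs)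
  have "bs m * nu = nv ^ i * apow l * nu * (if f then nb else 1)"
    by (simp add: m bs_def mult.assoc NA.rels(6))
  then show "bs m * nu \<in> Sp" using F Sp_b[OF F] by simp
qed

lemma Sp_z: "s \<in> Sp \<Longrightarrow> s * nz \<in> Sp"
proof (rule Sp_right)
  fix m :: "nat \<times> int \<times> bool"
  obtain i l f where m: "m = (i, l, f)" by (cases m)
  note z = commute_basis[OF NA.rels(7,5)] and b = commute_basis[OF NA.rels(6,4)]
  have "nv ^ i * apow l * nz = nz * (nv ^ i * apow l)"
    by (simp only: commute_left[OF z(2)] z(3) mult.assoc)
  also have "\<dots> = psi poly_Y * bs (i, l, False) - sc p * bs (i, l, True)"
  proof -
    have "nb * (nv ^ i * apow l) = nv ^ i * apow l * nb" 
      by (simp only: commute_left[OF b(2)] b(3) mult.assoc)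
    then show ?thesis unfolding nz_eq by (simp add: psi_simps bs_def left_diff_distrib mult.assoc)
  qed
  finally have F: "nv ^ i * apow l * nz \<in> Sp" by (simp only: Sp_diff Sp_sc Sp_psi Sp_bs)
  have "bs m * nz = (if f then sc (- 1) * (nv ^ i * apow l * nz * nb) else nv ^ i * apow l * nz)"
    by (simp add: m bs_def mult.assoc scD NA.rels(8))
  then show "bs m * nz \<in> Sp" using F Sp_sc[OF Sp_b[OF F]] by simp
qed

lemma Sp_UNIV: "r \<in> Sp"
proof -
  have "s * r \<in> Sp" if "s \<in> Sp" for s
    using that
  proof (induction r arbitrary: s rule: shifted_alg_induct)
    case (const c)
    then show ?case by (simp add: scalar_central Sp_sc)
  next
    case (var g)
    then show ?case by (cases g) (simp_all add: Sp_u Sp_z Sp_a Sp_b)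
  next
    case (add f h)
    then show ?case by (simp add: distrib_left Sp_add)
  next
    case (mult f h)
    then show ?case by (simp flip: mult.assoc)
  qed
  from this[OF Sp_bs[of "(0, 0, False)"]] show ?thesis by (simp add: bs_def apow_0)
qed

lemma spanning: obtains P F where "finite F" "\<And>m. m \<notin> F \<Longrightarrow> P m = 0" "r = (\<Sum>m\<in>F. psi (P m) * bs m)"
proof -
  have "\<exists>P F. finite F \<and> (\<forall>m. m \<notin> F \<longrightarrow> P m = 0) \<and> r = (\<Sum>m\<in>F. psi (P m) * bs m)"
    using Sp_UNIV[of r]
  proof (induction rule: Sp.induct)
    case Sp0
    show ?case by (intro exI[of _ "\<lambda>_. 0"] exI[of _ "{}"]) simp
  next
    case (SpS s Q n)
    then obtain P F where P: "finite F" "\<And>m. m \<notin> F \<Longrightarrow> P m = 0" "s = (\<Sum>m\<in>F. psi (P m) * bs m)" by blast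
    let ?P = "\<lambda>m. (if m = n then Q else 0) + P m"
    have "(\<Sum>m\<in>insert n F. psi (?P m) * bs m) =
        (\<Sum>m\<in>insert n F. (if m = n then psi Q * bs m else 0)) + (\<Sum>m\<in>insert n F. psi (P m) * bs m)"
      by (subst sum.distrib[symmetric]) (intro sum.cong refl, simp add: psiD distrib_right)
    also have "(\<Sum>m\<in>insert n F. psi (P m) * bs m) = s"
      unfolding P(3) by (rule sum.mono_neutral_right) (use P in \<open>auto simp: psiD(1)\<close>)
    finally show ?case using P(1,2)
      by (intro exI[of _ ?P] exI[of _ "insert n F"]) (simp add: sum.delta)
  qed
  then show thesis using that by blast
qed

lemma Theta_bs: "ap (Theta (bs m)) G (0, 0, False) = G m"
proof -
  have "Theta nv = opa * opu * opa' - lconst w * opu" by (simp add: nv_def ThetaD Theta)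
    (simp add: op_gen_def)
  also have "\<dots> = opv"
    unfolding op_au using op_rels1(1) by (simp add: mult.assoc)
  finally have v: "Theta nv = opv" .
  have 1: "ap (Theta (nv ^ i)) G (k, 0, f) = G (k + i, 0, f)" for i k f G
  proof (induction i arbitrary: k)
    case (Suc i)
    then show ?case by (simp add: ThetaD v ap_simps op_eqs wp_gm(1))
  qed (simp add: ThetaD ap_simps)
  have 2: "ap (Theta (apow l)) G (i, k, f) = G (i, k + l, f)" for l i k f G
  proof (induction l arbitrary: k rule: int_induct[of _ 0])
    case base
    show ?case by (simp add: apow_0 ThetaD ap_simps)
  next
    case (step1 l)
    then show ?case unfolding apow_Suc(3) by (simp add: ThetaD Theta_gens ap_simps op_eqs ac_simps)
  next
    case (step2 l)
    then show ?case unfolding apow_Suc(4) by (simp add: ThetaD Theta_gens ap_simps op_eqs algebra_simps)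
  qed
  obtain i l f where m: "m = (i, l, f)" by (cases m)
  show ?thesis by (simp add: m bs_def ThetaD ap_simps 1 2 Theta_gens op_eqs)
qed

lemma coordinates:
  "finite F \<Longrightarrow> ap (Theta (\<Sum>m\<in>F. psi (P m) * bs m)) G (0, 0, False) = (\<Sum>m\<in>F. evc (P m) * G m)"
  by (induction rule: finite_induct) (simp_all add: ThetaD ap_simps Theta_psi Theta_bs)

end

lemma regular_abelian_group:
  assumes "ring A" shows "abelian_group (regular_module A)"
proof -
  interpret ring A by fact
  show ?thesis
  proof (rule abelian_groupI)
    fix x assume "x \<in> carrier (regular_module A)"
    then show "\<exists>y\<in>carrier (regular_module A). y \<oplus>\<^bsub>regular_module A\<^esub> x = \<zero>\<^bsub>regular_module A\<^esub>"
      by (intro bexI[of _ "\<ominus>\<^bsub>A\<^esub> x"]) (simp_all add: regular_module_def l_neg)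
  next
    fix x y assume "x \<in> carrier (regular_module A)" "y \<in> carrier (regular_module A)"
    then show "x \<oplus>\<^bsub>regular_module A\<^esub> y = y \<oplus>\<^bsub>regular_module A\<^esub> x"
      using a_comm[of x y] by (simp add: regular_module_def)
  qed (simp_all add: regular_module_def a_assoc)
qed

lemma poly_XY_associative: "associative_algebra kk (poly_XY :: ('k::field, 'k poly poly) module)"
  unfolding poly_XY_def
proof (rule associative_algebra_of_type)
  fix c d :: 'k and x :: "'k poly poly"
  have "[:c + d:] = [:c:] + [:d:]" "[:c * d:] = [:c:] * [:d:]" by simp_all
  then show "Polynomial.smult [:c + d:] x = Polynomial.smult [:c:] x + Polynomial.smult [:d:] x"
    "Polynomial.smult [:c * d:] x = Polynomial.smult [:c:] (Polynomial.smult [:d:] x)"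
    by (simp_all only: smult_add_left smult_smult)
qed (simp_all add: smult_add_right flip: one_pCons)

context nodal_basis
begin

definition BB where "BB = j ` range psi"

lemma in_BB: "z \<in> BB \<longleftrightarrow> (\<exists>P. z = j (psi P))"
  by (auto simp: BB_def)

lemma psi_hom: "(\<lambda>P. j (psi P)) \<in> algebra_homs kk poly_XY A"
proof (intro algebra_homsI module_homsI)
  fix c :: 'k and P :: "'k poly poly"
  have "Polynomial.smult [:c:] P = [:[:c:]:] * P" by simp
  then show "j (psi (c \<odot>\<^bsub>poly_XY\<^esub> P)) = c \<odot>\<^bsub>A\<^esub> j (psi P)"
    by (simp only: poly_XY_def algebra_of_type_simps psiD psi_simps j_simps(5))
qed (simp_all add: poly_XY_def psiD j_simps)

lemma j_minus: "\<ominus>\<^bsub>A\<^esub> j r = j (- r)"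
proof (rule A.minus_equality)
  show "j (- r) \<oplus>\<^bsub>A\<^esub> j r = \<zero>\<^bsub>A\<^esub>" by (simp add: j_simps(6) flip: j_simps(2))
qed (simp_all add: j_simps)

lemma BB_subalgebra: "is_subalgebra kk BB A"
proof -
  have c: "BB \<subseteq> carrier A" by (auto simp: in_BB j_simps)
  have one: "\<one>\<^bsub>A\<^esub> \<in> BB" unfolding in_BB by (rule exI[of _ 1]) (simp add: psiD j_simps)
  have zero: "\<zero>\<^bsub>A\<^esub> \<in> BB" unfolding in_BB by (rule exI[of _ 0]) (simp add: psiD j_simps)
  have minus: "\<ominus>\<^bsub>A\<^esub> z \<in> BB" if z: "z \<in> BB" for z
  proof -
    obtain P where "z = j (psi P)" using z by (auto simp: in_BB)
    then show ?thesis unfolding in_BB by (intro exI[of _ "- P"]) (simp add: psiD j_minus)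
  qed
  have add: "z \<oplus>\<^bsub>A\<^esub> z' \<in> BB" "z \<otimes>\<^bsub>A\<^esub> z' \<in> BB" if z: "z \<in> BB" "z' \<in> BB" for z z'
  proof -
    obtain P Q where "z = j (psi P)" "z' = j (psi Q)" using z by (auto simp: in_BB)
    then have "z \<oplus>\<^bsub>A\<^esub> z' = j (psi (P + Q))" "z \<otimes>\<^bsub>A\<^esub> z' = j (psi (P * Q))"
      by (simp_all only: psiD j_simps)
    then show "z \<oplus>\<^bsub>A\<^esub> z' \<in> BB" "z \<otimes>\<^bsub>A\<^esub> z' \<in> BB" unfolding in_BB by blast+
  qed
  have smult: "c \<odot>\<^bsub>A\<^esub> z \<in> BB" if z: "z \<in> BB" for c z
  proof -
    obtain P where "z = j (psi P)" using z by (auto simp: in_BB)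
    then have "c \<odot>\<^bsub>A\<^esub> z = j (psi ([:[:c:]:] * P))"
      by (simp only: psiD psi_simps j_simps(5))
    then show ?thesis unfolding in_BB by blast
  qed
  have "subring BB A" by (rule A.subringI[OF c one minus add(2) add(1)])
  moreover have "submodule BB kk A" by (rule A.submoduleI[OF c zero minus add(1) smult])
  ultimately show ?thesis by (simp add: is_subalgebra_def)
qed

lemma BB_generated: "generated_subalgebra kk A {gx, gy} = BB"
proof
  have "gx = j (psi poly_X)" "gy = j (psi poly_Y)" by (simp_all add: psi_simps j_gens)
  then have "{gx, gy} \<subseteq> BB" unfolding BB_def by blast
  then show "generated_subalgebra kk A {gx, gy} \<subseteq> BB"
    unfolding generated_subalgebra_def using BB_subalgebra by blast
  show "BB \<subseteq> generated_subalgebra kk A {gx, gy}"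
    unfolding generated_subalgebra_def
  proof (rule Inter_greatest)
    fix C assume "C \<in> {B. is_subalgebra kk B A \<and> {gx, gy} \<subseteq> B}"
    then have sr: "subring C A" and sm: "submodule C kk A" and g: "j nx \<in> C" "j ny \<in> C"
      by (auto simp: is_subalgebra_def j_gens)
    have sc: "j (sc c) \<in> C" for c
      using A.submoduleE(4)[OF sm, of c, OF _ subringE(3)[OF sr]] j_simps(5)[of c 1] j_simps(4) by simp
    have 1: "j (psi1 R) \<in> C" for R
      by (induction R) (simp_all add: psi1_0 psi1_pCons j_simps subringE[OF sr] sc g)
    have "j (psi P) \<in> C" for P
      by (induction P) (simp_all add: psi_0 psi_pCons j_simps subringE[OF sr] 1 g)
    then show "BB \<subseteq> C" by (auto simp: in_BB)
  qed
qed

abbreviation "Rb \<equiv> A\<lparr>carrier := BB\<rparr>"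
abbreviation "Mb \<equiv> regular_module A"

lemma BB_cring: "cring Rb"
proof -
  have sr: "subring BB A" using BB_subalgebra by (simp add: is_subalgebra_def)
  interpret R: ring Rb by (rule A.subring_is_ring[OF sr])
  have "z \<otimes>\<^bsub>A\<^esub> z' = z' \<otimes>\<^bsub>A\<^esub> z" if z: "z \<in> BB" "z' \<in> BB" for z z'
  proof -
    obtain P Q where "z = j (psi P)" "z' = j (psi Q)" using z by (auto simp: in_BB)
    then have "z \<otimes>\<^bsub>A\<^esub> z' = j (psi (P * Q))" "z' \<otimes>\<^bsub>A\<^esub> z = j (psi (Q * P))"
      by (simp_all only: psiD j_simps)
    then show ?thesis by (simp only: mult.commute)
  qed
  then show ?thesis by unfold_locales simp
qed

lemma BB_carrier: "BB \<subseteq> carrier A"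
  by (auto simp: in_BB j_simps)

lemma Mb_module: "module Rb Mb"
proof (rule moduleI[OF BB_cring regular_abelian_group[OF A.ring_axioms]])
qed (use BB_carrier in \<open>auto simp: regular_module_def subset_iff A.l_distr A.r_distr A.m_assoc\<close>)

definition bj where "bj m = j (bs m)"

lemma bs_inj: "bs m = bs n \<Longrightarrow> m = n"
  using Theta_bs[of m "\<lambda>k. if k = n then 1 else 0"] Theta_bs[of n "\<lambda>k. if k = n then 1 else 0"]
  by (simp split: if_splits)

lemma bj_inj: "inj bj"
  by (rule injI) (simp add: bj_def j_eq_iff bs_inj)

lemma finsum_Mb:
  assumes "finite F"
  shows "(\<Oplus>\<^bsub>Mb\<^esub>m\<in>F. j (f m)) = j (sum f F)"
proof -
  interpret M: module Rb Mb by (rule Mb_module)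
  have c: "j r \<in> carrier Mb" for r by (simp add: regular_module_def j_simps)
  have z: "\<zero>\<^bsub>Mb\<^esub> = \<zero>\<^bsub>A\<^esub>" "add Mb = add A" by (simp_all add: regular_module_def)
  show ?thesis
    using assms by (induction rule: finite_induct) (simp_all add: c z j_simps Pi_def)
qed

text \<open>The coefficient of a basis element, read off from the action on a delta function.\<close>

definition coordinate_of where
  "coordinate_of r m = ap (Theta r) (\<lambda>k. if k = m then 1 else 0) (0, 0, False)"

definition is_expansion where
  "is_expansion r c \<longleftrightarrow> c \<in> UNIV \<rightarrow> carrier Rb \<and> finite {e. c e \<noteq> \<zero>\<^bsub>Rb\<^esub>} \<and> {e. c e \<noteq> \<zero>\<^bsub>Rb\<^esub>} \<subseteq> range bj \<and>
      j r = (\<Oplus>\<^bsub>Mb\<^esub>e\<in>{e. c e \<noteq> \<zero>\<^bsub>Rb\<^esub>}. c e \<odot>\<^bsub>Mb\<^esub> e)"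

lemma finsum_expansion:
  assumes c: "\<And>m. c (bj m) = j (psi (P m))" and sub: "{e. c e \<noteq> \<zero>\<^bsub>Rb\<^esub>} \<subseteq> range bj"
    and fin: "finite {m. psi (P m) \<noteq> 0}"
  shows "(\<Oplus>\<^bsub>Mb\<^esub>e\<in>{e. c e \<noteq> \<zero>\<^bsub>Rb\<^esub>}. c e \<odot>\<^bsub>Mb\<^esub> e) = j (\<Sum>m\<in>{m. psi (P m) \<noteq> 0}. psi (P m) * bs m)"
    and "{e. c e \<noteq> \<zero>\<^bsub>Rb\<^esub>} = bj ` {m. psi (P m) \<noteq> 0}"
proof -
  interpret M: module Rb Mb by (rule Mb_module)
  have z: "c (bj m) \<noteq> \<zero>\<^bsub>Rb\<^esub> \<longleftrightarrow> psi (P m) \<noteq> 0" for m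
    using j_eq_iff[of "psi (P m)" 0] by (simp add: c j_simps(6))
  show S: "{e. c e \<noteq> \<zero>\<^bsub>Rb\<^esub>} = bj ` {m. psi (P m) \<noteq> 0}"
    using sub z by blast
  have e: "c (bj m) \<odot>\<^bsub>Mb\<^esub> bj m = j (psi (P m) * bs m)" for m
    unfolding c by (simp add: regular_module_def bj_def j_simps)
  have cl: "j r \<in> carrier Mb" for r by (simp add: regular_module_def j_simps)
  have "(\<Oplus>\<^bsub>Mb\<^esub>e\<in>bj ` {m. psi (P m) \<noteq> 0}. c e \<odot>\<^bsub>Mb\<^esub> e) =
      (\<Oplus>\<^bsub>Mb\<^esub>m\<in>{m. psi (P m) \<noteq> 0}. c (bj m) \<odot>\<^bsub>Mb\<^esub> bj m)"
    by (rule M.finsum_reindex) (use bj_inj in \<open>auto simp: e cl inj_on_def\<close>)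
  then show "(\<Oplus>\<^bsub>Mb\<^esub>e\<in>{e. c e \<noteq> \<zero>\<^bsub>Rb\<^esub>}. c e \<odot>\<^bsub>Mb\<^esub> e) = j (\<Sum>m\<in>{m. psi (P m) \<noteq> 0}. psi (P m) * bs m)"
    unfolding S e finsum_Mb[OF fin] .
qed

lemma expansion_exists: "\<exists>c. is_expansion r c"
proof -
  obtain P F where P: "finite F" "\<And>m. m \<notin> F \<Longrightarrow> P m = 0" "r = (\<Sum>m\<in>F. psi (P m) * bs m)"
    by (rule spanning[OF that])
  define c where "c e = (if e \<in> range bj then j (psi (P (inv_into UNIV bj e))) else \<zero>\<^bsub>A\<^esub>)" for e
  have c: "c (bj m) = j (psi (P m))" for m
    by (simp add: c_def inv_into_f_f[OF bj_inj])
  have sub: "{e. c e \<noteq> \<zero>\<^bsub>Rb\<^esub>} \<subseteq> range bj" by (auto simp: c_def)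
  have "{m. psi (P m) \<noteq> 0} \<subseteq> F" using P(2) by (auto simp: psi_0 intro: ccontr)
  then have fin: "finite {m. psi (P m) \<noteq> 0}" using P(1) by (rule finite_subset)
  have r: "r = (\<Sum>m\<in>{m. psi (P m) \<noteq> 0}. psi (P m) * bs m)"
    unfolding P(3) by (rule sum.mono_neutral_right) (use P(1) \<open>_ \<subseteq> F\<close> in auto)
  have "c e \<in> BB" for e
  proof -
    have "\<zero>\<^bsub>A\<^esub> = j (psi 0)" by (simp add: psi_0 j_simps)
    then show ?thesis unfolding c_def in_BB by auto
  qed
  then have "is_expansion r c"
    using finsum_expansion[OF c sub fin] sub fin r by (simp add: is_expansion_def)
  then show ?thesis by blast
qed

lemma expansion_coordinates:
  assumes "is_expansion r c"
  obtains P where "\<And>m. c (bj m) = j (psi (P m))" "\<And>m. evc (P m) = coordinate_of r m"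
proof -
  note h = assms[unfolded is_expansion_def]
  have "\<forall>m. \<exists>P. c (bj m) = j (psi P)" using h in_BB by (auto simp: Pi_def)
  then obtain P where P: "\<And>m. c (bj m) = j (psi (P m))" by metis
  let ?S = "{m. psi (P m) \<noteq> 0}"
  have z: "c (bj m) \<noteq> \<zero>\<^bsub>Rb\<^esub> \<longleftrightarrow> psi (P m) \<noteq> 0" for m
    using j_eq_iff[of "psi (P m)" 0] by (simp add: P j_simps(6))
  have "bj ` ?S \<subseteq> {e. c e \<noteq> \<zero>\<^bsub>Rb\<^esub>}" using z by auto
  then have "finite (bj ` ?S)" using h finite_subset by blast
  then have fin: "finite ?S" using bj_inj by (meson finite_imageD inj_on_subset subset_UNIV)
  have "j r = j (\<Sum>m\<in>?S. psi (P m) * bs m)"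
    using h finsum_expansion(1)[OF P _ fin] by simp
  then have r: "r = (\<Sum>m\<in>?S. psi (P m) * bs m)" by (simp add: j_eq_iff)
  have "coordinate_of r m = evc (P m)" for m
  proof -
    have "coordinate_of r m = (\<Sum>k\<in>?S. evc (P k) * (if k = m then 1 else 0))"
      unfolding coordinate_of_def by (subst r) (rule coordinates[OF fin])
    also have "\<dots> = (\<Sum>k\<in>?S. if k = m then evc (P k) else 0)" by (intro sum.cong) auto
    also have "\<dots> = (if m \<in> ?S then evc (P m) else 0)" using fin by simp
    also have "\<dots> = evc (P m)" using psi_eq_0_iff[of "P m"] by auto
    finally show ?thesis .
  qed
  then show thesis using that[of P] P by simp
qed

lemma A_basis: "is_basis Rb Mb (range bj)"
  unfolding is_basis_def
proof (intro conjI ballI)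
  show "range bj \<subseteq> carrier Mb" by (auto simp: bj_def regular_module_def j_simps)
  fix x assume "x \<in> carrier Mb"
  then obtain r where r: "x = j r" using carrier_A by (auto simp: regular_module_def)
  have "c e = c' e" if c: "is_expansion r c" and c': "is_expansion r c'" for c c' e
  proof (cases "e \<in> range bj")
    case True
    then obtain m where m: "e = bj m" by blast
    obtain P where P: "\<And>m. c (bj m) = j (psi (P m))" "\<And>m. evc (P m) = coordinate_of r m"
      by (rule expansion_coordinates[OF c that])
    obtain P' where P': "\<And>m. c' (bj m) = j (psi (P' m))" "\<And>m. evc (P' m) = coordinate_of r m"
      by (rule expansion_coordinates[OF c' that])
    have "evc (P m - P' m) = 0" by (simp add: ring_mapD[OF evc_ring_map] P P')
    then have "psi (P m - P' m) = 0" by (simp add: psi_eq_0_iff)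
    then show ?thesis by (simp add: m P P' psiD)
  next
    case False
    then have "c e = \<zero>\<^bsub>Rb\<^esub>" "c' e = \<zero>\<^bsub>Rb\<^esub>" using c c' unfolding is_expansion_def by blast+
    then show ?thesis by simp
  qed
  then have "\<exists>!c. is_expansion r c" using expansion_exists[of r] by blast
  then show "\<exists>!c. c \<in> UNIV \<rightarrow> carrier Rb \<and> finite {e. c e \<noteq> \<zero>\<^bsub>Rb\<^esub>} \<and> {e. c e \<noteq> \<zero>\<^bsub>Rb\<^esub>} \<subseteq> range bj \<and>
      x = (\<Oplus>\<^bsub>Mb\<^esub>e\<in>{e. c e \<noteq> \<zero>\<^bsub>Rb\<^esub>}. c e \<odot>\<^bsub>Mb\<^esub> e)"
    unfolding is_expansion_def r .
qed

lemma cubic_ideal_iff: "P \<in> cubic_ideal \<longleftrightarrow> psi P = 0" and cubic_ideal_ideal: "ideal cubic_ideal (poly_XY :: ('k, 'k poly poly) module)"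
proof -
  interpret X: associative_algebra kk "poly_XY :: ('k, 'k poly poly) module" by (rule poly_XY_associative)
  have ci: "cubic_ideal = Idl\<^bsub>poly_XY\<^esub> {cubic :: 'k poly poly}" by (simp add: cubic_ideal_def cubic_def)
  have car: "carrier (poly_XY :: ('k, 'k poly poly) module) = UNIV" by (simp add: poly_XY_def)
  show i: "ideal cubic_ideal (poly_XY :: ('k, 'k poly poly) module)"
    unfolding ci by (rule X.genideal_ideal) (simp add: car)
  have k: "ideal {P. psi P = 0} (poly_XY :: ('k, 'k poly poly) module)"
  proof -
    have "ring_hom_ring (poly_XY :: ('k, 'k poly poly) module) A (\<lambda>P. j (psi P))"
      using psi_hom X.ring_axioms A.ring_axioms
      by (simp add: ring_hom_ring_def ring_hom_ring_axioms_def algebra_homs_def)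
    from ring_hom_ring.kernel_is_ideal[OF this] show ?thesis
      using j_eq_iff[of _ 0] by (simp add: a_kernel_def kernel_def car j_simps(6))
  qed
  show "P \<in> cubic_ideal \<longleftrightarrow> psi P = 0"
  proof
    assume "P \<in> cubic_ideal"
    moreover have "cubic_ideal \<subseteq> {P. psi P = 0}"
      unfolding ci by (rule X.genideal_minimal[OF k]) (simp add: psi_cubic)
    ultimately show "psi P = 0" by blast
  next
    assume "psi P = 0"
    then have "evc P = 0" by (simp only: psi_eq_0_iff)
    then obtain Q where "P = cubic * Q" by (rule evc_eq_0)
    moreover have "(cubic :: 'k poly poly) \<in> cubic_ideal"
      using X.genideal_self[of "{cubic}"] unfolding ci by (simp add: car)
    ultimately show "P \<in> cubic_ideal"
      using ideal.I_r_closed[OF i, of cubic Q] by (simp add: car poly_XY_def)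
  qed
qed

lemma coordinate_ring:
  "\<exists>\<phi> \<in> algebra_isos kk nodal_cubic Rb.
      \<phi> (cubic_ideal +>\<^bsub>poly_XY\<^esub> poly_X) = gx \<and> \<phi> (cubic_ideal +>\<^bsub>poly_XY\<^esub> poly_Y) = gy"
proof -
  interpret X: algebra_ideal kk "poly_XY :: ('k, 'k poly poly) module" cubic_ideal
    unfolding algebra_ideal_def using poly_XY_associative cubic_ideal_ideal by blast
  have car: "carrier (poly_XY :: ('k, 'k poly poly) module) = UNIV" by (simp add: poly_XY_def)
  have 0: "j (psi P) = \<zero>\<^bsub>A\<^esub>" if "P \<in> cubic_ideal" for P
    using that by (simp add: cubic_ideal_iff j_simps(6))
  obtain \<phi> where \<phi>: "\<phi> \<in> algebra_homs kk X.Q A" "\<And>P. \<phi> (X.\<pi> P) = j (psi P)"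
    by (rule X.factor_hom[OF psi_hom A.associative_algebra_axioms 0]) (auto simp: car)
  have Q: "X.Q = nodal_cubic" by (simp add: nodal_cubic_def)
  have cQ: "carrier nodal_cubic = range X.\<pi>" using X.carrier_Q by (simp add: Q car)
  note D = algebra_homsD[OF \<phi>(1)[unfolded Q]]
  have B: "\<phi> z \<in> BB" if z: "z \<in> carrier nodal_cubic" for z
  proof -
    obtain P where P: "z = X.\<pi> P" using z unfolding cQ by blast
    show ?thesis unfolding P \<phi>(2) BB_def by blast
  qed
  have h: "\<phi> \<in> algebra_homs kk nodal_cubic Rb"
    by (intro algebra_homsI module_homsI) (simp_all add: D B)
  have "X.\<pi> P = X.\<pi> P'" if "psi P = psi P'" for P P'
  proof -
    have "P \<ominus>\<^bsub>poly_XY\<^esub> P' \<in> cubic_ideal"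
    proof -
      have "\<ominus>\<^bsub>poly_XY\<^esub> P' = - P'" by (rule X.minus_equality) (simp_all add: poly_XY_def)
      then have "P \<ominus>\<^bsub>poly_XY\<^esub> P' = P - P'" by (simp only: a_minus_def) (simp add: poly_XY_def)
      then show ?thesis using that by (simp add: cubic_ideal_iff psiD)
    qed
    then show ?thesis using X.\<pi>_eq_iff[of P P'] by (simp add: car)
  qed
  note eq = this
  have "inj_on \<phi> (carrier nodal_cubic)"
  proof (rule inj_onI)
    fix z z' assume z: "z \<in> carrier nodal_cubic" "z' \<in> carrier nodal_cubic" "\<phi> z = \<phi> z'"
    obtain P where P: "z = X.\<pi> P" using z(1) unfolding cQ by blast
    obtain P' where P': "z' = X.\<pi> P'" using z(2) unfolding cQ by blast
    have "psi P = psi P'" using z(3) unfolding P P' \<phi>(2) j_eq_iff .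
    then show "z = z'" unfolding P P' by (rule eq)
  qed
  moreover have "\<phi> ` carrier nodal_cubic = BB"
    unfolding cQ BB_def image_image \<phi>(2) ..
  ultimately have "\<phi> \<in> algebra_isos kk nodal_cubic Rb"
    using h by (simp add: algebra_isos_def bij_betw_def)
  moreover have "\<phi> (cubic_ideal +>\<^bsub>poly_XY\<^esub> poly_X) = gx" "\<phi> (cubic_ideal +>\<^bsub>poly_XY\<^esub> poly_Y) = gy"
    by (simp_all add: \<phi>(2) psi_simps j_gens)
  ultimately show ?thesis by blast
qed

lemma B_structure:
  defines "B \<equiv> generated_subalgebra kk A {gx, gy}"
  shows "is_subalgebra kk B A"
    and "\<exists>\<phi> \<in> algebra_isos kk nodal_cubic (A\<lparr>carrier := B\<rparr>).
      \<phi> (cubic_ideal +>\<^bsub>poly_XY\<^esub> poly_X) = gx \<and> \<phi> (cubic_ideal +>\<^bsub>poly_XY\<^esub> poly_Y) = gy"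
    and "free_module (A\<lparr>carrier := B\<rparr>) (regular_module A)"
    and "faithfully_flat TYPE('n) (A\<lparr>carrier := B\<rparr>) (regular_module A)"
proof -
  show "is_subalgebra kk B A" unfolding B_def BB_generated by (rule BB_subalgebra)
  show "\<exists>\<phi> \<in> algebra_isos kk nodal_cubic (A\<lparr>carrier := B\<rparr>).
      \<phi> (cubic_ideal +>\<^bsub>poly_XY\<^esub> poly_X) = gx \<and> \<phi> (cubic_ideal +>\<^bsub>poly_XY\<^esub> poly_Y) = gy"
    unfolding B_def BB_generated by (rule coordinate_ring)
  show "free_module (A\<lparr>carrier := B\<rparr>) (regular_module A)"
    unfolding B_def BB_generated free_module_def using Mb_module A_basis by blast
  have "module_with_basis Rb Mb (range bj)"
    by (simp add: module_with_basis_def module_with_basis_axioms_def Mb_module A_basis)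
  from module_with_basis.free_imp_faithfully_flat[OF this]
  show "faithfully_flat TYPE('n) (A\<lparr>carrier := B\<rparr>) (regular_module A)"
    unfolding B_def BB_generated by simp
qed

end

section \<open>The Hopf algebra structure\<close>

lemma single_zero_commute:
  fixes f :: "'w::monoid_add \<Rightarrow>\<^sub>0 'k::comm_ring_1"
  shows "f * Poly_Mapping.single 0 c = Poly_Mapping.single 0 c * f"
  by (induction f rule: poly_mapping_sum_induct) (simp_all add: mult_single algebra_simps)

abbreviation monoid_algebra :: "('k::comm_ring_1, 'w::monoid_add \<Rightarrow>\<^sub>0 'k) module" where
  "monoid_algebra \<equiv> algebra_of_type (\<lambda>c f. Poly_Mapping.single 0 c * f)"

lemma monoid_algebra_associative: "associative_algebra ring_of_type_algebra monoid_algebra"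
proof (rule associative_algebra_of_type)
  fix c and f g :: "'w::monoid_add \<Rightarrow>\<^sub>0 'k::comm_ring_1"
  show "f * (Poly_Mapping.single 0 c * g) = Poly_Mapping.single 0 c * (f * g)"
    by (rule commute_left[OF single_zero_commute])
next
  fix c d and f :: "'w::monoid_add \<Rightarrow>\<^sub>0 'k::comm_ring_1"
  show "Poly_Mapping.single 0 (c * d) * f = Poly_Mapping.single 0 c * (Poly_Mapping.single 0 d * f)"
    by (simp add: mult.assoc[symmetric] mult_single)
qed (simp_all add: algebra_simps single_add)

lemma (in k_monoid_hom) alg_eval_hom:
  "alg_eval M h \<in> algebra_homs ring_of_type_algebra monoid_algebra M"
proof (intro algebra_homsI module_homsI)
  fix c f
  show "alg_eval M h (c \<odot>\<^bsub>monoid_algebra\<^esub> f) = c \<odot>\<^bsub>M\<^esub> alg_eval M h f"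
    using smult_mult_left[of c "\<one>\<^bsub>M\<^esub>" "alg_eval M h f"]
    by (simp add: alg_eval_mult alg_eval_const)
qed (simp_all add: alg_eval_add alg_eval_mult alg_eval_one)

locale nodal_tensor = nodal q p for q p :: "'k::field_char_0"
begin

sublocale AA: two_algebras kk A A
  by (simp add: two_algebras_def A.associative_algebra_axioms)

sublocale TA: k_algebra "tensor_algebra kk A A"
  by (simp add: k_algebra_def AA.TA.associative_algebra_axioms)

definition word_tensor :: "gen free_monoid \<times> gen free_monoid \<Rightarrow> ((gen, 'k) free_alg set \<times> (gen, 'k) free_alg set \<Rightarrow>\<^sub>0 int) set" where
  "word_tensor w = AA.pt (j (cl (Poly_Mapping.single (fst w) 1))) (j (cl (Poly_Mapping.single (snd w) 1)))"

sublocale E: k_monoid_hom "tensor_algebra kk A A" word_tensor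
proof
  have s: "Poly_Mapping.single (w + w') 1 = Poly_Mapping.single w 1 * (Poly_Mapping.single w' 1 :: (gen, 'k) free_alg)" for w w'
    by (simp add: mult_single)
  show "word_tensor w \<in> carrier (tensor_algebra kk A A)" for w
    by (simp add: word_tensor_def j_simps)
  show "word_tensor 0 = \<one>\<^bsub>tensor_algebra kk A A\<^esub>"
    by (simp add: word_tensor_def ring_mapD[OF cl_ring_map] j_simps)
  show "word_tensor (w + w') = word_tensor w \<otimes>\<^bsub>tensor_algebra kk A A\<^esub> word_tensor w'" for w w'
    by (simp add: word_tensor_def s ring_mapD[OF cl_ring_map] j_simps AA.mult_pure)
qed

abbreviation "E \<equiv> alg_eval (tensor_algebra kk A A) word_tensor"
abbreviation (input) "MA \<equiv> (monoid_algebra :: ('k, gen free_monoid \<times> gen free_monoid \<Rightarrow>\<^sub>0 'k) module)"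

lemma MA: "k_algebra MA"
  by (simp add: k_algebra_def monoid_algebra_associative)

definition embL :: "(gen, 'k) free_alg \<Rightarrow> (gen free_monoid \<times> gen free_monoid \<Rightarrow>\<^sub>0 'k)" where
  "embL = free_eval MA (\<lambda>g. Poly_Mapping.single (Word [g], 0) 1)"

definition embR :: "(gen, 'k) free_alg \<Rightarrow> (gen free_monoid \<times> gen free_monoid \<Rightarrow>\<^sub>0 'k)" where
  "embR = free_eval MA (\<lambda>g. Poly_Mapping.single (0, Word [g]) 1)"

lemma emb_hom: "embL \<in> algebra_homs kk free_algebra MA" "embR \<in> algebra_homs kk free_algebra MA"
  unfolding embL_def embR_def by (rule k_algebra.free_eval_hom[OF MA]; simp)+

lemma emb_var: "embL (fvar g) = Poly_Mapping.single (Word [g], 0) 1" "embR (fvar g) = Poly_Mapping.single (0, Word [g]) 1"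
  unfolding embL_def embR_def by (rule k_algebra.free_eval_var[OF MA]; simp)+

lemmas emb_ring_map = emb_hom[THEN algebra_hom_ring_map]

lemma emb_const: "embL (fconst c) = Poly_Mapping.single 0 c" "embR (fconst c) = Poly_Mapping.single 0 c"
  using emb_hom[THEN algebra_hom_const, of c] by simp_all

lemma emb_commute: "embR f * embL g = embL g * embR f"
proof (induction f rule: free_alg_induct)
  case (var t)
  show ?case
  proof (induction g rule: free_alg_induct)
    case (var t')
    show ?case by (simp add: emb_var mult_single)
  next
    case (mult f h)
    then show ?case
      using commute_left[OF mult(1)] by (simp only: ring_mapD(4)[OF emb_ring_map(1)] mult.assoc)
  qed (simp_all add: emb_const single_zero_commute ring_mapD[OF emb_ring_map(1)] algebra_simps)
next
  case (mult f h)
  then show ?case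
    using commute_left[OF mult(1)[symmetric]] by (simp only: ring_mapD(4)[OF emb_ring_map(2)] mult.assoc)
qed (simp_all add: emb_const single_zero_commute ring_mapD[OF emb_ring_map(2)] algebra_simps)

lemma j_const: "j (cl (fconst c)) = c \<odot>\<^bsub>A\<^esub> \<one>\<^bsub>A\<^esub>"
  using j_simps(5)[of c 1] j_simps(4) by simp

lemma j_scalar_mult: "j (cl (fconst c)) \<otimes>\<^bsub>A\<^esub> j r = c \<odot>\<^bsub>A\<^esub> j r"
  using j_simps(3)[of "cl (fconst c)" r] j_simps(5)[of c r] by simp

lemma pure_left_hom: "(\<lambda>f. AA.pt (j (cl f)) \<one>\<^bsub>A\<^esub>) \<in> algebra_homs kk free_algebra AA.TA"
  by (intro algebra_homsI module_homsI)
    (simp_all add: j_simps j_scalar_mult ring_mapD[OF cl_ring_map] AA.pure_add_left AA.mult_pure AA.smult_pure)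

lemma pure_right_hom: "(\<lambda>f. AA.pt \<one>\<^bsub>A\<^esub> (j (cl f))) \<in> algebra_homs kk free_algebra AA.TA"
  by (intro algebra_homsI module_homsI)
    (simp_all add: j_simps j_scalar_mult ring_mapD[OF cl_ring_map] AA.pure_add_right AA.mult_pure AA.smult_pure
      flip: AA.pure_smult)

lemma E_emb: "E (embL f) = AA.pt (j (cl f)) \<one>\<^bsub>A\<^esub>" "E (embR f) = AA.pt \<one>\<^bsub>A\<^esub> (j (cl f))"
proof -
  show "E (embL f) = AA.pt (j (cl f)) \<one>\<^bsub>A\<^esub>"
    by (rule free_algebra_hom_unique[OF algebra_homs_comp[OF emb_hom(1) E.alg_eval_hom] pure_left_hom])
      (simp add: emb_var E.alg_eval_single word_tensor_def j_simps ring_mapD(2)[OF cl_ring_map] TA.one_smult[simplified]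
        flip: fvar_def)
  show "E (embR f) = AA.pt \<one>\<^bsub>A\<^esub> (j (cl f))"
    by (rule free_algebra_hom_unique[OF algebra_homs_comp[OF emb_hom(2) E.alg_eval_hom] pure_right_hom])
      (simp add: emb_var E.alg_eval_single word_tensor_def j_simps ring_mapD(2)[OF cl_ring_map] TA.one_smult[simplified]
        flip: fvar_def)
qed

lemma E_emb_mult: "E (embL f * embR g) = AA.pt (j (cl f)) (j (cl g))"
  by (simp add: E.alg_eval_mult E_emb AA.mult_pure j_simps)

definition comult_gen :: "gen \<Rightarrow> (gen free_monoid \<times> gen free_monoid \<Rightarrow>\<^sub>0 'k)" where
  "comult_gen g =
    (if g = Gx then embR (fvar Gx) + embL (fvar Gx) * embR (fvar Ga)
     else if g = Gy then embR (fvar Gy) + embL (fvar Gy) * embR (fvar Gb)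
     else embL (fvar g) * embR (fvar g))"

definition comult_free :: "(gen, 'k) free_alg \<Rightarrow> (gen free_monoid \<times> gen free_monoid \<Rightarrow>\<^sub>0 'k)" where
  "comult_free = free_eval MA comult_gen"

lemma comult_free_hom: "comult_free \<in> algebra_homs kk free_algebra MA"
  unfolding comult_free_def by (rule k_algebra.free_eval_hom[OF MA]) simp

lemma comult_free_var: "comult_free (fvar g) = comult_gen g"
  unfolding comult_free_def by (rule k_algebra.free_eval_var[OF MA]) simp

lemma comult_free_rel:
  assumes "r \<in> shifted_set (fvar Gx) (fvar Gy) (fvar Ga) (fvar Gainv) (fvar Gb)"
  shows "E (comult_free r) = \<zero>\<^bsub>AA.TA\<^esub>"
proof -
  let ?K = "{r. E r = \<zero>\<^bsub>AA.TA\<^esub>}"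
  interpret K: two_sided_ideal ?K
    by unfold_locales (auto simp: E.alg_eval_zero E.alg_eval_add E.alg_eval_mult
      simp del: tensor_algebra_simps)
  have rel0: "j (cl r) = \<zero>\<^bsub>A\<^esub>" if "r \<in> shifted_set (fvar Gx) (fvar Gy) (fvar Ga) (fvar Gainv) (fvar Gb)" for r
  proof -
    have "r - 0 \<in> shifted_ideal" using that shifted_ideal_gens by auto
    then have "cl r = cl 0" by (simp only: cl_eq_iff)
    then show ?thesis by (simp add: ring_mapD[OF cl_ring_map] j_simps)
  qed
  have L: "shifted_set (embL (fvar Gx)) (embL (fvar Gy)) (embL (fvar Ga)) (embL (fvar Gainv)) (embL (fvar Gb)) \<subseteq> ?K"
    unfolding ring_map_shifted_set[OF emb_ring_map(1), symmetric]
    using rel0 AA.pure_zero_left[of "\<one>\<^bsub>A\<^esub>"] by (intro image_subsetI) (simp add: E_emb)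
  have R: "shifted_set (embR (fvar Gx)) (embR (fvar Gy)) (embR (fvar Ga)) (embR (fvar Gainv)) (embR (fvar Gb)) \<subseteq> ?K"
    unfolding ring_map_shifted_set[OF emb_ring_map(2), symmetric]
    using rel0 AA.pure_smult[of 0 "\<one>\<^bsub>A\<^esub>" "\<one>\<^bsub>A\<^esub>"] AA.pure_zero_left[of "\<one>\<^bsub>A\<^esub>"]
    by (intro image_subsetI) (simp add: E_emb)
  have "shifted_set (comult_gen Gx) (comult_gen Gy) (comult_gen Ga) (comult_gen Gainv) (comult_gen Gb) \<subseteq> ?K"
  proof -
    have "shifted_set (embR (fvar Gx) + embL (fvar Gx) * embR (fvar Ga)) (embR (fvar Gy) + embL (fvar Gy) * embR (fvar Gb))
        (embL (fvar Ga) * embR (fvar Ga)) (embL (fvar Gainv) * embR (fvar Gainv)) (embL (fvar Gb) * embR (fvar Gb)) \<subseteq> ?K"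
    proof (rule K.shifted_set_tensor[OF L R])
      fix f g
      assume "f \<in> {embL (fvar Gx), embL (fvar Gy), embL (fvar Ga), embL (fvar Gainv), embL (fvar Gb)}"
        "g \<in> {embR (fvar Gx), embR (fvar Gy), embR (fvar Ga), embR (fvar Gainv), embR (fvar Gb)}"
      then obtain s t where "f = embL s" "g = embR t" by blast
      then show "g * f = f * g" by (simp only: emb_commute)
    qed
    then show ?thesis by (simp only: comult_gen_def gen.distinct if_True if_False simp_thms)
  qed
  moreover have "comult_free r \<in> comult_free ` shifted_set (fvar Gx) (fvar Gy) (fvar Ga) (fvar Gainv) (fvar Gb)"
    using assms by (rule imageI)
  then have "comult_free r \<in> shifted_set (comult_gen Gx) (comult_gen Gy) (comult_gen Ga) (comult_gen Gainv) (comult_gen Gb)"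
    by (simp add: ring_map_shifted_set[OF algebra_hom_ring_map[OF comult_free_hom]] comult_free_var)
  ultimately show ?thesis by auto
qed

definition inv_j where "inv_j = inv_into UNIV j"

lemma inv_j_j [simp]: "inv_j (j r) = r"
  unfolding inv_j_def by (rule inv_f_f) (simp add: inj_def j_eq_iff)

lemma inv_j_hom: "inv_j \<in> algebra_homs kk A NA"
proof (intro algebra_homsI module_homsI)
  fix x y assume "x \<in> carrier A" "y \<in> carrier A"
  then obtain r s where rs: "x = j r" "y = j s" by (auto simp: carrier_A)
  show "inv_j (x \<oplus>\<^bsub>A\<^esub> y) = inv_j x \<oplus>\<^bsub>NA\<^esub> inv_j y" "inv_j (x \<otimes>\<^bsub>A\<^esub> y) = inv_j x \<otimes>\<^bsub>NA\<^esub> inv_j y"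
    unfolding rs j_simps(2,3)[symmetric] by simp_all
next
  fix c x assume "x \<in> carrier A"
  then obtain r where r: "x = j r" by (auto simp: carrier_A)
  show "inv_j (c \<odot>\<^bsub>A\<^esub> x) = c \<odot>\<^bsub>NA\<^esub> inv_j x"
    unfolding r j_simps(5)[symmetric] by (simp add: scale_def)
next
  show "inv_j \<one>\<^bsub>A\<^esub> = \<one>\<^bsub>NA\<^esub>"
    unfolding j_simps(4)[symmetric] by simp
qed simp

lemma comult_exists:
  obtains \<Delta> where "\<Delta> \<in> algebra_homs kk A AA.TA" "\<And>f. \<Delta> (j (cl f)) = E (comult_free f)"
proof -
  let ?v = "\<lambda>g. E (comult_gen g)"
  have v: "?v g \<in> carrier AA.TA" for g by (rule E.alg_eval_closed)
  have e: "free_eval AA.TA ?v f = E (comult_free f)" for f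
    by (rule free_algebra_hom_unique[OF TA.free_eval_hom[OF v] algebra_homs_comp[OF comult_free_hom E.alg_eval_hom]])
      (simp only: TA.free_eval_var[OF v] comult_free_var)
  obtain D where D: "D \<in> algebra_homs kk NA AA.TA" "\<And>f. D (cl f) = free_eval AA.TA ?v f"
  proof (rule NA_hom_exists[of AA.TA ?v])
    show "free_eval AA.TA ?v r = \<zero>\<^bsub>AA.TA\<^esub>"
      if "r \<in> shifted_set (fvar Gx) (fvar Gy) (fvar Ga) (fvar Gainv) (fvar Gb)" for r
      unfolding e by (rule comult_free_rel[OF that])
  qed (use v TA.k_algebra_axioms in blast)+
  show thesis
    by (rule that[of "\<lambda>x. D (inv_j x)"]) (simp_all add: algebra_homs_comp[OF inv_j_hom D(1)] D(2) e)
qed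

end

lemma tensor_map_tensor_algebra2:
  "tensor_map R (tensor_algebra R A B) N f g = tensor_map R (tensor_module R A B) N f g"
  "tensor_map R M (tensor_algebra R A B) f' g' = tensor_map R M (tensor_module R A B) f' g'"
  by (simp_all add: tensor_map_def)

lemma (in nodal) A_hom_unique:
  assumes "f \<in> algebra_homs kk A M" "g \<in> algebra_homs kk A M"
    and "\<And>t. f (j (cl (fvar t))) = g (j (cl (fvar t)))" and "z \<in> carrier A"
  shows "f z = g z"
proof -
  obtain r where z: "z = j r" using assms(4) by (auto simp: carrier_A)
  show ?thesis
    unfolding z
    by (rule NA_hom_unique[OF algebra_homs_comp[OF j(1) assms(1)] algebra_homs_comp[OF j(1) assms(2)]])
      (rule assms(3))
qed

lemma id_algebra_hom: "(\<lambda>x. x) \<in> algebra_homs R A A"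
  by (intro algebra_homsI module_homsI) simp_all

lemma regular_module_type: "regular_module (kk :: 'k::field ring) = algebra_of_type (*)"
  by (simp add: regular_module_def ring_of_type_algebra_def algebra_of_type_def)

lemma regular_module_associative: "associative_algebra kk (regular_module (kk :: 'k::field ring))"
  unfolding regular_module_type by (rule associative_algebra_of_type) (simp_all add: algebra_simps)

context nodal_tensor
begin

definition counit_gen :: "gen \<Rightarrow> 'k" where
  "counit_gen g = (if g = Gx \<or> g = Gy then 0 else 1)"

lemma counit_exists:
  obtains \<epsilon> where "\<epsilon> \<in> algebra_homs kk A (regular_module kk)"
    "\<And>g. \<epsilon> (j (cl (fvar g))) = counit_gen g"
proof -
  let ?M = "algebra_of_type ((*) :: 'k \<Rightarrow> 'k \<Rightarrow> 'k)"
  have M: "k_algebra ?M"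
    using regular_module_associative by (simp add: k_algebra_def regular_module_type)
  interpret M: k_algebra ?M by (rule M)
  have h: "free_eval ?M counit_gen \<in> algebra_homs kk free_algebra ?M" by (rule M.free_eval_hom) simp
  have var: "free_eval ?M counit_gen (fvar g) = counit_gen g" for g by (rule M.free_eval_var) simp
  have "free_eval ?M counit_gen ` shifted_set (fvar Gx) (fvar Gy) (fvar Ga) (fvar Gainv) (fvar Gb) \<subseteq> {0}"
    unfolding ring_map_shifted_set[OF algebra_hom_ring_map[OF h]] var
    by (simp add: shifted_set_def counit_gen_def)
  then have rel: "free_eval ?M counit_gen r = \<zero>\<^bsub>?M\<^esub>"
    if "r \<in> shifted_set (fvar Gx) (fvar Gy) (fvar Ga) (fvar Gainv) (fvar Gb)" for r
    using that by auto
  obtain e where e: "e \<in> algebra_homs kk NA ?M" "\<And>f. e (cl f) = free_eval ?M counit_gen f"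
    using NA_hom_exists[of ?M counit_gen, OF M _ rel] by auto
  show thesis
    by (rule that[of "\<lambda>x. e (inv_j x)"])
      (use algebra_homs_comp[OF inv_j_hom e(1)] in \<open>simp_all add: e(2) var regular_module_type\<close>)
qed

definition antipode_gen :: "gen \<Rightarrow> 'k shifted_alg" where
  "antipode_gen g =
    (case g of Gx \<Rightarrow> - (nu * na') | Gy \<Rightarrow> - (nz * NA.b') | Ga \<Rightarrow> na' | Gainv \<Rightarrow> na | Gb \<Rightarrow> NA.b')"

lemma antipode_exists:
  obtains S where "S \<in> module_homs kk A A" "S \<one>\<^bsub>A\<^esub> = \<one>\<^bsub>A\<^esub>"
    "\<And>x y. \<lbrakk>x \<in> carrier A; y \<in> carrier A\<rbrakk> \<Longrightarrow> S (x \<otimes>\<^bsub>A\<^esub> y) = S y \<otimes>\<^bsub>A\<^esub> S x"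
    "\<And>g. S (j (cl (fvar g))) = j (antipode_gen g)"
proof -
  let ?M = "opposite_algebra (NA :: ('k, 'k shifted_alg) module)"
  have M: "k_algebra ?M"
    by (simp add: k_algebra_def opposite_associative_algebra NA_associative)
  interpret M: k_algebra ?M by (rule M)
  define s where "s = free_eval ?M antipode_gen"
  have h: "s \<in> algebra_homs kk free_algebra ?M" unfolding s_def by (rule M.free_eval_hom) simp
  have var: "s (fvar g) = antipode_gen g" for g unfolding s_def by (rule M.free_eval_var) simp
  note D = algebra_homsD[OF h, simplified]
  have s0: "s 0 = 0" using D(3)[of 0 0] by simp
  have sm: "s (f - g) = s f - s g" for f g using D(3)[of "f - g" g] by (simp add: algebra_simps)
  have "s (of_nat n) = of_nat n" for n by (induction n) (simp_all add: s0 D)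
  from this[of "numeral n" for n] have sn: "s (numeral n) = numeral n" for n by simp
  let ?U = "antipode_gen Gx" and ?Z = "antipode_gen Gy" and ?a = "antipode_gen Ga"
    and ?a' = "antipode_gen Gainv" and ?b = "antipode_gen Gb"
  have ar: "?b * ?b = ?a * ?a * ?a" "?a * ?b = ?b * ?a" "?a * ?Z = ?Z * ?a" "?U * ?b = ?b * ?U" "?U * ?Z = ?Z * ?U"
    "?Z * ?b = - (?b * ?Z)" "?U * ?a * ?a + ?a * ?U * ?a + ?a * ?a * ?U = 0"
    "?U * ?U * ?a + ?U * ?a * ?U + ?a * ?U * ?U = 3 * (?a - ?a * ?a * ?a)"
    "27 * (?Z * ?Z) = ?U * ?U * ?U - 3 * ?U + 2 - 2 * (?a * ?a * ?a)" "?a' * ?a = 1" "?a * ?a' = 1"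
    unfolding antipode_gen_def gen.case by (rule NA.antipode_relations NA.cancel)+
  note S = sm sn D(3,4,6) var mult.assoc numeral_commute
  have "s (fvar Ga * fvar Gainv - 1) = 0" "s (fvar Gainv * fvar Ga - 1) = 0"
    using ar(10,11) by (simp_all add: S)
  moreover have "s (fvar Gb * fvar Gb - fvar Ga * fvar Ga * fvar Ga) = 0" using ar(1) by (simp add: S)
  moreover have "s (fvar Gb * fvar Ga - fvar Ga * fvar Gb) = 0" using ar(2) by (simp add: S)
  moreover have "s (fvar Gy * fvar Ga - fvar Ga * fvar Gy) = 0" using ar(3) by (simp add: S)
  moreover have "s (fvar Gb * fvar Gx - fvar Gx * fvar Gb) = 0" using ar(4) by (simp add: S)
  moreover have "s (fvar Gy * fvar Gx - fvar Gx * fvar Gy) = 0" using ar(5) by (simp add: S)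
  moreover have "s (fvar Gb * fvar Gy + fvar Gy * fvar Gb) = 0" using ar(6) by (simp add: S)
  moreover have "s (fvar Ga * fvar Ga * fvar Gx + fvar Ga * fvar Gx * fvar Ga + fvar Gx * fvar Ga * fvar Ga) = 0"
    using ar(7) by (simp add: S)
  moreover have "s (fvar Ga * fvar Gx * fvar Gx + fvar Gx * fvar Ga * fvar Gx + fvar Gx * fvar Gx * fvar Ga
      - 3 * (fvar Ga - fvar Ga * fvar Ga * fvar Ga)) = 0"
    using ar(8) by (simp add: S algebra_simps)
  moreover have "s (27 * (fvar Gy * fvar Gy) - (fvar Gx * fvar Gx * fvar Gx - 3 * fvar Gx + 2 - 2 * (fvar Ga * fvar Ga * fvar Ga))) = 0"
    using ar(9) by (simp add: S)
  ultimately have rel: "free_eval ?M antipode_gen r = \<zero>\<^bsub>?M\<^esub>"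
    if "r \<in> shifted_set (fvar Gx) (fvar Gy) (fvar Ga) (fvar Gainv) (fvar Gb)" for r
    using that unfolding shifted_set_def s_def[symmetric] opposite_algebra_simps algebra_of_type_simps by blast
  obtain e where e: "e \<in> algebra_homs kk NA ?M" "\<And>f. e (cl f) = free_eval ?M antipode_gen f"
    using NA_hom_exists[of ?M antipode_gen, OF M _ rel] by auto
  note De = algebra_homsD[OF e(1), simplified]
  show thesis
  proof (rule that[of "\<lambda>x. j (e (inv_j x))"])
    show "(\<lambda>x. j (e (inv_j x))) \<in> module_homs kk A A"
    proof (rule module_homsI)
      fix c x assume "x \<in> carrier A"
      then obtain r where r: "x = j r" by (auto simp: carrier_A)
      show "j (e (inv_j (c \<odot>\<^bsub>A\<^esub> x))) = c \<odot>\<^bsub>A\<^esub> j (e (inv_j x))"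
        using De(5)[of c r] by (simp add: r scale_def flip: j_simps(5))
    next
      fix x y assume "x \<in> carrier A" "y \<in> carrier A"
      then obtain r s where "x = j r" "y = j s" by (auto simp: carrier_A)
      then show "j (e (inv_j (x \<oplus>\<^bsub>A\<^esub> y))) = j (e (inv_j x)) \<oplus>\<^bsub>A\<^esub> j (e (inv_j y))"
        by (simp add: De flip: j_simps(2))
    qed (simp add: j_simps)
    show "j (e (inv_j \<one>\<^bsub>A\<^esub>)) = \<one>\<^bsub>A\<^esub>"
      by (simp add: De flip: j_simps(4))
    fix x y assume "x \<in> carrier A" "y \<in> carrier A"
    then obtain r s where "x = j r" "y = j s" by (auto simp: carrier_A)
    then show "j (e (inv_j (x \<otimes>\<^bsub>A\<^esub> y))) = j (e (inv_j y)) \<otimes>\<^bsub>A\<^esub> j (e (inv_j x))"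
      by (simp add: De flip: j_simps(3))
  next
    show "j (e (inv_j (j (cl (fvar g))))) = j (antipode_gen g)" for g
      by (simp add: e(2) s_def[symmetric] var)
  qed
qed

end

locale nodal_maps = nodal_tensor q p for q p :: "'k::field_char_0" +
  fixes \<Delta> \<epsilon> S
  assumes \<Delta>: "\<Delta> \<in> algebra_homs kk A AA.TA" and \<Delta>_eq: "\<And>f. \<Delta> (j (cl f)) = E (comult_free f)"
    and \<epsilon>: "\<epsilon> \<in> algebra_homs kk A (regular_module kk)"
    and \<epsilon>_gen: "\<And>g. \<epsilon> (j (cl (fvar g))) = counit_gen g"
    and S: "S \<in> module_homs kk A A" and S_one: "S \<one>\<^bsub>A\<^esub> = \<one>\<^bsub>A\<^esub>"
    and S_mult: "\<And>x y. \<lbrakk>x \<in> carrier A; y \<in> carrier A\<rbrakk> \<Longrightarrow> S (x \<otimes>\<^bsub>A\<^esub> y) = S y \<otimes>\<^bsub>A\<^esub> S x"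
    and S_gen: "\<And>g. S (j (cl (fvar g))) = j (antipode_gen g)"
begin

lemma \<Delta>_gens:
  "\<Delta> (j nu) = AA.pt \<one>\<^bsub>A\<^esub> (j nu) \<oplus>\<^bsub>AA.T\<^esub> AA.pt (j nu) (j na)"
  "\<Delta> (j nz) = AA.pt \<one>\<^bsub>A\<^esub> (j nz) \<oplus>\<^bsub>AA.T\<^esub> AA.pt (j nz) (j nb)"
  "\<Delta> (j na) = AA.pt (j na) (j na)" "\<Delta> (j na') = AA.pt (j na') (j na')" "\<Delta> (j nb) = AA.pt (j nb) (j nb)"
  by (simp_all add: \<Delta>_eq comult_free_var comult_gen_def E_emb_mult E_emb E.alg_eval_add)

lemma \<epsilon>_simps: "\<epsilon> (j (r + s)) = \<epsilon> (j r) + \<epsilon> (j s)" "\<epsilon> (j (r * s)) = \<epsilon> (j r) * \<epsilon> (j s)"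
    "\<epsilon> (j 1) = 1" "\<epsilon> (j (cl (fconst c))) = c"
proof -
  note D = algebra_homsD[OF \<epsilon>, unfolded regular_module_type, simplified]
  show "\<epsilon> (j (r + s)) = \<epsilon> (j r) + \<epsilon> (j s)" "\<epsilon> (j (r * s)) = \<epsilon> (j r) * \<epsilon> (j s)" "\<epsilon> (j 1) = 1"
    by (simp_all add: j_simps D)
  show "\<epsilon> (j (cl (fconst c))) = c"
    using D(5)[of "\<one>\<^bsub>A\<^esub>" c] D(6) by (simp add: j_const)
qed

lemma coassociative:
  assumes "z \<in> carrier A"
  shows "tensor_assoc kk A A A (tensor_map kk (tensor_module kk A A) A \<Delta> (\<lambda>u. u) (\<Delta> z)) =
    tensor_map kk A (tensor_module kk A A) (\<lambda>u. u) \<Delta> (\<Delta> z)"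
proof -
  interpret AAA: three_algebras kk A A A
    by (simp add: three_algebras_def A.associative_algebra_axioms)
  note id = id_algebra_hom[of kk A]
  note t1 = tensor_map_algebra_hom[OF AA.two_algebras_axioms AAA.AB_C.two_algebras_axioms \<Delta> id]
  note t2 = tensor_map_algebra_hom[OF AA.two_algebras_axioms AAA.A_BC.two_algebras_axioms id \<Delta>]
  note p1 = tensor_map_pure[OF AA.tensor_product_axioms AAA.AB_C.tensor_product_axioms
      algebra_homsD(1)[OF \<Delta>] algebra_homsD(1)[OF id], unfolded tensor_map_tensor_algebra2 tensor_module_tensor_algebra]
  note p2 = tensor_map_pure[OF AA.tensor_product_axioms AAA.A_BC.tensor_product_axioms
      algebra_homsD(1)[OF id] algebra_homsD(1)[OF \<Delta>], unfolded tensor_map_tensor_algebra2 tensor_module_tensor_algebra]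
  note D1 = algebra_homsD[OF t1, unfolded tensor_map_tensor_algebra2 tensor_module_tensor_algebra tensor_algebra_simps]
  note D2 = algebra_homsD[OF t2, unfolded tensor_map_tensor_algebra2 tensor_module_tensor_algebra tensor_algebra_simps]
  note as = AAA.tensor_assoc_pure[unfolded tensor_map_tensor_algebra2 tensor_module_tensor_algebra]
  note Da = algebra_homsD[OF AAA.tensor_assoc_hom, unfolded tensor_map_tensor_algebra2 tensor_module_tensor_algebra tensor_algebra_simps]
  note pl = AAA.AB_C.pure_add_left[unfolded tensor_map_tensor_algebra2 tensor_module_tensor_algebra tensor_algebra_simps]
  note pr = AAA.A_BC.pure_add_right[unfolded tensor_map_tensor_algebra2 tensor_module_tensor_algebra tensor_algebra_simps]
  note cl1 = AAA.AB_C.pure_closed[unfolded tensor_map_tensor_algebra2 tensor_module_tensor_algebra tensor_algebra_simps]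
  note cl2 = AAA.A_BC.pure_closed[unfolded tensor_map_tensor_algebra2 tensor_module_tensor_algebra tensor_algebra_simps]
  note ca = AAA.AB_C.T.a_closed[unfolded tensor_module_tensor_algebra tensor_algebra_simps]
    AAA.A_BC.T.a_closed[unfolded tensor_module_tensor_algebra tensor_algebra_simps]
  note asm = AAA.A_BC.T.a_assoc[unfolded tensor_map_tensor_algebra2 tensor_module_tensor_algebra tensor_algebra_simps]
  have \<Delta>1: "\<Delta> \<one>\<^bsub>A\<^esub> = AA.pt \<one>\<^bsub>A\<^esub> \<one>\<^bsub>A\<^esub>"
    using algebra_homsD(6)[OF \<Delta>] by simp
  show ?thesis
  proof (rule A_hom_unique[of "\<lambda>z. tensor_assoc kk A A A (tensor_map kk (tensor_module kk A A) A \<Delta> (\<lambda>u. u) (\<Delta> z))"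
        AAA.A_BC.TA "\<lambda>z. tensor_map kk A (tensor_module kk A A) (\<lambda>u. u) \<Delta> (\<Delta> z)", OF _ _ _ assms])
    show "(\<lambda>z. tensor_assoc kk A A A (tensor_map kk (tensor_module kk A A) A \<Delta> (\<lambda>u. u) (\<Delta> z)))
        \<in> algebra_homs kk A AAA.A_BC.TA"
      using algebra_homs_comp[OF algebra_homs_comp[OF \<Delta> t1] AAA.tensor_assoc_hom]
      unfolding tensor_map_tensor_algebra2 .
    show "(\<lambda>z. tensor_map kk A (tensor_module kk A A) (\<lambda>u. u) \<Delta> (\<Delta> z)) \<in> algebra_homs kk A AAA.A_BC.TA"
      using algebra_homs_comp[OF \<Delta> t2] unfolding tensor_map_tensor_algebra2 .
    show "tensor_assoc kk A A A (tensor_map kk (tensor_module kk A A) A \<Delta> (\<lambda>u. u) (\<Delta> (j (cl (fvar t))))) =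
        tensor_map kk A (tensor_module kk A A) (\<lambda>u. u) \<Delta> (\<Delta> (j (cl (fvar t))))" for t
      by (cases t)
        (simp_all add: \<Delta>_gens D1 D2 p1 p2 as Da pl pr cl1 cl2 \<Delta>1 j_simps asm ca)
  qed
qed

lemma counit_balanced:
  "balanced_map kk A A A (\<lambda>u v. \<epsilon> u \<odot>\<^bsub>A\<^esub> v)" "balanced_map kk A A A (\<lambda>u v. \<epsilon> v \<odot>\<^bsub>A\<^esub> u)"
proof -
  note D = algebra_homsD[OF \<epsilon>, unfolded regular_module_type, simplified]
  have s: "(c * d) \<odot>\<^bsub>A\<^esub> x = c \<odot>\<^bsub>A\<^esub> (d \<odot>\<^bsub>A\<^esub> x)" "(c + d) \<odot>\<^bsub>A\<^esub> x = c \<odot>\<^bsub>A\<^esub> x \<oplus>\<^bsub>A\<^esub> d \<odot>\<^bsub>A\<^esub> x"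
    if "x \<in> carrier A" for c d x
    using A.smult_assoc1[of c d x] A.smult_l_distr[of c d x] that by simp_all
  have s': "c \<odot>\<^bsub>A\<^esub> (d \<odot>\<^bsub>A\<^esub> x) = d \<odot>\<^bsub>A\<^esub> (c \<odot>\<^bsub>A\<^esub> x)" if "x \<in> carrier A" for c d x
    using that by (simp flip: s add: mult.commute)
  show "balanced_map kk A A A (\<lambda>u v. \<epsilon> u \<odot>\<^bsub>A\<^esub> v)"
    by (rule AA.balanced_mapI[OF A.module_axioms]) (simp_all add: D s s' A.smult_r_distr)
  show "balanced_map kk A A A (\<lambda>u v. \<epsilon> v \<odot>\<^bsub>A\<^esub> u)"
    by (rule AA.balanced_mapI[OF A.module_axioms]) (simp_all add: D s s' A.smult_r_distr)
qed

lemma is_add_group_A: "is_add_group (add_monoid A) A"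
  by (rule is_add_group_add_monoid[OF A.M.abelian_group_axioms])

lemma counit_hom:
  "tensor_lift (add_monoid A) (\<lambda>u v. \<epsilon> u \<odot>\<^bsub>A\<^esub> v) \<in> algebra_homs kk AA.TA A"
  "tensor_lift (add_monoid A) (\<lambda>u v. \<epsilon> v \<odot>\<^bsub>A\<^esub> u) \<in> algebra_homs kk AA.TA A"
proof -
  note D = algebra_homsD[OF \<epsilon>, unfolded regular_module_type, simplified]
  have m: "(c \<odot>\<^bsub>A\<^esub> x) \<otimes>\<^bsub>A\<^esub> (d \<odot>\<^bsub>A\<^esub> y) = (c * d) \<odot>\<^bsub>A\<^esub> (x \<otimes>\<^bsub>A\<^esub> y)"
    if "x \<in> carrier A" "y \<in> carrier A" for c d x y
    using that A.smult_assoc1[of c d "x \<otimes>\<^bsub>A\<^esub> y"] A.smult_mult_left[of c x "d \<odot>\<^bsub>A\<^esub> y"] A.smult_mult_right[of d x y]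
    by simp
  have s: "(c * d) \<odot>\<^bsub>A\<^esub> x = c \<odot>\<^bsub>A\<^esub> (d \<odot>\<^bsub>A\<^esub> x)" if "x \<in> carrier A" for c d x
    using A.smult_assoc1[of c d x] that by simp
  note L = AA.lift_module_hom[OF A.module_axioms is_add_group_A]
    and P = AA.lift_pure[OF is_add_group_A]
  show "tensor_lift (add_monoid A) (\<lambda>u v. \<epsilon> u \<odot>\<^bsub>A\<^esub> v) \<in> algebra_homs kk AA.TA A"
    by (rule AA.algebra_homsI_TA[OF L[OF counit_balanced(1)] A.associative_algebra_axioms])
      (simp_all add: P[OF counit_balanced(1)] D m s)
  show "tensor_lift (add_monoid A) (\<lambda>u v. \<epsilon> v \<odot>\<^bsub>A\<^esub> u) \<in> algebra_homs kk AA.TA A"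
    by (rule AA.algebra_homsI_TA[OF L[OF counit_balanced(2)] A.associative_algebra_axioms])
      (simp_all add: P[OF counit_balanced(2)] D m mult.commute flip: s)
qed

lemma counital:
  assumes "z \<in> carrier A"
  shows "tensor_lift (add_monoid A) (\<lambda>u v. \<epsilon> u \<odot>\<^bsub>A\<^esub> v) (\<Delta> z) = z"
    and "tensor_lift (add_monoid A) (\<lambda>u v. \<epsilon> v \<odot>\<^bsub>A\<^esub> u) (\<Delta> z) = z"
proof -
  note P = AA.lift_pure[OF is_add_group_A] and Ad = AA.lift_add[OF is_add_group_A]
  have e1: "\<epsilon> \<one>\<^bsub>A\<^esub> = 1" using \<epsilon>_simps(3) by (simp add: j_simps)
  show "tensor_lift (add_monoid A) (\<lambda>u v. \<epsilon> u \<odot>\<^bsub>A\<^esub> v) (\<Delta> z) = z"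
  proof (rule A_hom_unique[OF algebra_homs_comp[OF \<Delta> counit_hom(1)] id_algebra_hom _ assms])
    show "tensor_lift (add_monoid A) (\<lambda>u v. \<epsilon> u \<odot>\<^bsub>A\<^esub> v) (\<Delta> (j (cl (fvar t)))) = j (cl (fvar t))" for t
      by (cases t)
        (simp_all add: \<Delta>_gens P[OF counit_balanced(1)] Ad[OF counit_balanced(1)] j_simps \<epsilon>_gen counit_gen_def e1)
  qed
  show "tensor_lift (add_monoid A) (\<lambda>u v. \<epsilon> v \<odot>\<^bsub>A\<^esub> u) (\<Delta> z) = z"
  proof (rule A_hom_unique[OF algebra_homs_comp[OF \<Delta> counit_hom(2)] id_algebra_hom _ assms])
    show "tensor_lift (add_monoid A) (\<lambda>u v. \<epsilon> v \<odot>\<^bsub>A\<^esub> u) (\<Delta> (j (cl (fvar t)))) = j (cl (fvar t))" for t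
      by (cases t)
        (simp_all add: \<Delta>_gens P[OF counit_balanced(2)] Ad[OF counit_balanced(2)] j_simps \<epsilon>_gen counit_gen_def e1)
  qed
qed

lemma antipode_balanced:
  "balanced_map kk A A A (\<lambda>u v. S u \<otimes>\<^bsub>A\<^esub> v)" "balanced_map kk A A A (\<lambda>u v. u \<otimes>\<^bsub>A\<^esub> S v)"
proof -
  note D = module_homsD[OF S]
  have m: "(c \<odot>\<^bsub>A\<^esub> x) \<otimes>\<^bsub>A\<^esub> y = c \<odot>\<^bsub>A\<^esub> (x \<otimes>\<^bsub>A\<^esub> y)" "x \<otimes>\<^bsub>A\<^esub> (c \<odot>\<^bsub>A\<^esub> y) = c \<odot>\<^bsub>A\<^esub> (x \<otimes>\<^bsub>A\<^esub> y)"
    if "x \<in> carrier A" "y \<in> carrier A" for c x y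
    using that by (simp_all add: A.smult_mult_left A.smult_mult_right)
  show "balanced_map kk A A A (\<lambda>u v. S u \<otimes>\<^bsub>A\<^esub> v)"
    by (rule AA.balanced_mapI[OF A.module_axioms]) (simp_all add: D m A.l_distr A.r_distr)
  show "balanced_map kk A A A (\<lambda>u v. u \<otimes>\<^bsub>A\<^esub> S v)"
    by (rule AA.balanced_mapI[OF A.module_axioms]) (simp_all add: D m A.l_distr A.r_distr)
qed

abbreviation (input) "mS \<equiv> tensor_lift (add_monoid A) (\<lambda>u v. S u \<otimes>\<^bsub>A\<^esub> v)"
abbreviation (input) "mS' \<equiv> tensor_lift (add_monoid A) (\<lambda>u v. u \<otimes>\<^bsub>A\<^esub> S v)"

lemma smult_mult: "(c \<odot>\<^bsub>A\<^esub> x) \<otimes>\<^bsub>A\<^esub> y = c \<odot>\<^bsub>A\<^esub> (x \<otimes>\<^bsub>A\<^esub> y)" "x \<otimes>\<^bsub>A\<^esub> (c \<odot>\<^bsub>A\<^esub> y) = c \<odot>\<^bsub>A\<^esub> (x \<otimes>\<^bsub>A\<^esub> y)"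
  if "x \<in> carrier A" "y \<in> carrier A" for c x y
  using that by (simp_all add: A.smult_mult_left A.smult_mult_right)

lemma mS_mult_pure:
  assumes s: "s \<in> carrier AA.T" and ab: "a \<in> carrier A" "b \<in> carrier A"
  shows "mS (s \<otimes>\<^bsub>AA.TA\<^esub> AA.pt a b) = S a \<otimes>\<^bsub>A\<^esub> mS s \<otimes>\<^bsub>A\<^esub> b"
    and "mS' (AA.pt a b \<otimes>\<^bsub>AA.TA\<^esub> s) = a \<otimes>\<^bsub>A\<^esub> mS' s \<otimes>\<^bsub>A\<^esub> S b"
  using s
proof (induction s rule: AA.tensor_induct)
  case (pure x y)
  {
    case 1
    show ?case
      using ab pure AA.lift_pure[OF is_add_group_A antipode_balanced(1)] module_homsD(1)[OF S]
      by (simp add: AA.mult_pure S_mult A.m_assoc)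
  next
    case 2
    show ?case
      using ab pure AA.lift_pure[OF is_add_group_A antipode_balanced(2)] module_homsD(1)[OF S]
      by (simp add: AA.mult_pure S_mult A.m_assoc)
  }
next
  case (add s t)
  note c = AA.lift_closed[OF is_add_group_A antipode_balanced(1)] AA.lift_closed[OF is_add_group_A antipode_balanced(2)]
  {
    case 1
    show ?case
      using ab add AA.lift_add[OF is_add_group_A antipode_balanced(1)] module_homsD(1)[OF S] c
      by (simp add: AA.l_distr_TA AA.mult_closed_TA A.l_distr A.r_distr)
  next
    case 2
    show ?case
      using ab add AA.lift_add[OF is_add_group_A antipode_balanced(2)] module_homsD(1)[OF S] c
      by (simp add: AA.r_distr_TA AA.mult_closed_TA A.l_distr A.r_distr)
  }
qed

lemma mS_mult:
  assumes s: "s \<in> carrier AA.T" and t: "t \<in> carrier AA.T"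
  shows "mS s = c \<odot>\<^bsub>A\<^esub> \<one>\<^bsub>A\<^esub> \<Longrightarrow> mS (s \<otimes>\<^bsub>AA.TA\<^esub> t) = c \<odot>\<^bsub>A\<^esub> mS t"
    and "mS' s = c \<odot>\<^bsub>A\<^esub> \<one>\<^bsub>A\<^esub> \<Longrightarrow> mS' (t \<otimes>\<^bsub>AA.TA\<^esub> s) = c \<odot>\<^bsub>A\<^esub> mS' t"
  using t
proof (induction t rule: AA.tensor_induct)
  case (pure x y)
  {
    case 1
    then show ?case
      using pure s AA.lift_pure[OF is_add_group_A antipode_balanced(1)] module_homsD(1)[OF S]
      by (simp add: mS_mult_pure smult_mult)
  next
    case 2
    then show ?case
      using pure s AA.lift_pure[OF is_add_group_A antipode_balanced(2)] module_homsD(1)[OF S]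
      by (simp add: mS_mult_pure smult_mult)
  }
next
  case (add t t')
  note c = AA.lift_closed[OF is_add_group_A antipode_balanced(1)] AA.lift_closed[OF is_add_group_A antipode_balanced(2)]
  {
    case 1
    then show ?case
      using s add AA.lift_add[OF is_add_group_A antipode_balanced(1)] c A.smult_r_distr
      by (simp add: AA.r_distr_TA AA.mult_closed_TA)
  next
    case 2
    then show ?case
      using s add AA.lift_add[OF is_add_group_A antipode_balanced(2)] c A.smult_r_distr
      by (simp add: AA.l_distr_TA AA.mult_closed_TA)
  }
qed

lemma antipode:
  assumes "z \<in> carrier A"
  shows "mS (\<Delta> z) = \<epsilon> z \<odot>\<^bsub>A\<^esub> \<one>\<^bsub>A\<^esub>" "mS' (\<Delta> z) = \<epsilon> z \<odot>\<^bsub>A\<^esub> \<one>\<^bsub>A\<^esub>"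
proof -
  note P1 = AA.lift_pure[OF is_add_group_A antipode_balanced(1)] and A1 = AA.lift_add[OF is_add_group_A antipode_balanced(1)]
  note P2 = AA.lift_pure[OF is_add_group_A antipode_balanced(2)] and A2 = AA.lift_add[OF is_add_group_A antipode_balanced(2)]
  note D = algebra_homsD[OF \<Delta>, simplified]
  note M1 = module_homsD[OF AA.lift_module_hom[OF A.module_axioms is_add_group_A antipode_balanced(1)]]
  note M2 = module_homsD[OF AA.lift_module_hom[OF A.module_axioms is_add_group_A antipode_balanced(2)]]
  have "mS (\<Delta> (j r)) = \<epsilon> (j r) \<odot>\<^bsub>A\<^esub> \<one>\<^bsub>A\<^esub> \<and> mS' (\<Delta> (j r)) = \<epsilon> (j r) \<odot>\<^bsub>A\<^esub> \<one>\<^bsub>A\<^esub>" for r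
  proof (induction r rule: shifted_alg_induct)
    case (const c)
    have "\<Delta> (j (cl (fconst c))) = AA.pt (c \<odot>\<^bsub>A\<^esub> \<one>\<^bsub>A\<^esub>) \<one>\<^bsub>A\<^esub>"
      by (simp add: j_const D AA.smult_pure)
    then show ?case
      using module_homsD(1)[OF S] by (simp add: P1 P2 \<epsilon>_simps S_one module_homsD(3)[OF S] smult_mult)
  next
    case (var t)
    have 0: "j nu \<otimes>\<^bsub>A\<^esub> j na' = j (nu * na')" for r s by (simp add: j_simps)
    show ?case
    proof (cases t)
      case Gx
      have "j nu \<oplus>\<^bsub>A\<^esub> j (- (nu * na')) \<otimes>\<^bsub>A\<^esub> j na = \<zero>\<^bsub>A\<^esub>" "j (- (nu * na')) \<oplus>\<^bsub>A\<^esub> j nu \<otimes>\<^bsub>A\<^esub> j na' = \<zero>\<^bsub>A\<^esub>"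
        unfolding j_simps(2,3)[symmetric] by (simp_all add: mult.assoc j_simps(6))
      then show ?thesis
        by (simp add: Gx \<Delta>_gens A1 A2 P1 P2 j_simps(1) S_one S_gen antipode_gen_def \<epsilon>_gen counit_gen_def)
    next
      case Gy
      have "j nz \<oplus>\<^bsub>A\<^esub> j (- (nz * NA.b')) \<otimes>\<^bsub>A\<^esub> j nb = \<zero>\<^bsub>A\<^esub>" "j (- (nz * NA.b')) \<oplus>\<^bsub>A\<^esub> j nz \<otimes>\<^bsub>A\<^esub> j NA.b' = \<zero>\<^bsub>A\<^esub>"
        unfolding j_simps(2,3)[symmetric] by (simp_all add: mult.assoc NA.b'_rels j_simps(6))
      then show ?thesis
        by (simp add: Gy \<Delta>_gens A1 A2 P1 P2 j_simps(1) S_one S_gen antipode_gen_def \<epsilon>_gen counit_gen_def)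
    qed (simp_all add: \<Delta>_gens P1 P2 j_simps(1) S_gen antipode_gen_def \<epsilon>_gen counit_gen_def NA.b'_rels j_simps(4)
        flip: j_simps(3))
  next
    case (add f h)
    then show ?case
      using A.smult_l_distr[of "\<epsilon> (j f)" "\<epsilon> (j h)" "\<one>\<^bsub>A\<^esub>"]
      by (simp add: \<epsilon>_simps(1)[of f h, unfolded j_simps(2)] j_simps(1,2) D A1 A2)
  next
    case (mult f h)
    have c: "\<Delta> (j f) \<in> carrier AA.T" "\<Delta> (j h) \<in> carrier AA.T" by (simp_all add: D j_simps)
    show ?case
      using mult mS_mult(1)[OF c, of "\<epsilon> (j f)"] mS_mult(2)[OF c(2,1), of "\<epsilon> (j h)"]
        A.smult_assoc1[of "\<epsilon> (j f)" "\<epsilon> (j h)" "\<one>\<^bsub>A\<^esub>"] A.smult_assoc1[of "\<epsilon> (j h)" "\<epsilon> (j f)" "\<one>\<^bsub>A\<^esub>"]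
      by (simp add: \<epsilon>_simps(2)[of f h, unfolded j_simps(3)] j_simps(1,3) D mult.commute)
  qed
  then show "mS (\<Delta> z) = \<epsilon> z \<odot>\<^bsub>A\<^esub> \<one>\<^bsub>A\<^esub>" "mS' (\<Delta> z) = \<epsilon> z \<odot>\<^bsub>A\<^esub> \<one>\<^bsub>A\<^esub>"
    using assms by (auto simp: carrier_A)
qed

lemma hopf: "hopf_algebra kk A \<Delta> \<epsilon> S"
  by (intro hopf_algebra.intro hopf_algebra_axioms.intro)
    (simp_all add: A.associative_algebra_axioms \<Delta> \<epsilon> S coassociative counital antipode)

end

context nodal_maps
begin

lemma comult_coordinates:
  "\<Delta> gx = AA.pt \<one>\<^bsub>A\<^esub> (gx \<ominus>\<^bsub>A\<^esub> q \<odot>\<^bsub>A\<^esub> ga) \<oplus>\<^bsub>AA.TA\<^esub> AA.pt gx ga"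
  "\<Delta> gy = AA.pt \<one>\<^bsub>A\<^esub> (gy \<ominus>\<^bsub>A\<^esub> p \<odot>\<^bsub>A\<^esub> gb) \<oplus>\<^bsub>AA.TA\<^esub> AA.pt gy gb"
proof -
  note L = ring_mapD[OF emb_ring_map(1)] and R = ring_mapD[OF emb_ring_map(2)]
    and C = ring_mapD[OF algebra_hom_ring_map[OF comult_free_hom]] and cl = ring_mapD[OF cl_ring_map]
  define K :: "'k \<Rightarrow> (gen free_monoid \<times> gen free_monoid \<Rightarrow>\<^sub>0 'k)" where "K = Poly_Mapping.single 0"
  have e: "embL (fconst c) = K c" "embR (fconst c) = K c" "comult_free (fconst c) = K c" for c
    using algebra_hom_const[OF comult_free_hom, of c] by (simp_all add: K_def emb_const)
  have K: "K (1 / 3) * K (1 + 3 * q) = K q + K (1 / 3)"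
  proof -
    have "K (1 / 3) * K (1 + 3 * q) = K (1 / 3 * (1 + 3 * q))" by (simp add: K_def mult_single)
    also have "1 / 3 * (1 + 3 * q) = q + 1 / 3" by (simp add: field_simps)
    finally show ?thesis by (simp add: K_def single_add)
  qed
  have Kl: "K (1 / 3) * (K (1 + 3 * q) * h) = K q * h + K (1 / 3) * h" for h
    unfolding mult.assoc[symmetric] K by (rule distrib_right)
  define fx where "fx = fconst (1 / 3) * (fvar Gx - 1 + fconst (1 + 3 * q) * fvar Ga)"
  define fy where "fy = fvar Gy + fconst p * fvar Gb"
  have n: "nx = cl fx" "ny = cl fy" by (simp_all add: nx_def ny_def fx_def fy_def cl)
  have "comult_free fx = embR (fx - fconst q * fvar Ga) + embL fx * embR (fvar Ga)"
    by (simp add: fx_def L R C e comult_free_var comult_gen_def distrib_left distrib_right left_diff_distrib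
        right_diff_distrib mult.assoc Kl)
  then have "\<Delta> (j nx) = AA.pt \<one>\<^bsub>A\<^esub> (j (nx - cl (fconst q) * na)) \<oplus>\<^bsub>AA.T\<^esub> AA.pt (j nx) (j na)"
    by (simp add: n \<Delta>_eq E.alg_eval_add E_emb_mult E_emb(2)) (simp add: cl)
  then show "\<Delta> gx = AA.pt \<one>\<^bsub>A\<^esub> (gx \<ominus>\<^bsub>A\<^esub> q \<odot>\<^bsub>A\<^esub> ga) \<oplus>\<^bsub>AA.TA\<^esub> AA.pt gx ga"
    by (simp add: j_simps j_scalar_mult[of _ na, unfolded j_gens] j_scalar_mult[of _ nb, unfolded j_gens] j_gens)
  have "comult_free fy = embR (fy - fconst p * fvar Gb) + embL fy * embR (fvar Gb)"
    by (simp add: fy_def L R C e comult_free_var comult_gen_def distrib_left distrib_right mult.assoc)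
  then have "\<Delta> (j ny) = AA.pt \<one>\<^bsub>A\<^esub> (j (ny - cl (fconst p) * nb)) \<oplus>\<^bsub>AA.T\<^esub> AA.pt (j ny) (j nb)"
    by (simp add: n \<Delta>_eq E.alg_eval_add E_emb_mult E_emb(2)) (simp add: cl)
  then show "\<Delta> gy = AA.pt \<one>\<^bsub>A\<^esub> (gy \<ominus>\<^bsub>A\<^esub> p \<odot>\<^bsub>A\<^esub> gb) \<oplus>\<^bsub>AA.TA\<^esub> AA.pt gy gb"
    by (simp add: j_simps j_scalar_mult[of _ na, unfolded j_gens] j_scalar_mult[of _ nb, unfolded j_gens] j_gens)
qed

lemma counit_coordinates: "\<epsilon> gx = q" "\<epsilon> gy = p" "\<epsilon> ga = 1" "\<epsilon> gb = 1"
proof -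
  have g: "\<epsilon> (j nu) = 0" "\<epsilon> (j nz) = 0" "\<epsilon> (j na) = 1" "\<epsilon> (j nb) = 1"
    by (simp_all add: \<epsilon>_gen counit_gen_def)
  have "nx + cl (fconst (1 / 3)) = cl (fconst (1 / 3)) * (nu + cl (fconst (1 + 3 * q)) * na)"
    by (simp add: nx_def algebra_simps)
  then have "\<epsilon> (j (nx + cl (fconst (1 / 3)))) = \<epsilon> (j (cl (fconst (1 / 3)) * (nu + cl (fconst (1 + 3 * q)) * na)))"
    by simp
  then have "\<epsilon> (j nx) + 1 / 3 = 1 / 3 * (1 + 3 * q)" unfolding \<epsilon>_simps g by simp
  then show "\<epsilon> gx = q" by (simp add: j_gens field_simps)
  have "\<epsilon> (j ny) = p" unfolding ny_def \<epsilon>_simps g by simp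
  then show "\<epsilon> gy = p" by (simp add: j_gens)
  show "\<epsilon> ga = 1" "\<epsilon> gb = 1" using g by (simp_all add: j_gens)
qed

lemma inv_b: "inv\<^bsub>A\<^esub> gb = j NA.b'"
proof (rule monoid.inv_char[OF A.monoid_axioms])
  show "gb \<otimes>\<^bsub>A\<^esub> j NA.b' = \<one>\<^bsub>A\<^esub>" "j NA.b' \<otimes>\<^bsub>A\<^esub> gb = \<one>\<^bsub>A\<^esub>"
    unfolding j_gens(5)[symmetric] j_simps(3)[symmetric] j_simps(4)[symmetric] by (simp_all add: NA.b'_rels)
qed (simp_all add: j_simps flip: j_gens)

lemma antipode_coordinates:
  "S gx = (q \<odot>\<^bsub>A\<^esub> \<one>\<^bsub>A\<^esub>) \<ominus>\<^bsub>A\<^esub> ((gx \<ominus>\<^bsub>A\<^esub> (q \<odot>\<^bsub>A\<^esub> \<one>\<^bsub>A\<^esub>)) \<otimes>\<^bsub>A\<^esub> ga')"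
  "S gy = (p \<odot>\<^bsub>A\<^esub> \<one>\<^bsub>A\<^esub>) \<ominus>\<^bsub>A\<^esub> ((gy \<ominus>\<^bsub>A\<^esub> (p \<odot>\<^bsub>A\<^esub> \<one>\<^bsub>A\<^esub>)) \<otimes>\<^bsub>A\<^esub> inv\<^bsub>A\<^esub> gb)"
  "S ga = ga'" "S gb = inv\<^bsub>A\<^esub> gb"
proof -
  have S_add: "S (j (r + s)) = S (j r) \<oplus>\<^bsub>A\<^esub> S (j s)" for r s
    using module_homsD(2)[OF S, of "j r" "j s"] by (simp add: j_simps)
  have S_sc: "S (j (cl (fconst c) * r)) = c \<odot>\<^bsub>A\<^esub> S (j r)" for c r
    using module_homsD(3)[OF S, of c "j r"] by (simp add: j_simps j_scalar_mult)
  have g: "S (j nu) = j (- (nu * na'))" "S (j nz) = j (- (nz * NA.b'))" "S (j na) = j na'" "S (j nb) = j NA.b'"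
    "S (j 1) = j 1"
    by (simp_all add: S_gen antipode_gen_def S_one j_simps(4))
  show "S ga = ga'" "S gb = inv\<^bsub>A\<^esub> gb" using g by (simp_all add: j_gens inv_b)
  have sc: "cl (fconst (c + d)) = cl (fconst c) + cl (fconst d)" "cl (fconst (c * d)) = cl (fconst c) * cl (fconst d)"
    for c d by (simp_all add: fconst_add fconst_mult ring_mapD[OF cl_ring_map])
  have K: "cl (fconst (1 / 3)) * cl (fconst (1 + 3 * q)) = cl (fconst q) + cl (fconst (1 / 3))"
  proof -
    have "1 / 3 * (1 + 3 * q) = q + 1 / 3" by (simp add: field_simps)
    then show ?thesis by (simp only: sc(2)[symmetric] sc(1)[symmetric])
  qed
  then have Kl: "cl (fconst (1 / 3)) * (cl (fconst (1 + 3 * q)) * h) = cl (fconst q) * h + cl (fconst (1 / 3)) * h" for h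
    by (simp only: mult.assoc[symmetric] distrib_right)
  have m: "cl (fconst (- 1 / 3)) = - cl (fconst (1 / 3))"
    using sc(1)[of "- 1 / 3" "1 / 3"] by (simp add: eq_neg_iff_add_eq_0 ring_mapD[OF cl_ring_map])
  have nx: "nx = cl (fconst (1 / 3)) * nu + (cl (fconst (1 / 3)) * (cl (fconst (1 + 3 * q)) * na) + cl (fconst (- 1 / 3)) * 1)"
    unfolding m by (simp add: nx_def algebra_simps)
  have "S (j nx) = j (cl (fconst (1 / 3)) * - (nu * na')
      + (cl (fconst (1 / 3)) * (cl (fconst (1 + 3 * q)) * na') + cl (fconst (- 1 / 3)) * 1))"
    unfolding nx S_add S_sc g unfolding j_simps(2,5) ..
  also have "cl (fconst (1 / 3)) * - (nu * na')
      + (cl (fconst (1 / 3)) * (cl (fconst (1 + 3 * q)) * na') + cl (fconst (- 1 / 3)) * 1)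
    = cl (fconst q) * 1 - (nx - cl (fconst q) * 1) * na'"
  proof -
    define C where "C = cl (fconst (1 + 3 * q))"
    show ?thesis
      unfolding m nx_def C_def[symmetric] by (simp add: algebra_simps K[folded C_def] Kl[folded C_def])
  qed
  finally show "S gx = (q \<odot>\<^bsub>A\<^esub> \<one>\<^bsub>A\<^esub>) \<ominus>\<^bsub>A\<^esub> ((gx \<ominus>\<^bsub>A\<^esub> (q \<odot>\<^bsub>A\<^esub> \<one>\<^bsub>A\<^esub>)) \<otimes>\<^bsub>A\<^esub> ga')"
    unfolding j_simps(5,7) unfolding j_simps(3) unfolding j_simps(5,7) unfolding j_simps(4) j_gens .
  have "S (j ny) = j (- (nz * NA.b') + cl (fconst p) * NA.b')"
    unfolding ny_def S_add S_sc g unfolding j_simps(2,5) ..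
  also have "- (nz * NA.b') + cl (fconst p) * NA.b' = cl (fconst p) * 1 - (ny - cl (fconst p) * 1) * NA.b'"
    by (simp add: ny_def algebra_simps NA.b'_rels)
  finally show "S gy = (p \<odot>\<^bsub>A\<^esub> \<one>\<^bsub>A\<^esub>) \<ominus>\<^bsub>A\<^esub> ((gy \<ominus>\<^bsub>A\<^esub> (p \<odot>\<^bsub>A\<^esub> \<one>\<^bsub>A\<^esub>)) \<otimes>\<^bsub>A\<^esub> inv\<^bsub>A\<^esub> gb)"
    unfolding j_simps(5,7) unfolding j_simps(3) unfolding j_simps(5,7) unfolding j_simps(4) j_gens inv_b .
qed

text \<open>The image of \<open>B \<otimes> A\<close> is a subalgebra, so its preimage under \<open>\<Delta>\<close> is one as well, and it is enough
  that it contains \<open>x\<close> and \<open>y\<close>.\<close>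

lemma right_coideal:
  assumes sub: "is_subalgebra kk B A" and gen: "B = generated_subalgebra kk A {gx, gy}"
  shows "right_coideal_subalgebra kk A \<Delta> B"
proof -
  let ?B = "A\<lparr>carrier := B\<rparr>"
  let ?\<tau> = "tensor_map kk A A (\<lambda>u. u) (\<lambda>u. u)"
  define Im where "Im = ?\<tau> ` carrier (tensor_module kk ?B A)"
  have sr: "subring B A" and sm: "submodule B kk A" using sub by (simp_all add: is_subalgebra_def)
  have BA: "B \<subseteq> carrier A" by (rule subringE(1)[OF sr])
  interpret R: ring ?B by (rule A.subring_is_ring[OF sr])
  interpret M: module kk ?B by (rule submodule.submodule_is_module[OF sm A.module_axioms])
  interpret B: associative_algebra kk ?B
    by unfold_locales (use BA in \<open>auto simp: A.smult_mult_left A.smult_mult_right subset_iff\<close>)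
  interpret BA: two_algebras kk ?B A
    by (simp add: two_algebras_def B.associative_algebra_axioms A.associative_algebra_axioms)
  have i: "(\<lambda>u. u) \<in> algebra_homs kk ?B A"
    by (intro algebra_homsI module_homsI) (use BA in auto)
  note i' = id_algebra_hom[of kk A]
  note D = algebra_homsD[OF tensor_map_algebra_hom[OF BA.two_algebras_axioms AA.two_algebras_axioms i i'], simplified]
  note P = tensor_map_pure[OF BA.tensor_product_axioms AA.tensor_product_axioms algebra_homsD(1)[OF i] algebra_homsD(1)[OF i'], simplified]
  have Xp: "AA.pt u v \<in> Im" if "u \<in> B" "v \<in> carrier A" for u v
    unfolding Im_def using P[of u v] that BA.pure_closed[of u v] by (intro image_eqI[of _ _ "BA.pt u v"]) auto
  have Xa: "s \<oplus>\<^bsub>AA.T\<^esub> t \<in> Im" if "s \<in> Im" "t \<in> Im" for s t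
    using that D(3) BA.T.a_closed unfolding Im_def by (auto simp flip: D(3))
  have Xm: "s \<otimes>\<^bsub>AA.TA\<^esub> t \<in> Im" if "s \<in> Im" "t \<in> Im" for s t
    using that BA.mult_closed_TA unfolding Im_def by (auto simp flip: D(4))
  have Xs: "c \<odot>\<^bsub>AA.T\<^esub> s \<in> Im" if "s \<in> Im" for c s
    using that module.smult_closed[OF BA.T_module, of c] unfolding Im_def by (auto simp flip: D(5))
  note De = algebra_homsD[OF \<Delta>, simplified]
  have g: "gx \<in> B" "gy \<in> B" unfolding gen generated_subalgebra_def by auto
  have gc: "gx \<in> carrier A" "gy \<in> carrier A" "ga \<in> carrier A" "gb \<in> carrier A"
    by (simp_all add: j_simps flip: j_gens)
  have one: "\<one>\<^bsub>A\<^esub> \<in> B" by (rule subringE(3)[OF sr])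
  define C where "C = {z \<in> B. \<Delta> z \<in> Im}"
  have CA: "C \<subseteq> carrier A" using BA by (auto simp: C_def)
  have C_add: "s \<oplus>\<^bsub>A\<^esub> t \<in> C" if "s \<in> C" "t \<in> C" for s t
    using that BA subringE(7)[OF sr] Xa unfolding C_def by (auto simp: De subset_iff)
  have C_mult: "s \<otimes>\<^bsub>A\<^esub> t \<in> C" if "s \<in> C" "t \<in> C" for s t
    using that BA subringE(6)[OF sr] Xm unfolding C_def by (auto simp: De subset_iff)
  have C_smult: "c \<odot>\<^bsub>A\<^esub> s \<in> C" if "s \<in> C" for c s
    using that BA A.submoduleE(4)[OF sm] Xs unfolding C_def by (auto simp: De subset_iff)
  have C_one: "\<one>\<^bsub>A\<^esub> \<in> C" using one Xp[OF one] by (simp add: C_def De)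
  have C_minus: "\<ominus>\<^bsub>A\<^esub> s \<in> C" if s: "s \<in> C" for s
  proof -
    obtain r where r: "s = j r" using s CA carrier_A by auto
    have m1: "cl (fconst (- 1 :: 'k)) + cl (fconst 1) = cl (fconst (- 1 + 1))"
      by (simp only: fconst_add ring_mapD(3)[OF cl_ring_map])
    have "cl (fconst (- 1)) * r + r = (cl (fconst (- 1)) + cl (fconst 1)) * r"
      by (simp add: distrib_right ring_mapD(2)[OF cl_ring_map])
    also have "\<dots> = 0" unfolding m1 by (simp add: ring_mapD(1)[OF cl_ring_map])
    finally have "j (cl (fconst (- 1)) * r + r) = j 0" by simp
    then have e: "(- 1) \<odot>\<^bsub>A\<^esub> j r \<oplus>\<^bsub>A\<^esub> j r = \<zero>\<^bsub>A\<^esub>" by (simp only: j_simps(2,5,6))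
    have "\<ominus>\<^bsub>A\<^esub> s = (- 1) \<odot>\<^bsub>A\<^esub> s"
      unfolding r by (rule A.minus_equality[OF e]) (simp_all add: j_simps(1))
    then show ?thesis using C_smult[OF s] by simp
  qed
  have C_zero: "\<zero>\<^bsub>A\<^esub> \<in> C"
    using C_add[OF C_minus[OF C_one] C_one] A.l_neg[of "\<one>\<^bsub>A\<^esub>"] by simp
  have "subring C A" by (rule A.subringI[OF CA C_one C_minus C_mult C_add])
  moreover have "submodule C kk A" by (rule A.submoduleI[OF CA C_zero C_minus C_add C_smult])
  ultimately have "is_subalgebra kk C A" by (simp add: is_subalgebra_def)
  moreover have "gx \<in> C" "gy \<in> C"
    unfolding C_def using g gc one by (auto simp: comult_coordinates intro!: Xa Xp)
  ultimately have "B \<subseteq> C" unfolding gen generated_subalgebra_def by auto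
  then have "\<Delta> ` B \<subseteq> Im" by (auto simp: C_def)
  then show ?thesis using sub by (simp add: right_coideal_subalgebra_def Im_def)
qed

lemma comult_grouplike: "\<Delta> ga = AA.pt ga ga" "\<Delta> gb = AA.pt gb gb"
  using \<Delta>_gens(3,5) by (simp_all add: j_gens)

end

lemma (in nodal_tensor) nodal_maps_exist: "\<exists>\<Delta> \<epsilon> S. nodal_maps q p \<Delta> \<epsilon> S"
proof -
  obtain \<Delta> where D: "\<Delta> \<in> algebra_homs kk A AA.TA" "\<And>f. \<Delta> (j (cl f)) = E (comult_free f)"
    by (rule comult_exists[OF that])
  obtain \<epsilon> where e: "\<epsilon> \<in> algebra_homs kk A (regular_module kk)" "\<And>g. \<epsilon> (j (cl (fvar g))) = counit_gen g"
    by (rule counit_exists[OF that])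
  obtain S where S: "S \<in> module_homs kk A A" "S \<one>\<^bsub>A\<^esub> = \<one>\<^bsub>A\<^esub>"
    "\<And>x y. \<lbrakk>x \<in> carrier A; y \<in> carrier A\<rbrakk> \<Longrightarrow> S (x \<otimes>\<^bsub>A\<^esub> y) = S y \<otimes>\<^bsub>A\<^esub> S x"
    "\<And>g. S (j (cl (fvar g))) = j (antipode_gen g)"
    by (rule antipode_exists[OF that])
  have "nodal_maps q p \<Delta> \<epsilon> S"
    by unfold_locales ((rule D e S(1,2,4)) | (rule S(3); assumption))+
  then show ?thesis by blast
qed

section \<open>The quantum homogeneous space structure\<close>

theorem mainTheorem1:
  fixes q p :: "'k::{alg_closed_field, field_char_0}"
  assumes "p^2 = q^2 + q^3"
  shows "let
      k = ring_of_type_algebra :: 'k ring;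
      A = nodal_hopf q p;
      x = nodal_gen q p Gx;
      y = nodal_gen q p Gy;
      a = nodal_gen q p Ga;
      a' = nodal_gen q p Gainv;
      b = nodal_gen q p Gb;
      AA = tensor_algebra k A A;
      t = pure_tensor k A A;
      B = generated_subalgebra k A {x, y}
    in
      (\<exists>\<Delta> \<epsilon> S.
        hopf_algebra k A \<Delta> \<epsilon> S \<and>
        \<Delta> x = t \<one>\<^bsub>A\<^esub> (x \<ominus>\<^bsub>A\<^esub> q \<odot>\<^bsub>A\<^esub> a) \<oplus>\<^bsub>AA\<^esub> t x a \<and>
        \<Delta> y = t \<one>\<^bsub>A\<^esub> (y \<ominus>\<^bsub>A\<^esub> p \<odot>\<^bsub>A\<^esub> b) \<oplus>\<^bsub>AA\<^esub> t y b \<and>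
        \<Delta> a = t a a \<and>
        \<Delta> b = t b b \<and>
        \<epsilon> x = q \<and> \<epsilon> y = p \<and> \<epsilon> a = 1 \<and> \<epsilon> b = 1 \<and>
        S x = (q \<odot>\<^bsub>A\<^esub> \<one>\<^bsub>A\<^esub>) \<ominus>\<^bsub>A\<^esub> ((x \<ominus>\<^bsub>A\<^esub> (q \<odot>\<^bsub>A\<^esub> \<one>\<^bsub>A\<^esub>)) \<otimes>\<^bsub>A\<^esub> a') \<and>
        S y = (p \<odot>\<^bsub>A\<^esub> \<one>\<^bsub>A\<^esub>) \<ominus>\<^bsub>A\<^esub> ((y \<ominus>\<^bsub>A\<^esub> (p \<odot>\<^bsub>A\<^esub> \<one>\<^bsub>A\<^esub>)) \<otimes>\<^bsub>A\<^esub> inv\<^bsub>A\<^esub> b) \<and>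
        S a = a' \<and>
        S b = inv\<^bsub>A\<^esub> b \<and>
        right_coideal_subalgebra k A \<Delta> B) \<and>
      (\<exists>\<phi> \<in> algebra_isos k nodal_cubic (A\<lparr>carrier := B\<rparr>).
        \<phi> (cubic_ideal +>\<^bsub>poly_XY\<^esub> poly_X) = x \<and>
        \<phi> (cubic_ideal +>\<^bsub>poly_XY\<^esub> poly_Y) = y) \<and>
      free_module (A\<lparr>carrier := B\<rparr>) (regular_module A) \<and>
      faithfully_flat TYPE('n) (A\<lparr>carrier := B\<rparr>) (regular_module A)"
proof -
  obtain w :: 'k where "poly [:1, 1, 1:] w = 0"
    using alg_closed_imp_poly_has_root[of "[:1, 1, 1:] :: 'k poly"] by auto
  then have w: "w * w + w + 1 = 0" by (simp add: algebra_simps)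
  have nb: "nodal_basis q p w" and nt: "nodal_tensor q p"
    using assms w by (simp_all add: nodal_basis_def nodal_tensor_def nodal_def nodal_representation_def)
  note B = nodal_basis.B_structure[OF nb]
  obtain \<Delta> \<epsilon> S where m: "nodal_maps q p \<Delta> \<epsilon> S"
    using nodal_tensor.nodal_maps_exist[OF nt] by blast
  show ?thesis
    unfolding Let_def
    using nodal_maps.hopf[OF m] nodal_maps.comult_coordinates[OF m] nodal_maps.comult_grouplike[OF m]
      nodal_maps.counit_coordinates[OF m] nodal_maps.antipode_coordinates[OF m]
      nodal_maps.right_coideal[OF m B(1) refl] B(2-4)
    by (intro conjI exI[of _ \<Delta>] exI[of _ \<epsilon>] exI[of _ S]) assumption+
qed

end
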